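(* Let $n\ge 2$ be an even integer and $m\ge 8$. Then the pebbling number of the Jahangir graph satisfies $$f(J_{n,m})=f_{2^{n/2+1}-1}(C_{n+2})+\alpha+1,$$ where $$\alpha=\begin{cases}\frac{m}{2}\big(f(C_n)+f(C_{n+2})-2\big)-f(C_{n+2})+1, & m \text{ even},\\[2pt] \frac{m-1}{2}\big(f(C_n)+f(C_{n+2})-2\big)+f(C_{n+1})-f(C_{n+2}), & m\text{ odd}.\end{cases}$$ In particular, $f(J_{2,m})=2m+10$ for $m\ge 8$.
   Context: The Jahangir graph $J_{n,m}$ ($m\ge3$) consists of the cycle $C_{nm}=v_0v_1\cdots v_{nm-1}v_0$ together with an extra vertex $u$ adjacent to $v_{ni}$ for $0\le i\le m-1$. A pebbling distribution assigns a nonnegative integer number of pebbles to each vertex. A pebbling move removes two pebbles from a vertex and places one pebble on an adjacent vertex. For a graph $G$ and integer $t\ge1$, the $t$-fold pebbling number $f_t(G)$ is the least $p$ such that from every distribution of $p$ pebbles on $G$ and for every vertex $w$, some sequence of pebbling moves results in at least $t$ pebbles on $w$; the pebbling number is $f(G)=f_1(G)$. $C_k$ is the cycle on $k$ vertices, with $f(C_{2k'})=2^{k'}$ and $f(C_{2k'+1})=2\lfloor 2^{k'+1}/3\rfloor+1$ (these formulas also used as the convention for $k<3$, e.g. $f(C_2)=2$). *)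

theory Defs
  imports Main
begin

type_synonym graph = "nat set \<times> (nat \<Rightarrow> nat \<Rightarrow> bool)"

definition verts :: "graph \<Rightarrow> nat set" where "verts G = fst G"
definition adj :: "graph \<Rightarrow> nat \<Rightarrow> nat \<Rightarrow> bool" where "adj G = snd G"

definition cycle_graph :: "nat \<Rightarrow> graph" where
  "cycle_graph k = ({0..<k}, \<lambda>i j. i < k \<and> j < k \<and> i \<noteq> j \<and>
       (j = (i + 1) mod k \<or> i = (j + 1) mod k))"

text \<open>Jahangir graph J_{n,m}: cycle vertices v_i = i for i < n*m, and the extra vertex u = n*m,
  adjacent to v_{n*i} for i < m.\<close>
definition jahangir :: "nat \<Rightarrow> nat \<Rightarrow> graph" where
  "jahangir n m = ({0..n*m},
     \<lambda>i j. (i < n*m \<and> j < n*m \<and> i \<noteq> j \<and> (j = (i + 1) mod (n*m) \<or> i = (j + 1) mod (n*m)))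
          \<or> (i = n*m \<and> (\<exists>k<m. j = n*k)) \<or> (j = n*m \<and> (\<exists>k<m. i = n*k)))"

definition pebbling_move :: "graph \<Rightarrow> (nat \<Rightarrow> nat) \<Rightarrow> (nat \<Rightarrow> nat) \<Rightarrow> bool" where
  "pebbling_move G D D' \<longleftrightarrow> (\<exists>v w. v \<in> verts G \<and> w \<in> verts G \<and> adj G v w \<and> 2 \<le> D v \<and>
       D' = (D(v := D v - 2))(w := D w + 1))"

definition distribution :: "graph \<Rightarrow> (nat \<Rightarrow> nat) \<Rightarrow> nat \<Rightarrow> bool" where
  "distribution G D p \<longleftrightarrow> (\<forall>x. x \<notin> verts G \<longrightarrow> D x = 0) \<and> sum D (verts G) = p"

definition t_pebbling_number :: "nat \<Rightarrow> graph \<Rightarrow> nat" where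
  "t_pebbling_number t G = (LEAST p. \<forall>D. distribution G D p \<longrightarrow>
      (\<forall>w\<in>verts G. \<exists>D'. (pebbling_move G)\<^sup>*\<^sup>* D D' \<and> t \<le> D' w))"

definition pebbling_number :: "graph \<Rightarrow> nat" where
  "pebbling_number G = t_pebbling_number 1 G"

text \<open>f(C_k) via the known formulas (also the convention for k < 3).\<close>
definition fC :: "nat \<Rightarrow> nat" where
  "fC k = (if even k then 2 ^ (k div 2) else 2 * ((2 ^ (k div 2 + 1)) div 3) + 1)"

definition jahangir_alpha :: "nat \<Rightarrow> nat \<Rightarrow> int" where
  "jahangir_alpha n m = (if even m
     then int (m div 2) * (int (fC n) + int (fC (n+2)) - 2) - int (fC (n+2)) + 1
     else int ((m - 1) div 2) * (int (fC n) + int (fC (n+2)) - 2) + int (fC (n+1)) - int (fC (n+2)))"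

end

(*
  Let n = 2k and Z = 2^k, and call the pieces of the big cycle between consecutive neighbours of the
  hub u segments.

  Upper bound.  It is enough to bring 2^d pebbles to u, where d <= k + 1 is the distance from u to
  the root.  While a segment together with u contains 2Z pebbles, these give one pebble on u, since
  f(C_(n+2)) = 2Z.  A segment from which nothing can be brought to u any more has fewer than Z
  pebbles, or fewer than f(C_(n+1)) and one usable end, or fewer than 2Z and can still send a pebble
  to either of its ends: merging the ends of the segment, or joining one of them to u, turns the
  three claims into f(C_n), f(C_(n+1)), f(C_(n+2)).  Two pebbles meeting at a neighbour of u give one
  more pebble on u, and going once around the cycle greedily one finds as many such meetings as
  the number of usable ends, compared with m, allows.  Counting then succeeds unless the root is
  the midpoint of an empty segment and exactly one pebble is missing; in that case one of
  the two spokes next to the root receives a pebble directly, which saves two pebbles on u.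

  Lower bound.  The root is the midpoint of segment 0.  The midpoint of segment 4 carries 4Z^2 - 1
  pebbles, the other even and odd segments 2Z - 1 and Z - 1; if m is odd, the parity defect is hidden
  in two piles of size floor(2Z/3) in segment 6.  To see that the root is unreachable, assign to
  every pebble one of four roles: it moves to the spoke below or above its segment, or it travels to
  the root along the cycle, in one of the two directions.  The worth of such an assignment, with
  all contributions rounded down, counts hub pebbles; its maximum never increases under
  pebbling moves, is at most 2Z - 1 initially, and is at least 2Z once the root is occupied.
*)

theory Submission
  imports Defs Complex_Main "HOL-Library.Function_Algebras"
begin

text \<open>Where the value comes from: a root in the middle of an empty segment needs 2Z pebbles on
  u, and a pebble on u costs 2Z pebbles at a midpoint, so a pile of 4Z^2 - 1 is just too small.
  Further pebbles can be stored without effect because of rounding. A segment with 2Z - 1 pebbles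
  can send one pebble to either end, but none beyond; it meets no partner if its neighbours hold Z -
  1 and send nothing. This stores 3Z - 2 per two segments. For odd m strict alternation is
  impossible, and the odd segment stores f(C_(n+1)) - 1, the largest load for which the segment
  cannot be sure to have two usable ends. A linear weight would also credit pebbles that get stuck
  before a spoke, and a pile with two usable ends would be credited twice. So the potential of the
  lower bound contains the rounding, and each pebble must choose a direction. The maximum over all
  choices is controlled backwards: a choice made after a move is pulled back to one before the move
  that is worth at least as much.\<close>

section \<open>Reachability as a monotone and additive relation\<close>

definition single :: "nat \<Rightarrow> nat \<Rightarrow> nat \<Rightarrow> nat" where
  "single v a = (\<lambda>x. if x = v then a else 0)"

definition edge :: "graph \<Rightarrow> nat \<Rightarrow> nat \<Rightarrow> bool" where
  "edge G v w \<longleftrightarrow> v \<in> verts G \<and> w \<in> verts G \<and> adj G v w"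

text \<open>The target is only a lower bound for the configuration reached, so that pieces of a distribution
  can be treated separately and their results added.\<close>

definition yields :: "graph \<Rightarrow> (nat \<Rightarrow> nat) \<Rightarrow> (nat \<Rightarrow> nat) \<Rightarrow> bool" where
  "yields G D E \<longleftrightarrow> (\<exists>D'. (pebbling_move G)\<^sup>*\<^sup>* D D' \<and> E \<le> D')"

declare plus_fun_apply [simp del] zero_fun_apply [simp del]

lemma single_apply: "single v a x = (if x = v then a else 0)"
  by (simp add: single_def)

lemma single_0 [simp]: "single v 0 = 0"
  by (simp add: fun_eq_iff single_apply plus_fun_apply zero_fun_apply)

lemma single_add: "single v (a + b) = single v a + single v b"
  by (simp add: fun_eq_iff single_apply plus_fun_apply zero_fun_apply)

lemma sum_fun_apply: "(\<Sum>i\<in>A. f i) x = (\<Sum>i\<in>A. f i x)"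
  for f :: "'i \<Rightarrow> 'b \<Rightarrow> 'c::comm_monoid_add"
  by (induction A rule: infinite_finite_induct) (auto simp: plus_fun_apply zero_fun_apply)

lemmas pointwise = single_apply plus_fun_apply zero_fun_apply le_fun_def

lemma pebbling_moveI:
  assumes "v \<in> verts G" "w \<in> verts G" "adj G v w" "2 \<le> D v"
    "D' = (D(v := D v - 2))(w := D w + 1)"
  shows "pebbling_move G D D'"
  using assms unfolding pebbling_move_def by blast

lemma pebbling_move_add:
  assumes "pebbling_move G D D'" shows "pebbling_move G (D + F) (D' + F)"
proof -
  obtain v w where "v \<in> verts G" "w \<in> verts G" "adj G v w" "2 \<le> D v"
    "D' = (D(v := D v - 2))(w := D w + 1)"
    using assms by (auto simp: pebbling_move_def)
  then show ?thesis
    by (intro pebbling_moveI[of v G w]) (auto simp: plus_fun_apply fun_eq_iff)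
qed

lemma pebbling_moves_add:
  assumes "(pebbling_move G)\<^sup>*\<^sup>* D D'" shows "(pebbling_move G)\<^sup>*\<^sup>* (D + F) (D' + F)"
  using assms
proof induction
  case (step D1 D2)
  then show ?case using pebbling_move_add by (meson rtranclp.rtrancl_into_rtrancl)
qed simp

lemma yields_le: "E \<le> D \<Longrightarrow> yields G D E"
  unfolding yields_def by blast

lemma yields_refl: "yields G D D"
  by (simp add: yields_le)

lemma yields_trans:
  assumes "yields G D E" "yields G E F" shows "yields G D F"
proof -
  obtain D' where D': "(pebbling_move G)\<^sup>*\<^sup>* D D'" "E \<le> D'"
    using assms by (auto simp: yields_def)
  obtain E' where E': "(pebbling_move G)\<^sup>*\<^sup>* E E'" "F \<le> E'"
    using assms by (auto simp: yields_def)
  \<comment> \<open>The surplus of \<open>D'\<close> over \<open>E\<close> is a spectator while the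
    moves that start from \<open>E\<close> are replayed.\<close>
  have "E + (D' - E) = D'"
    using D' by (auto simp: fun_eq_iff plus_fun_apply le_fun_def)
  then have "(pebbling_move G)\<^sup>*\<^sup>* D' (E' + (D' - E))"
    using pebbling_moves_add[OF E'(1), of "D' - E"] by simp
  moreover have "F \<le> E' + (D' - E)"
    using E'(2) by (simp add: le_fun_def plus_fun_apply trans_le_add1)
  ultimately show ?thesis
    using D'(1) unfolding yields_def by (meson rtranclp_trans)
qed

lemma yields_add:
  assumes "yields G D E" "yields G D' E'" shows "yields G (D + D') (E + E')"
proof -
  have *: "yields G (A + C) (B + C)" if AB: "yields G A B" for A B C
  proof -
    obtain A' where "(pebbling_move G)\<^sup>*\<^sup>* A A'" "B \<le> A'"
      using AB by (auto simp: yields_def)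
    then have "(pebbling_move G)\<^sup>*\<^sup>* (A + C) (A' + C)" "B + C \<le> A' + C"
      using pebbling_moves_add by (auto simp: pointwise)
    then show ?thesis by (auto simp: yields_def)
  qed
  show ?thesis
    using *[OF assms(1), of D'] *[OF assms(2), of E]
    by (metis add.commute yields_trans)
qed

lemma yields_sum:
  assumes "\<And>i. i \<in> A \<Longrightarrow> yields G (f i) (g i)"
  shows "yields G (\<Sum>i\<in>A. f i) (\<Sum>i\<in>A. g i)"
  using assms
proof (induction A rule: infinite_finite_induct)
  case (insert x A)
  then show ?case by (simp add: yields_add)
qed (auto simp: yields_refl)

lemma yields_mono:
  assumes "yields G D E" "D \<le> D'" "E' \<le> E" shows "yields G D' E'"
  using assms yields_le yields_trans by blast

lemma yields_add_left: "yields G D E \<Longrightarrow> yields G (D + F) E"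
  by (erule yields_mono) (auto simp: pointwise)

lemma yields_add_right: "yields G D E \<Longrightarrow> yields G (F + D) E"
  by (erule yields_mono) (auto simp: pointwise)

lemma yields_edge:
  assumes "edge G v w" shows "yields G (single v (2 * a)) (single w a)"
proof (induction a)
  case (Suc a)
  have "pebbling_move G (single v 2) ((single v 2)(v := single v 2 v - 2, w := single v 2 w + 1))"
    using assms unfolding edge_def by (intro pebbling_moveI[of v G w]) (auto simp: single_apply fun_eq_iff)
  then have "yields G (single v 2) (single w 1)"
    unfolding yields_def
    by (intro exI[of _ "(single v 2)(v := single v 2 v - 2, w := single v 2 w + 1)"] conjI r_into_rtranclp)
      (auto simp: pointwise)
  from yields_add[OF this Suc.IH] show ?case
    using single_add[of v 2 "2 * a"] single_add[of w 1 a] by simp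
qed (simp add: yields_refl)

lemma yields_edge_div:
  assumes "edge G v w" shows "yields G (single v a) (single w (a div 2))"
  by (rule yields_mono[OF yields_edge[OF assms, of "a div 2"]]) (auto simp: pointwise)

text \<open>The far end is pushed one step inwards as completely as possible, which shortens the
  path; pebbles spread over the path do as well as one pile at its end.\<close>

lemma yields_path:
  assumes "\<And>j. j < d \<Longrightarrow> edge G (y (Suc j)) (y j)" "2 ^ d \<le> (\<Sum>j\<le>d. p j)"
  shows "yields G (\<Sum>j\<le>d. single (y j) (p j)) (single (y 0) 1)"
  using assms
proof (induction d arbitrary: p)
  case 0
  then show ?case by (intro yields_le) (simp add: pointwise)
next
  case (Suc d)
  define p' where "p' = p(d := p d + p (Suc d) div 2)"
  have at: "{..d} = insert d {..<d}" by auto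
  let ?S = "\<Sum>j\<le>d. p j" and ?c = "p (Suc d)"
  have sp: "(\<Sum>j\<le>d. f (p' j) j) = (\<Sum>j<d. f (p j) j) + f (p d + ?c div 2) d"
    for f :: "nat \<Rightarrow> nat \<Rightarrow> 'z::comm_monoid_add"
    by (simp add: p'_def at add.commute)
  \<comment> \<open>If the rest of the path is empty, \<open>?c\<close> alone is at least 2^(d+1).
    Otherwise a pebble already there makes up for the one lost in halving.\<close>
  have "2 ^ d \<le> ?S + ?c div 2"
    using Suc.prems(2) by (cases "?S = 0") auto
  then have "2 ^ d \<le> (\<Sum>j\<le>d. p' j)"
    using sp[of "\<lambda>a j. a"] by (simp add: at ac_simps)
  then have "yields G (\<Sum>j\<le>d. single (y j) (p' j)) (single (y 0) 1)"
    by (intro Suc.IH Suc.prems(1)) simp_all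
  moreover have "yields G (\<Sum>j\<le>Suc d. single (y j) (p j)) (\<Sum>j\<le>d. single (y j) (p' j))"
  proof -
    have "yields G ((\<Sum>j\<le>d. single (y j) (p j)) + single (y (Suc d)) ?c)
       ((\<Sum>j\<le>d. single (y j) (p j)) + single (y d) (?c div 2))"
      using Suc.prems(1) by (intro yields_add yields_refl yields_edge_div) simp
    then show ?thesis
      using sp[of "\<lambda>a j. single (y j) a"]
      by (simp add: at single_add ac_simps)
  qed
  ultimately show ?case by (rule yields_trans[rotated])
qed

section \<open>Cycles\<close>

text \<open>Walks may revisit vertices; in particular the two ends may coincide, and then
  a walk of length $L$ is a cycle $C_L$ through its end.\<close>

definition walk :: "graph \<Rightarrow> (nat \<Rightarrow> nat) \<Rightarrow> nat \<Rightarrow> bool" where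
  "walk G y L \<longleftrightarrow> (\<forall>j<L. edge G (y j) (y (Suc j)) \<and> edge G (y (Suc j)) (y j))"

lemma walk_rev: "walk G y L \<Longrightarrow> walk G (\<lambda>j. y (L - j)) L"
  unfolding walk_def
proof (intro allI impI)
  fix j assume "\<forall>j<L. edge G (y j) (y (Suc j)) \<and> edge G (y (Suc j)) (y j)" "j < L"
  moreover from this have "L - Suc j < L" "Suc (L - Suc j) = L - j" by auto
  ultimately show "edge G (y (L - j)) (y (L - Suc j)) \<and> edge G (y (L - Suc j)) (y (L - j))"
    by metis
qed

text \<open>\<open>Suc K\<close> will be a middle vertex of the walk. Its pile enters with half its
  size, after which only a path of length \<open>K\<close> from \<open>y 0\<close> is left.\<close>

lemma yields_left_end:
  assumes "walk G y L" "Suc K \<le> L" "2 ^ K \<le> (\<Sum>j\<in>{1..<Suc K}. p j) + p (Suc K) div 2"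
  shows "yields G (\<Sum>j\<in>{1..<Suc (Suc K)}. single (y j) (p j)) (single (y 0) 1)"
proof -
  let ?c = "p (Suc K) div 2"
  define p' where "p' j = (if j = 0 then 0 else p j) + (if j = K then ?c else 0)" for j
  have sp: "(\<Sum>j\<le>K. f j (p' j)) = (\<Sum>j\<in>{1..<Suc K}. f j (p j)) + f K ?c"
    if f: "\<And>j. f j 0 = 0" "\<And>j a b. f j (a + b) = f j a + f j b"
    for f :: "nat \<Rightarrow> nat \<Rightarrow> 'z::comm_monoid_add"
  proof -
    have "(\<Sum>j\<le>K. f j (p' j))
      = (\<Sum>j\<le>K. f j (if j = 0 then 0 else p j)) + (\<Sum>j\<le>K. f j (if j = K then ?c else 0))"
      unfolding p'_def f by (rule sum.distrib)
    also have "(\<Sum>j\<le>K. f j (if j = 0 then 0 else p j)) = (\<Sum>j\<in>{1..<Suc K}. f j (p j))"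
      by (rule sum.mono_neutral_cong_right) (auto simp: f)
    also have "(\<Sum>j\<le>K. f j (if j = K then ?c else 0)) = (\<Sum>j\<le>K. if j = K then f j ?c else 0)"
      by (rule sum.cong) (auto simp: f)
    finally show ?thesis by simp
  qed
  have a: "yields G (\<Sum>j\<in>{1..<Suc (Suc K)}. single (y j) (p j))
      ((\<Sum>j\<in>{1..<Suc K}. single (y j) (p j)) + single (y K) ?c)"
  proof -
    have "yields G (single (y (Suc K)) (p (Suc K))) (single (y K) ?c)"
      using assms by (intro yields_edge_div) (auto simp: walk_def)
    then show ?thesis
      by (simp add: yields_add yields_refl)
  qed
  have b: "(\<Sum>j\<le>K. single (y j) (p' j)) = (\<Sum>j\<in>{1..<Suc K}. single (y j) (p j)) + single (y K) ?c"
    by (rule sp) (auto simp: single_add)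
  have c: "yields G (\<Sum>j\<le>K. single (y j) (p' j)) (single (y 0) 1)"
    using assms sp[of "\<lambda>j a. a"] by (intro yields_path) (auto simp: walk_def)
  show ?thesis using yields_trans[OF a c[unfolded b]] .
qed

lemma yields_right_end:
  assumes "walk G y L" "Suc K \<le> L" "2 ^ K \<le> (\<Sum>j\<in>{L - K..<L}. p j) + p (L - Suc K) div 2"
  shows "yields G (\<Sum>j\<in>{L - Suc K..<L}. single (y j) (p j)) (single (y L) 1)"
proof -
  have re: "(\<Sum>j\<in>{1..<Suc i}. f (L - j)) = (\<Sum>j\<in>{L - i..<L}. f j)" if "i \<le> L"
    for i and f :: "nat \<Rightarrow> 'z::comm_monoid_add"
    using that by (intro sum.reindex_bij_witness[of _ "\<lambda>j. L - j" "\<lambda>j. L - j"]) auto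
  have "yields G (\<Sum>j\<in>{1..<Suc (Suc K)}. single (y (L - j)) (p (L - j))) (single (y (L - 0)) 1)"
    using assms re[of K p]
    by (intro yields_left_end[OF walk_rev[OF assms(1)]]) auto
  then show ?thesis
    using re[of "Suc K" "\<lambda>j. single (y j) (p j)"] assms(2) by simp
qed

lemma even_cycle_arith:
  fixes A B M Z :: nat
  assumes "2 * Z \<le> A + M + B"
  shows "Z \<le> A + M div 2 \<or> Z \<le> B + M div 2"
proof -
  have "M \<le> 2 * (M div 2) + 1" by simp
  then show ?thesis using assms by linarith
qed

lemma yields_two_ends_even:
  assumes "walk G y (2 * Suc K)" "2 ^ Suc K \<le> (\<Sum>j\<in>{1..<2 * Suc K}. p j)"
  shows "yields G (\<Sum>j\<in>{1..<2 * Suc K}. single (y j) (p j)) (single (y 0) 1)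
    \<or> yields G (\<Sum>j\<in>{1..<2 * Suc K}. single (y j) (p j)) (single (y (2 * Suc K)) 1)"
proof -
  let ?L = "2 * Suc K" and ?M = "p (Suc K)"
  let ?A = "\<Sum>j\<in>{1..<Suc K}. p j" and ?B = "\<Sum>j\<in>{?L - K..<?L}. p j"
  have split: "(\<Sum>j\<in>{1..<?L}. f j) = (\<Sum>j\<in>{1..<Suc K}. f j) + f (Suc K) + (\<Sum>j\<in>{?L - K..<?L}. f j)"
    for f :: "nat \<Rightarrow> 'z::comm_monoid_add"
  proof -
    have "{1..<?L} = {1..<Suc K} \<union> {Suc K} \<union> {?L - K..<?L}" by auto
    then show ?thesis by (simp add: sum.union_disjoint ac_simps)
  qed
  have "2 ^ K \<le> ?A + ?M div 2 \<or> 2 ^ K \<le> ?B + ?M div 2"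
    by (rule even_cycle_arith) (use assms(2) in \<open>simp only: split power_Suc\<close>)
  then show ?thesis
  proof
    assume "2 ^ K \<le> ?A + ?M div 2"
    then have "yields G (\<Sum>j\<in>{1..<Suc (Suc K)}. single (y j) (p j)) (single (y 0) 1)"
      using assms(1) by (intro yields_left_end) auto
    then have "yields G ((\<Sum>j\<in>{1..<Suc K}. single (y j) (p j)) + single (y (Suc K)) ?M) (single (y 0) 1)"
      by simp
    then show ?thesis
      unfolding split by (intro disjI1 yields_add_left[of _ _ _ "sum _ _"])
  next
    assume "2 ^ K \<le> ?B + ?M div 2"
    moreover have LS: "?L - Suc K = Suc K" by simp
    ultimately have "yields G (\<Sum>j\<in>{?L - Suc K..<?L}. single (y j) (p j)) (single (y ?L) 1)"
      using assms(1) by (intro yields_right_end) auto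
    also have "(\<Sum>j\<in>{?L - Suc K..<?L}. single (y j) (p j))
      = single (y (Suc K)) ?M + (\<Sum>j\<in>{?L - K..<?L}. single (y j) (p j))"
      unfolding LS by (subst sum.atLeast_Suc_lessThan) auto
    finally show ?thesis
      unfolding split add.assoc by (intro disjI2, rule yields_add_right)
  qed
qed

text \<open>\<open>a\<close> and \<open>b\<close> are the two middle piles: each counts 1/2 towards
  its own side and 1/4 towards the other, and rounding costs at most 3/2 in all. If both
  alternatives failed, adding them would give A + B + 3/4 (a + b) \<le> 2Z - 1/2, so the total would
  be at most (8Z - 2)/3, just below the hypothesis.\<close>

lemma odd_cycle_arith:
  fixes A B a b N Z :: nat
  assumes "2 * ((4 * Z) div 3) + 1 \<le> A + a + b + B"
  shows "Z \<le> A + (a + b div 2) div 2 \<or> Z \<le> B + (b + a div 2) div 2"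
proof -
  have half: "x \<le> 2 * (x div 2) + 1" for x :: nat by simp
  have "4 * Z \<le> 3 * (4 * Z div 3) + 2"
    using div_mult_mod_eq[of "4 * Z" 3] pos_mod_bound[of 3 "4 * Z"] by simp
  then show ?thesis
    using half[of a] half[of b] half[of "a + b div 2"] half[of "b + a div 2"] assms by linarith
qed

lemma yields_two_ends_odd:
  assumes "walk G y (2 * K + 3)" "2 * ((4 * 2 ^ K) div 3) + 1 \<le> (\<Sum>j\<in>{1..<2 * K + 3}. p j)"
  shows "yields G (\<Sum>j\<in>{1..<2 * K + 3}. single (y j) (p j)) (single (y 0) 1)
    \<or> yields G (\<Sum>j\<in>{1..<2 * K + 3}. single (y j) (p j)) (single (y (2 * K + 3)) 1)"
proof -
  let ?L = "2 * K + 3" and ?a = "p (Suc K)" and ?b = "p (Suc (Suc K))"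
  let ?A = "\<Sum>j\<in>{1..<Suc K}. p j" and ?B = "\<Sum>j\<in>{?L - K..<?L}. p j"
  let ?SA = "\<Sum>j\<in>{1..<Suc K}. single (y j) (p j)" and ?SB = "\<Sum>j\<in>{?L - K..<?L}. single (y j) (p j)"
  have split: "(\<Sum>j\<in>{1..<?L}. f j) = (\<Sum>j\<in>{1..<Suc K}. f j) + (f (Suc K) + f (Suc (Suc K)))
       + (\<Sum>j\<in>{?L - K..<?L}. f j)"
    for f :: "nat \<Rightarrow> 'z::comm_monoid_add"
  proof -
    have "{1..<?L} = {1..<Suc K} \<union> {Suc K} \<union> {Suc (Suc K)} \<union> {?L - K..<?L}" by auto
    then show ?thesis by (simp add: sum.union_disjoint ac_simps)
  qed
  have LS: "?L - Suc K = Suc (Suc K)" "?L - K = Suc (Suc (Suc K))" by auto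
  have e: "edge G (y (Suc K)) (y (Suc (Suc K)))" "edge G (y (Suc (Suc K))) (y (Suc K))"
    using assms(1) by (auto simp: walk_def)
  have "2 ^ K \<le> ?A + (?a + ?b div 2) div 2 \<or> 2 ^ K \<le> ?B + (?b + ?a div 2) div 2"
    by (rule odd_cycle_arith) (use assms(2) in \<open>simp only: split add.assoc\<close>)
  then show ?thesis
  proof
    assume l: "2 ^ K \<le> ?A + (?a + ?b div 2) div 2"
    define q where "q = p(Suc K := ?a + ?b div 2)"
    have 1: "yields G (\<Sum>j\<in>{1..<Suc (Suc K)}. single (y j) (q j)) (single (y 0) 1)"
      using assms(1) l by (intro yields_left_end) (auto simp: q_def)
    have 2: "(\<Sum>j\<in>{1..<Suc (Suc K)}. single (y j) (q j))
        = ?SA + single (y (Suc K)) (?a + ?b div 2)"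
      by (simp add: q_def)
    have 3: "yields G (?SA + (single (y (Suc K)) ?a + single (y (Suc (Suc K))) ?b))
       (?SA + single (y (Suc K)) (?a + ?b div 2))"
      unfolding single_add by (intro yields_add yields_refl yields_edge_div e)
    have "yields G (?SA + (single (y (Suc K)) ?a + single (y (Suc (Suc K))) ?b)) (single (y 0) 1)"
      by (rule yields_trans[OF 3 1[unfolded 2]])
    then show ?thesis
      unfolding split by (intro disjI1, rule yields_add_left)
  next
    assume r: "2 ^ K \<le> ?B + (?b + ?a div 2) div 2"
    define q where "q = p(Suc (Suc K) := ?a div 2 + ?b)"
    have 1: "yields G (\<Sum>j\<in>{?L - Suc K..<?L}. single (y j) (q j)) (single (y ?L) 1)"
      using assms(1) r by (intro yields_right_end) (auto simp: q_def LS add.commute)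
    have 2: "(\<Sum>j\<in>{?L - Suc K..<?L}. single (y j) (q j))
        = single (y (Suc (Suc K))) (?a div 2 + ?b) + ?SB"
      unfolding LS by (subst sum.atLeast_Suc_lessThan) (auto simp: q_def)
    have 3: "yields G ((single (y (Suc K)) ?a + single (y (Suc (Suc K))) ?b) + ?SB)
       (single (y (Suc (Suc K))) (?a div 2 + ?b) + ?SB)"
      unfolding single_add by (intro yields_add yields_refl yields_edge_div e)
    have "yields G ((single (y (Suc K)) ?a + single (y (Suc (Suc K))) ?b) + ?SB) (single (y ?L) 1)"
      by (rule yields_trans[OF 3 1[unfolded 2]])
    then show ?thesis
      unfolding split add.assoc by (intro disjI2, rule yields_add_right)
  qed
qed

text \<open>The argument for the cycle C_L works equally for two different ends, at the price of not
  choosing which one is served. In this form it applies to a segment between two spokes.\<close>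

lemma yields_two_ends:
  assumes "walk G y L" "2 \<le> L" "fC L \<le> (\<Sum>j\<in>{1..<L}. p j)"
  shows "yields G (\<Sum>j\<in>{1..<L}. single (y j) (p j)) (single (y 0) 1)
    \<or> yields G (\<Sum>j\<in>{1..<L}. single (y j) (p j)) (single (y L) 1)"
proof (cases "even L")
  case True
  with assms(2) obtain K where "L = 2 * Suc K"
    by (metis dvd_def mult_0_right not0_implies_Suc not_numeral_le_zero)
  then show ?thesis
    using yields_two_ends_even[of G y K p] assms by (simp add: fC_def)
next
  case False
  then obtain j where j: "L = 2 * j + 1" by (elim oddE)
  with assms(2) obtain K where "j = Suc K" by (cases j) auto
  with j have L: "L = 2 * K + 3" "L div 2 = Suc K" by auto
  then show ?thesis
    using yields_two_ends_odd[of G y K p] assms False by (simp add: fC_def)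
qed

section \<open>Restricting a distribution and extracting pebbles from it\<close>

definition restr :: "nat set \<Rightarrow> (nat \<Rightarrow> nat) \<Rightarrow> nat \<Rightarrow> nat" where
  "restr S D = (\<lambda>x. if x \<in> S then D x else 0)"

lemma restr_walk:
  fixes y :: "nat \<Rightarrow> nat"
  assumes "inj_on y {1..<L}"
  shows "restr (y ` {1..<L}) D = (\<Sum>j\<in>{1..<L}. single (y j) (D (y j)))"
proof
  fix x
  show "restr (y ` {1..<L}) D x = (\<Sum>j\<in>{1..<L}. single (y j) (D (y j))) x"
  proof (cases "x \<in> y ` {1..<L}")
    case True
    then obtain i where i: "x = y i" "i \<in> {1..<L}" by blast
    have "(\<Sum>j\<in>{1..<L}. single (y j) (D (y j)) x) = (\<Sum>j\<in>{1..<L}. if j = i then D (y i) else 0)"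
      using i assms by (intro sum.cong) (auto simp: single_apply inj_on_def)
    also have "\<dots> = D (y i)" using i(2) by (subst sum.delta) auto
    finally show ?thesis using True i by (simp add: sum_fun_apply restr_def)
  next
    case False
    then show ?thesis by (auto simp: sum_fun_apply restr_def single_apply)
  qed
qed

lemma yields_closed_walk:
  assumes "walk G y L" "2 \<le> L" "inj_on y {1..<L}" "fC L \<le> (\<Sum>x\<in>y ` {1..<L}. D x)"
  shows "yields G (restr (y ` {1..<L}) D) (single (y 0) 1) \<or> yields G (restr (y ` {1..<L}) D) (single (y L) 1)"
  unfolding restr_walk[OF assms(3)]
  using assms by (intro yields_two_ends) (auto simp: sum.reindex)

lemma sub_distribution:
  fixes D :: "nat \<Rightarrow> nat"
  assumes "finite S" "c \<le> (\<Sum>x\<in>S. D x)"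
  obtains E where "E \<le> D" "\<And>x. x \<notin> S \<Longrightarrow> E x = 0" "(\<Sum>x\<in>S. E x) = c"
proof -
  have "\<exists>E\<le>D. (\<forall>x. x \<notin> S \<longrightarrow> E x = 0) \<and> (\<Sum>x\<in>S. E x) = c"
    using assms
  proof (induction S arbitrary: c rule: finite_induct)
    case empty
    then show ?case by (intro exI[of _ 0]) (auto simp: le_fun_def zero_fun_apply)
  next
    case (insert a S)
    have "c - min c (D a) \<le> (\<Sum>x\<in>S. D x)" using insert by auto
    from insert.IH[OF this] obtain E where E: "E \<le> D" "\<And>x. x \<notin> S \<Longrightarrow> E x = 0"
      "(\<Sum>x\<in>S. E x) = c - min c (D a)" by blast
    have "(\<Sum>x\<in>S. (E(a := min c (D a))) x) = (\<Sum>x\<in>S. E x)"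
      using insert by (intro sum.cong) auto
    then show ?case
      using E insert by (intro exI[of _ "E(a := min c (D a))"]) (auto simp: le_fun_def)
  qed
  then show ?thesis using that by blast
qed

text \<open>Guarantees that every round of the extraction below consumes pebbles, so that it
  terminates.\<close>

lemma not_yields_0: "\<not> yields G 0 (single u 1)"
proof
  assume "yields G 0 (single u 1)"
  then obtain D' where D': "(pebbling_move G)\<^sup>*\<^sup>* 0 D'" "single u 1 \<le> D'"
    by (auto simp: yields_def)
  from D'(1) have "D' = 0"
    by (induction rule: rtranclp_induct) (auto simp: pebbling_move_def zero_fun_apply)
  with D'(2) show False by (auto simp: le_fun_def single_apply zero_fun_apply dest: spec[of _ u])
qed

lemma yields_extract_supported:
  fixes M :: nat
  assumes S: "finite S" and M: "\<And>E. (\<And>x. x \<notin> S \<Longrightarrow> E x = 0) \<Longrightarrow> M \<le> (\<Sum>x\<in>S. E x) \<Longrightarrow> yields G E (single u 1)"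
    and D: "\<And>x. x \<notin> S \<Longrightarrow> D x = 0"
  shows "\<exists>q E. yields G D (single u q + E) \<and> (\<forall>x. x \<notin> S \<longrightarrow> E x = 0) \<and> \<not> yields G E (single u 1)
    \<and> (\<Sum>x\<in>S. D x) \<le> q * M + (\<Sum>x\<in>S. E x)"
  using D
proof (induction "\<Sum>x\<in>S. D x" arbitrary: D rule: less_induct)
  case less
  show ?case
  proof (cases "yields G D (single u 1) \<and> (\<Sum>x\<in>S. D x) \<noteq> 0")
    case False
    have "\<not> yields G D (single u 1)" if "(\<Sum>x\<in>S. D x) = 0"
    proof -
      have "D = 0" using that less.prems S by (fastforce simp: fun_eq_iff zero_fun_apply)
      then show ?thesis using not_yields_0 by simp
    qed
    with False show ?thesis
      using less.prems by (intro exI[of _ 0] exI[of _ D]) (auto simp: yields_refl)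
  next
    case True
    let ?s = "\<Sum>x\<in>S. D x"
    \<comment> \<open>One round costs at most \<open>M\<close>: exactly \<open>M\<close> pebbles are
      taken if there are that many, and otherwise everything that is left.\<close>
    have "\<exists>E\<le>D. yields G E (single u 1) \<and> (\<Sum>x\<in>S. E x) \<le> M \<and> (\<Sum>x\<in>S. E x) \<noteq> 0"
    proof (cases "M \<le> ?s \<and> M \<noteq> 0")
      case M': True
      then obtain E where "E \<le> D" "\<And>x. x \<notin> S \<Longrightarrow> E x = 0" "(\<Sum>x\<in>S. E x) = M"
        using sub_distribution[OF S, of M D] by metis
      then show ?thesis using M[of E] M' by (intro exI[of _ E]) auto
    next
      case M': False
      then show ?thesis
      proof (cases "M = 0")
        case True
        have "yields G 0 (single u 1)" using M[of 0] True by (simp add: zero_fun_apply)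
        then show ?thesis using not_yields_0 by simp
      next
        case False
        then show ?thesis using M' True by (intro exI[of _ D]) auto
      qed
    qed
    then obtain E where E: "E \<le> D" "yields G E (single u 1)" "(\<Sum>x\<in>S. E x) \<le> M" "(\<Sum>x\<in>S. E x) \<noteq> 0" by blast
    define D1 where "D1 x = D x - E x" for x
    have DE: "D = E + D1" using E(1) by (auto simp: fun_eq_iff plus_fun_apply D1_def le_fun_def)
    then have s: "?s = (\<Sum>x\<in>S. E x) + (\<Sum>x\<in>S. D1 x)" by (simp add: plus_fun_apply sum.distrib)
    have "\<And>x. x \<notin> S \<Longrightarrow> D1 x = 0" using less.prems by (simp add: D1_def)
    with less.hyps[of D1] s E(4) obtain q E1 where q: "yields G D1 (single u q + E1)"
      "\<forall>x. x \<notin> S \<longrightarrow> E1 x = 0" "\<not> yields G E1 (single u 1)" "(\<Sum>x\<in>S. D1 x) \<le> q * M + (\<Sum>x\<in>S. E1 x)"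
      by auto
    have "yields G D (single u (Suc q) + E1)"
      using yields_add[OF E(2) q(1)] unfolding DE using single_add[of u 1 q] by (simp add: add.assoc)
    moreover have "?s \<le> Suc q * M + (\<Sum>x\<in>S. E1 x)" using s E(3) q(4) by simp
    ultimately show ?thesis using q by blast
  qed
qed

lemma restr_idem: "(\<And>x. x \<notin> S \<Longrightarrow> E x = 0) \<Longrightarrow> restr S E = E"
  by (auto simp: restr_def fun_eq_iff)

lemma sum_restr [simp]: "(\<Sum>x\<in>S. restr S D x) = (\<Sum>x\<in>S. D x)"
  by (simp add: restr_def)

lemma yields_extract:
  fixes M :: nat
  assumes "finite S" and M: "\<And>E. M \<le> (\<Sum>x\<in>S. E x) \<Longrightarrow> yields G (restr S E) (single u 1)"
  obtains q E where "yields G (restr S D) (single u q + restr S E)" "\<not> yields G (restr S E) (single u 1)"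
    "(\<Sum>x\<in>S. D x) \<le> q * M + (\<Sum>x\<in>S. E x)"
proof -
  have "\<exists>q E. yields G (restr S D) (single u q + E) \<and> (\<forall>x. x \<notin> S \<longrightarrow> E x = 0) \<and> \<not> yields G E (single u 1)
    \<and> (\<Sum>x\<in>S. restr S D x) \<le> q * M + (\<Sum>x\<in>S. E x)"
  proof (rule yields_extract_supported[OF assms(1)])
    fix E :: "nat \<Rightarrow> nat" assume E: "\<And>x. x \<notin> S \<Longrightarrow> E x = 0" "M \<le> (\<Sum>x\<in>S. E x)"
    show "yields G E (single u 1)" using M[OF E(2)] restr_idem[OF E(1)] by simp
  qed (simp add: restr_def)
  then obtain q E where *: "yields G (restr S D) (single u q + E)" "\<And>x. x \<notin> S \<Longrightarrow> E x = 0"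
    "\<not> yields G E (single u 1)" "(\<Sum>x\<in>S. restr S D x) \<le> q * M + (\<Sum>x\<in>S. E x)"
    by blast
  with restr_idem[of S E] have "restr S E = E" by blast
  with * that[of q E] show ?thesis by simp
qed

section \<open>Certifying pebbling numbers, and the even cycle\<close>

lemma yields_single_iff: "(\<exists>D'. (pebbling_move G)\<^sup>*\<^sup>* D D' \<and> t \<le> D' w) \<longleftrightarrow> yields G D (single w t)"
  unfolding yields_def by (auto simp: le_fun_def single_apply)

text \<open>\<open>LEAST\<close> also requires a counterexample for each smaller size; any smaller
  number of pebbles can be selected from \<open>D0\<close>, and they reach no more than
  \<open>D0\<close> does.\<close>

lemma t_pebbling_number_eqI:
  assumes fin: "finite (verts G)"
    and upper: "\<And>D w. distribution G D (Suc p) \<Longrightarrow> w \<in> verts G \<Longrightarrow> yields G D (single w t)"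
    and lower: "distribution G D0 p" "w0 \<in> verts G" "\<not> yields G D0 (single w0 t)"
  shows "t_pebbling_number t G = Suc p"
  unfolding t_pebbling_number_def yields_single_iff
proof (rule Least_equality)
  show "\<forall>D. distribution G D (Suc p) \<longrightarrow> (\<forall>w\<in>verts G. yields G D (single w t))"
    using upper by blast
next
  fix p' assume p': "\<forall>D. distribution G D p' \<longrightarrow> (\<forall>w\<in>verts G. yields G D (single w t))"
  show "Suc p \<le> p'"
  proof (rule ccontr)
    assume "\<not> Suc p \<le> p'"
    then have "p' \<le> (\<Sum>x\<in>verts G. D0 x)" using lower(1) by (simp add: distribution_def)
    then obtain E where E: "E \<le> D0" "\<And>x. x \<notin> verts G \<Longrightarrow> E x = 0" "(\<Sum>x\<in>verts G. E x) = p'"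
      using sub_distribution[OF fin] by metis
    then have "yields G E (single w0 t)" using p' lower(2) by (simp add: distribution_def)
    then show False using lower(3) yields_mono E(1) by blast
  qed
qed

lemma cycle_verts [simp]: "verts (cycle_graph N) = {0..<N}"
  by (simp add: verts_def cycle_graph_def)

lemma cycle_edge: "edge (cycle_graph N) v w \<longleftrightarrow> v < N \<and> w < N \<and> v \<noteq> w \<and> (w = (v + 1) mod N \<or> v = (w + 1) mod N)"
  by (auto simp: edge_def verts_def adj_def cycle_graph_def)

lemma weight_move:
  fixes wt :: "nat \<Rightarrow> nat"
  assumes fin: "finite (verts G)" and wt: "\<And>v w. edge G v w \<Longrightarrow> wt w \<le> 2 * wt v"
    and irrefl: "\<And>v. \<not> edge G v v" and mv: "pebbling_move G D D'"
  shows "(\<Sum>x\<in>verts G. D' x * wt x) \<le> (\<Sum>x\<in>verts G. D x * wt x)"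
proof -
  obtain v w where vw: "edge G v w" "2 \<le> D v" "D' = (D(v := D v - 2))(w := D w + 1)"
    using mv unfolding pebbling_move_def edge_def by blast
  then have ne: "v \<noteq> w" and V: "v \<in> verts G" "w \<in> verts G" using irrefl by (auto simp: edge_def)
  have sp: "(\<Sum>x\<in>verts G. f x) = f v + f w + (\<Sum>x\<in>verts G - {v} - {w}. f x)" for f :: "nat \<Rightarrow> nat"
    using fin V ne by (simp add: sum.remove[of _ v] sum.remove[of _ w])
  have "(\<Sum>x\<in>verts G - {v} - {w}. D' x * wt x) = (\<Sum>x\<in>verts G - {v} - {w}. D x * wt x)"
    by (intro sum.cong) (auto simp: vw)
  moreover have "D' v * wt v + D' w * wt w \<le> D v * wt v + D w * wt w"
  proof -
    obtain e where "D v = 2 + e" using vw(2) le_Suc_ex by blast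
    then show ?thesis using wt[OF vw(1)] ne by (simp add: vw(3) algebra_simps)
  qed
  ultimately show ?thesis unfolding sp by simp
qed

lemma weight_bound:
  fixes wt :: "nat \<Rightarrow> nat"
  assumes fin: "finite (verts G)" and wt: "\<And>v w. edge G v w \<Longrightarrow> wt w \<le> 2 * wt v"
    and irrefl: "\<And>v. \<not> edge G v v" and y: "yields G D (single w t)" and w: "w \<in> verts G"
  shows "t * wt w \<le> (\<Sum>x\<in>verts G. D x * wt x)"
proof -
  obtain D' where D': "(pebbling_move G)\<^sup>*\<^sup>* D D'" "t \<le> D' w"
    using y by (auto simp: yields_single_iff[symmetric])
  from D'(1) have "(\<Sum>x\<in>verts G. D' x * wt x) \<le> (\<Sum>x\<in>verts G. D x * wt x)"
  proof induction
    case (step D1 D2)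
    have "(\<Sum>x\<in>verts G. D2 x * wt x) \<le> (\<Sum>x\<in>verts G. D1 x * wt x)"
      by (rule weight_move[OF fin wt irrefl step(2)])
    with step(3) show ?case by simp
  qed simp
  moreover have "D' w * wt w \<le> (\<Sum>x\<in>verts G. D' x * wt x)"
    using member_le_sum[OF w, of "\<lambda>x. D' x * wt x"] fin by simp
  moreover have "t * wt w \<le> D' w * wt w" using D'(2) by simp
  ultimately show ?thesis by linarith
qed

lemma inj_on_mod_add: "inj_on (\<lambda>j. (a + j) mod N) {0..<N}" for a N :: nat
proof (rule linorder_inj_onI)
  fix i j :: nat assume ij: "i < j" "i \<in> {0..<N}" "j \<in> {0..<N}"
  show "(a + i) mod N \<noteq> (a + j) mod N"
  proof
    assume "(a + i) mod N = (a + j) mod N"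
    then have "N dvd (a + j) - (a + i)" using ij(1) mod_eq_dvd_iff_nat[of "a + i" "a + j" N] by simp
    then show False using ij by (auto dest: dvd_imp_le)
  qed
qed auto

text \<open>Seen from the root, the other vertices form a closed walk; every 2^K pebbles on it pay
  for one pebble on the root, and fewer than 2^K remain unspent. The bad distribution is a single
  pile opposite the root.\<close>

theorem t_pebbling_number_even_cycle:
  assumes "2 \<le> K" "1 \<le> t"
  shows "t_pebbling_number t (cycle_graph (2 * K)) = t * 2 ^ K"
proof -
  let ?G = "cycle_graph (2 * K)"
  obtain p where p: "t * 2 ^ K = Suc p" using assms by (cases "t * 2 ^ K") auto
  have "t_pebbling_number t ?G = Suc p"
  proof (rule t_pebbling_number_eqI)
    fix D w assume D: "distribution ?G D (Suc p)" and w: "w \<in> verts ?G"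
    define y where "y j = (w + j) mod (2 * K)" for j
    define S where "S = y ` {1..<2 * K}"
    have inj: "inj_on y {0..<2 * K}"
      unfolding y_def by (rule inj_on_mod_add)
    have walk: "walk ?G y (2 * K)"
      unfolding walk_def
    proof (intro allI impI)
      fix j
      define x where "x = y j"
      have "x < 2 * K" "y (Suc j) = Suc x mod (2 * K)"
        using assms by (simp_all add: x_def y_def mod_Suc_eq)
      then show "edge ?G (y j) (y (Suc j)) \<and> edge ?G (y (Suc j)) (y j)"
        using assms unfolding x_def[symmetric] cycle_edge by (cases "Suc x = 2 * K") auto
    qed
    have y0: "y 0 = w" "y (2 * K) = w" using w by (auto simp: y_def)
    have V: "verts ?G = insert w S" "w \<notin> S"
    proof -
      have "y ` {0..<2 * K} \<subseteq> {0..<2 * K}" using assms by (auto simp: y_def)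
      moreover have "card (y ` {0..<2 * K}) = card {0..<2 * K}" by (rule card_image[OF inj])
      ultimately have "y ` {0..<2 * K} = {0..<2 * K}" by (intro card_subset_eq) auto
      moreover have "{0..<2 * K} = insert 0 {1..<2 * K}" using assms by auto
      ultimately have "{0..<2 * K} = y ` insert 0 {1..<2 * K}" by simp
      also have "\<dots> = insert w S" by (simp add: S_def y0)
      finally show "verts ?G = insert w S" by simp
      show "w \<notin> S"
      proof
        assume "w \<in> S"
        then obtain j where "j \<in> {1..<2 * K}" "y j = y 0" unfolding S_def y0(1) by force
        with inj_onD[OF inj, of j 0] show False by auto
      qed
    qed
    have ext: "yields ?G (restr S E) (single w 1)" if E: "2 ^ K \<le> (\<Sum>x\<in>S. E x)" for E
    proof -
      have "inj_on y {1..<2 * K}" by (rule inj_on_subset[OF inj]) auto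
      moreover have "2 \<le> 2 * K" "fC (2 * K) \<le> (\<Sum>x\<in>y ` {1..<2 * K}. E x)"
        using assms E by (simp_all add: fC_def S_def)
      ultimately show ?thesis
        using yields_closed_walk[OF walk] unfolding y0 S_def by blast
    qed
    have "finite S" by (simp add: S_def)
    from yields_extract[OF this ext] obtain q E
      where q: "yields ?G (restr S D) (single w q + restr S E)" "\<not> yields ?G (restr S E) (single w 1)"
        "(\<Sum>x\<in>S. D x) \<le> q * 2 ^ K + (\<Sum>x\<in>S. E x)" by blast
    then have E2: "(\<Sum>x\<in>S. E x) < 2 ^ K"
      using ext[of E] by (meson not_le)
    have "Suc p = D w + (\<Sum>x\<in>S. D x)"
      using D V by (simp add: distribution_def S_def)
    moreover have "D w \<le> D w * 2 ^ K" by simp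
    moreover have "(D w + q + 1) * 2 ^ K = D w * 2 ^ K + q * 2 ^ K + 2 ^ K" by (simp add: algebra_simps)
    ultimately have "t * 2 ^ K < (D w + q + 1) * 2 ^ K"
      using q(3) E2 p by linarith
    then have "t < D w + q + 1" unfolding mult_less_cancel2 by blast
    then have "t \<le> D w + q" by simp
    moreover have "yields ?G D (single w (D w + q))"
    proof (rule yields_mono)
      show "yields ?G (single w (D w) + restr S D) (single w (D w) + (single w q + restr S E))"
        by (intro yields_add yields_refl q)
    qed (use V(2) in \<open>auto simp: pointwise restr_def\<close>)
    ultimately show "yields ?G D (single w t)"
      by (elim yields_mono) (auto simp: pointwise)
  next
    show "distribution ?G (single K p) p"
      using assms by (auto simp: distribution_def single_def)
    show "(0::nat) \<in> verts ?G" using assms by simp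
    \<comment> \<open>The exponent is the distance from the antipode \<open>K\<close> of the root: a
      pebble in the pile weighs 1 and one on the root 2^K.\<close>
    define wt :: "nat \<Rightarrow> nat" where "wt x = 2 ^ (if x \<le> K then K - x else x - K)" for x
    show "\<not> yields ?G (single K p) (single 0 t)"
    proof
      assume "yields ?G (single K p) (single 0 t)"
      from weight_bound[OF _ _ _ this, of wt] have "t * wt 0 \<le> (\<Sum>x\<in>verts ?G. single K p x * wt x)"
      proof -
        have "wt w \<le> 2 * wt v" if "edge ?G v w" for v w
        proof -
          have "(if w \<le> K then K - w else w - K) \<le> Suc (if v \<le> K then K - v else v - K)"
            using that assms unfolding cycle_edge by (auto simp: mod_Suc split: if_splits)
          then show ?thesis
            unfolding wt_def power_Suc[symmetric] by (intro power_increasing) auto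
        qed
        moreover have "\<not> edge ?G v v" for v by (simp add: cycle_edge)
        ultimately show ?thesis
          using weight_bound[OF _ _ _ \<open>yields ?G (single K p) (single 0 t)\<close>, of wt] assms by simp
      qed
      also have "(\<Sum>x\<in>verts ?G. single K p x * wt x) = (\<Sum>x\<in>verts ?G. if x = K then p else 0)"
        by (intro sum.cong) (auto simp: single_apply wt_def)
      also have "\<dots> = p" using assms by simp
      finally show False using p by (simp add: wt_def)
    qed
  qed simp
  with p show ?thesis by simp
qed

lemma yields_pair:
  assumes "edge G s u" "yields G A (single s 1)" "yields G B (single s 1)"
  shows "yields G (A + B) (single u 1)"
proof -
  have "yields G (A + B) (single s 2)"
    using yields_add[OF assms(2,3)] single_add[of s 1 1] by (simp add: numeral_2_eq_2)
  then show ?thesis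
    using yields_edge[OF assms(1), of 1] by (auto intro: yields_trans)
qed

section \<open>Collecting pebbles on the hub\<close>

text \<open>Piece \<open>E i\<close> can send one pebble to spoke \<open>i\<close> if \<open>l i\<close>, and one to spoke \<open>Suc i\<close> if \<open>r i\<close>, but perhaps
  not both. The induction tracks whether piece \<open>a + c\<close> is still untouched; if it has been spent and
  could have served the next spoke, the bound has one unit in reserve.\<close>

lemma spoke_matching:
  fixes E C :: "nat \<Rightarrow> nat \<Rightarrow> nat" and l r P :: "nat \<Rightarrow> bool"
  assumes s: "\<And>j. edge G (s j) u"
    and l: "\<And>i. l i \<Longrightarrow> yields G (E i) (single (s i) 1)"
    and r: "\<And>i. r i \<Longrightarrow> yields G (E i) (single (s (Suc i)) 1)"
    and P: "\<And>j. P j \<Longrightarrow> yields G (C j) (single (s j) 1)"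
  shows "\<exists>X. yields G ((\<Sum>i\<in>{a..a + c}. E i) + (\<Sum>j\<in>{a<..a + c}. C j)) (single u X)
    \<and> (\<Sum>j\<in>{a<..a + c}. of_bool (r (j - 1)) + of_bool (P j) + of_bool (l j)) \<le> 2 * X + c"
proof -
  let ?d = "\<lambda>j. (of_bool (r (j - 1)) + of_bool (P j) + of_bool (l j) :: nat)"
  have "(\<exists>X. yields G ((\<Sum>i\<in>{a..<a + c}. E i) + (\<Sum>j\<in>{a<..a + c}. C j)) (single u X)
      \<and> (\<Sum>j\<in>{a<..a + c}. ?d j) \<le> 2 * X + c) \<or>
    (\<exists>X. yields G ((\<Sum>i\<in>{a..a + c}. E i) + (\<Sum>j\<in>{a<..a + c}. C j)) (single u X)
      \<and> (\<Sum>j\<in>{a<..a + c}. ?d j) + of_bool (r (a + c)) \<le> 2 * X + c)"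
  proof (induction c)
    case 0
    show ?case by (intro disjI1 exI[of _ 0]) (simp add: yields_refl)
  next
    case (Suc c)
    let ?b = "a + c"
    let ?EE = "\<Sum>i\<in>{a..<?b}. E i" and ?CC = "\<Sum>j\<in>{a<..?b}. C j"
    let ?dd = "\<Sum>j\<in>{a<..?b}. ?d j"
    have E1: "(\<Sum>i\<in>{a..?b}. E i) = ?EE + E ?b" "(\<Sum>i\<in>{a..<a + Suc c}. E i) = ?EE + E ?b"
      "(\<Sum>i\<in>{a..a + Suc c}. E i) = ?EE + E ?b + E (Suc ?b)"
      by (simp_all add: atLeastLessThanSuc_atLeastAtMost[symmetric])
    have ins: "{a<..a + Suc c} = insert (Suc ?b) {a<..?b}" by auto
    have C1: "(\<Sum>j\<in>{a<..a + Suc c}. C j) = ?CC + C (Suc ?b)"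
      unfolding ins by (simp add: add.commute)
    have d1: "(\<Sum>j\<in>{a<..a + Suc c}. ?d j) = ?dd + (of_bool (r ?b) + of_bool (P (Suc ?b)) + of_bool (l (Suc ?b)))"
      unfolding ins by simp
    have gain: "yields G (A + B) (single u (Suc X))"
      if "yields G A (single u X)" "yields G B (single u 1)" for A B X
      using yields_add[OF that] single_add[of u X 1] by simp
    let ?unused = "\<lambda>X. yields G (?EE + E ?b + (?CC + C (Suc ?b))) (single u X)
      \<and> ?dd + (of_bool (r ?b) + of_bool (P (Suc ?b)) + of_bool (l (Suc ?b))) \<le> 2 * X + Suc c"
    let ?spent = "\<lambda>X. yields G (?EE + E ?b + E (Suc ?b) + (?CC + C (Suc ?b))) (single u X)
      \<and> ?dd + (of_bool (r ?b) + of_bool (P (Suc ?b)) + of_bool (l (Suc ?b))) + of_bool (r (Suc ?b)) \<le> 2 * X + Suc c"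
    from Suc.IH have "(\<exists>X. ?unused X) \<or> (\<exists>X. ?spent X)"
    proof (elim disjE exE conjE)
      fix X assume X: "yields G (?EE + ?CC) (single u X)" "?dd \<le> 2 * X + c"
      \<comment> \<open>Partners other than piece \<open>Suc ?b\<close> are preferred, so that this
        piece stays available for the next spoke. It is spent only at a spoke with exactly two
        users, and the unit that such a spoke need not waste pays for the loss of
        \<open>r (Suc ?b)\<close>.\<close>
      consider "r ?b" "P (Suc ?b)" | "l (Suc ?b)" "r ?b \<noteq> P (Suc ?b)"
        | "of_bool (r ?b) + of_bool (P (Suc ?b)) + of_bool (l (Suc ?b)) \<le> (1::nat)"
        by (cases "r ?b"; cases "P (Suc ?b)"; cases "l (Suc ?b)") auto
      then show ?thesis
      proof cases
        case 1
        have "yields G ((?EE + ?CC) + (E ?b + C (Suc ?b))) (single u (Suc X))"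
          by (intro gain X yields_pair[OF s r P] 1)
        then have "?unused (Suc X)" using X(2) by (simp add: ac_simps)
        then show ?thesis by blast
      next
        case 2
        then have "yields G ((E ?b + C (Suc ?b)) + E (Suc ?b)) (single u 1)"
          using l r P by (intro yields_pair[OF s]) (auto intro: yields_add_left yields_add_right)
        from gain[OF X(1) this] have "?spent (Suc X)" using X(2) 2 by (auto simp: ac_simps)
        then show ?thesis by blast
      next
        case 3
        have "yields G ((?EE + ?CC) + (E ?b + C (Suc ?b))) (single u X)"
          by (rule yields_add_left[OF X(1)])
        then have "?unused X" using X(2) 3 by (simp add: ac_simps)
        then show ?thesis by blast
      qed
    next
      fix X assume X: "yields G ((\<Sum>i\<in>{a..?b}. E i) + ?CC) (single u X)" "?dd + of_bool (r ?b) \<le> 2 * X + c"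
      note X = X[unfolded E1(1)]
      show ?thesis
      \<comment> \<open>Piece \<open>?b\<close> is gone, but the reserve has already paid for
        \<open>r ?b\<close>; only the other two users of this spoke can still meet.\<close>
      proof (cases "P (Suc ?b) \<and> l (Suc ?b)")
        case True
        have "yields G ((?EE + E ?b + ?CC) + (C (Suc ?b) + E (Suc ?b))) (single u (Suc X))"
          by (intro gain X yields_pair[OF s P l]) (use True in auto)
        then have "?spent (Suc X)" using X(2) True by (cases "r ?b") (auto simp: ac_simps)
        then show ?thesis by blast
      next
        case False
        have "yields G ((?EE + E ?b + ?CC) + C (Suc ?b)) (single u X)"
          by (rule yields_add_left[OF X(1)])
        then have "?unused X" using X(2) False by (simp add: ac_simps) auto
        then show ?thesis by blast
      qed
    qed
    then show ?case unfolding E1 C1 d1 by simp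
  qed
  then show ?thesis
  proof (elim disjE exE conjE)
    fix X assume X: "yields G ((\<Sum>i\<in>{a..<a + c}. E i) + (\<Sum>j\<in>{a<..a + c}. C j)) (single u X)"
      "(\<Sum>j\<in>{a<..a + c}. ?d j) \<le> 2 * X + c"
    have "yields G ((\<Sum>i\<in>{a..a + c}. E i) + (\<Sum>j\<in>{a<..a + c}. C j)) (single u X)"
      using yields_add_left[OF X(1), of "E (a + c)"]
      by (simp add: atLeastLessThanSuc_atLeastAtMost[symmetric] ac_simps)
    with X(2) show ?thesis by blast
  next
    fix X assume X: "yields G ((\<Sum>i\<in>{a..a + c}. E i) + (\<Sum>j\<in>{a<..a + c}. C j)) (single u X)"
      "(\<Sum>j\<in>{a<..a + c}. ?d j) + of_bool (r (a + c)) \<le> 2 * X + c"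
    then have "(\<Sum>j\<in>{a<..a + c}. ?d j) \<le> 2 * X + c" by linarith
    with X(1) show ?thesis by blast
  qed
qed


section \<open>Segments joined to the hub\<close>

lemma sum_open_segment:
  fixes f :: "nat \<Rightarrow> 'z::comm_monoid_add"
  assumes "f 1 = 0" "f (Suc L) = 0" "1 \<le> L"
  shows "(\<Sum>j\<in>{1..<Suc (Suc L)}. f j) = (\<Sum>j\<in>{1..<L}. f (Suc j))"
proof -
  have "(\<Sum>j\<in>{1..<Suc (Suc L)}. f j) = (\<Sum>j\<in>{0..<Suc L}. f (Suc j))"
    by (simp add: sum.shift_bounds_Suc_ivl del: sum.op_ivl_Suc)
  also have "\<dots> = f 1 + (\<Sum>j\<in>{1..<L}. f (Suc j)) + f (Suc L)"
    using assms(3) by (simp add: sum.atLeast_Suc_lessThan)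
  finally show ?thesis using assms by simp
qed

text \<open>Appending \<open>u\<close> behind \<open>y L\<close> gives a walk of length L + 1 in
  which the spoke \<open>y L\<close> is an inner vertex, taken with no pebbles.\<close>

lemma hub_segment_right:
  assumes w: "walk G y L" and u: "edge G (y L) u" "edge G u (y L)" and L: "1 \<le> L"
    and inj: "inj_on y {1..<L}" and f: "fC (Suc L) \<le> (\<Sum>x\<in>y ` {1..<L}. D x)"
  shows "yields G (restr (y ` {1..<L}) D) (single (y 0) 1) \<or> yields G (restr (y ` {1..<L}) D) (single u 1)"
proof -
  define z where "z j = (if j \<le> L then y j else u)" for j
  define p where "p j = (if j < L then D (y j) else 0)" for j
  have "walk G z (Suc L)"
    using w u unfolding walk_def z_def by (auto simp: less_Suc_eq le_less)
  moreover have S: "(\<Sum>j\<in>{1..<Suc L}. g (z j) (p j)) = (\<Sum>j\<in>{1..<L}. g (y j) (D (y j)))"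
    if "\<And>v. g v 0 = 0" for g :: "nat \<Rightarrow> nat \<Rightarrow> 'z::comm_monoid_add"
  proof -
    have "(\<Sum>j\<in>{1..<Suc L}. g (z j) (p j)) = (\<Sum>j\<in>{1..<L}. g (z j) (p j)) + g (z L) (p L)"
      using L by simp
    also have "(\<Sum>j\<in>{1..<L}. g (z j) (p j)) = (\<Sum>j\<in>{1..<L}. g (y j) (D (y j)))"
      by (intro sum.cong) (auto simp: z_def p_def)
    finally show ?thesis using that by (simp add: p_def)
  qed
  moreover have "fC (Suc L) \<le> (\<Sum>j\<in>{1..<Suc L}. p j)"
    using f S[of "\<lambda>v a. a"] inj by (simp add: sum.reindex)
  ultimately have "yields G (\<Sum>j\<in>{1..<Suc L}. single (z j) (p j)) (single (z 0) 1)
    \<or> yields G (\<Sum>j\<in>{1..<Suc L}. single (z j) (p j)) (single (z (Suc L)) 1)"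
    using L by (intro yields_two_ends) auto
  then show ?thesis
    unfolding restr_walk[OF inj] S[of single, OF single_0] by (simp add: z_def)
qed

text \<open>With \<open>u\<close> appended at both ends the walk is a closed one of length L + 2, so
  either end is \<open>u\<close>.\<close>

lemma hub_segment_both:
  assumes w: "walk G y L" and u: "edge G (y L) u" "edge G u (y L)" "edge G (y 0) u" "edge G u (y 0)" and L: "1 \<le> L"
    and inj: "inj_on y {1..<L}" and f: "fC (Suc (Suc L)) \<le> (\<Sum>x\<in>y ` {1..<L}. D x)"
  shows "yields G (restr (y ` {1..<L}) D) (single u 1)"
proof -
  define z where "z j = (if j = 0 \<or> j = Suc (Suc L) then u else y (j - 1))" for j
  define p where "p j = (if 1 < j \<and> j < Suc L then D (y (j - 1)) else 0)" for j
  have "walk G z (Suc (Suc L))"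
    unfolding walk_def
  proof (intro allI impI)
    fix j assume "j < Suc (Suc L)"
    then consider "j = 0" | "j = Suc L" | i where "j = Suc i" "i < L" by (cases j) (auto simp: less_Suc_eq)
    then show "edge G (z j) (z (Suc j)) \<and> edge G (z (Suc j)) (z j)"
      using w u by cases (auto simp: z_def walk_def)
  qed
  moreover have S: "(\<Sum>j\<in>{1..<Suc (Suc L)}. g (z j) (p j)) = (\<Sum>j\<in>{1..<L}. g (y j) (D (y j)))"
    if "\<And>v. g v 0 = 0" for g :: "nat \<Rightarrow> nat \<Rightarrow> 'z::comm_monoid_add"
  proof -
    have "(\<Sum>j\<in>{1..<Suc (Suc L)}. g (z j) (p j)) = (\<Sum>j\<in>{1..<L}. g (z (Suc j)) (p (Suc j)))"
      using that L by (intro sum_open_segment) (auto simp: p_def)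
    also have "\<dots> = (\<Sum>j\<in>{1..<L}. g (y j) (D (y j)))"
      by (intro sum.cong) (auto simp: z_def p_def)
    finally show ?thesis .
  qed
  moreover have "fC (Suc (Suc L)) \<le> (\<Sum>j\<in>{1..<Suc (Suc L)}. p j)"
    using f S[of "\<lambda>v a. a"] inj by (simp add: sum.reindex)
  ultimately have "yields G (\<Sum>j\<in>{1..<Suc (Suc L)}. single (z j) (p j)) (single (z 0) 1)
    \<or> yields G (\<Sum>j\<in>{1..<Suc (Suc L)}. single (z j) (p j)) (single (z (Suc (Suc L))) 1)"
    using L by (intro yields_two_ends) auto
  then show ?thesis
    unfolding restr_walk[OF inj] S[of single, OF single_0] by (simp add: z_def)
qed

lemma walk_image_rev: "(\<lambda>j. y (L - j)) ` {1..<L} = y ` {1..<L}" for y :: "nat \<Rightarrow> 'a"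
proof -
  have "(\<lambda>j. L - j) ` {1..<L} = {1..<L}"
  proof (intro equalityI subsetI)
    fix x assume "x \<in> {1..<L}"
    then have "x = L - (L - x)" "L - x \<in> {1..<L}" by auto
    then show "x \<in> (\<lambda>j. L - j) ` {1..<L}" by (rule image_eqI)
  qed auto
  then show ?thesis by (metis image_image)
qed

lemma hub_segment_left:
  assumes w: "walk G y L" and u: "edge G (y 0) u" "edge G u (y 0)" and L: "1 \<le> L"
    and inj: "inj_on y {1..<L}" and f: "fC (Suc L) \<le> (\<Sum>x\<in>y ` {1..<L}. D x)"
  shows "yields G (restr (y ` {1..<L}) D) (single (y L) 1) \<or> yields G (restr (y ` {1..<L}) D) (single u 1)"
proof -
  have "inj_on (\<lambda>j. y (L - j)) {1..<L}"
  proof (rule inj_onI)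
    fix a b assume "a \<in> {1..<L}" "b \<in> {1..<L}" "y (L - a) = y (L - b)"
    moreover from this have "L - a \<in> {1..<L}" "L - b \<in> {1..<L}" by auto
    ultimately have "L - a = L - b" using inj_onD[OF inj] by blast
    then show "a = b" using \<open>a \<in> {1..<L}\<close> \<open>b \<in> {1..<L}\<close> by auto
  qed
  then show ?thesis
    using hub_segment_right[OF walk_rev[OF w], of u D] assms unfolding walk_image_rev by simp
qed

lemma yields_spoke_extract:
  assumes "edge G s u"
  shows "yields G (single s a) (single u (a div 2) + single s (a mod 2))"
proof -
  have "single s a = single s (2 * (a div 2)) + single s (a mod 2)"
    unfolding single_add[symmetric] by simp
  then show ?thesis using assms by (auto intro!: yields_add yields_edge yields_refl)
qed

text \<open>In \<open>extraction\<close>, \<open>q\<close> pebbles reach the hub at a price of at most \<open>2 * Z\<close> each, \<open>b\<close> counts the remaining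
  pieces that can serve either spoke, and \<open>c\<close> those that serve exactly one spoke, together with
  the spokes that carry a pebble.\<close>

lemma extraction:
  fixes I :: "nat \<Rightarrow> nat set" and Z g m :: nat and D :: "nat \<Rightarrow> nat"
  assumes m: "2 \<le> m" and Z: "1 \<le> Z" and g: "1 \<le> g"
    and fin: "\<And>i. finite (I i)" and s: "\<And>j. edge G (s j) u"
    and A: "\<And>i E. Z \<le> (\<Sum>x\<in>I i. E x) \<Longrightarrow> yields G (restr (I i) E) (single (s i) 1) \<or> yields G (restr (I i) E) (single (s (Suc i)) 1)"
    and B: "\<And>i E. Z + g \<le> (\<Sum>x\<in>I i. E x) \<Longrightarrow>
      (yields G (restr (I i) E) (single (s i) 1) \<and> yields G (restr (I i) E) (single (s (Suc i)) 1)) \<or> yields G (restr (I i) E) (single u 1)"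
    and C: "\<And>i E. 2 * Z \<le> (\<Sum>x\<in>I i. E x) \<Longrightarrow> yields G (restr (I i) E) (single u 1)"
    and D': "D' = (\<Sum>i\<in>{1..<m}. restr (I i) D) + (\<Sum>j\<in>{1..m}. single (s j) (D (s j)))"
  obtains q b c where
    "(\<Sum>i\<in>{1..<m}. \<Sum>x\<in>I i. D x) + (\<Sum>j\<in>{1..m}. D (s j)) \<le> q * (2 * Z) + (m - 1) * (Z - 1) + Z * b + g * c"
    "\<And>X. 2 * X \<le> 2 * b + c + 1 - m \<Longrightarrow> yields G D' (single u (q + X))"
    "yields G D' (single u q + single (s 1) 1) \<or> yields G D' (single u q + single (s m) 1)
      \<or> (\<forall>X. 2 * X \<le> 2 * b + c + 3 - m \<longrightarrow> yields G D' (single u (q + X)))"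
proof -
  have "\<exists>q E. yields G (restr (I i) D) (single u q + restr (I i) E) \<and> \<not> yields G (restr (I i) E) (single u 1)
    \<and> (\<Sum>x\<in>I i. D x) \<le> q * (2 * Z) + (\<Sum>x\<in>I i. E x)" for i
    by (rule yields_extract[OF fin[of i] C[where i = i], where D = D]) blast+
  then obtain q0 F where F: "\<And>i. yields G (restr (I i) D) (single u (q0 i) + restr (I i) (F i))"
    "\<And>i. \<not> yields G (restr (I i) (F i)) (single u 1)"
    "\<And>i. (\<Sum>x\<in>I i. D x) \<le> q0 i * (2 * Z) + (\<Sum>x\<in>I i. F i x)"
    by metis
  define E where "E i = (if i \<in> {1..<m} then restr (I i) (F i) else 0)" for i
  define K where "K j = single (s j) (D (s j) mod 2)" for j
  define l where "l i \<longleftrightarrow> i \<in> {1..<m} \<and> yields G (E i) (single (s i) 1)" for i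
  define r where "r i \<longleftrightarrow> i \<in> {1..<m} \<and> yields G (E i) (single (s (Suc i)) 1)" for i
  define P where "P j \<longleftrightarrow> D (s j) mod 2 = 1" for j
  define q where "q = (\<Sum>i\<in>{1..<m}. q0 i) + (\<Sum>j\<in>{1..m}. D (s j) div 2)"
  define b where "b = (\<Sum>i\<in>{1..<m}. of_bool (l i \<and> r i) :: nat)"
  define c where "c = (\<Sum>i\<in>{1..<m}. of_bool (l i \<noteq> r i)) + (\<Sum>j\<in>{1..m}. of_bool (P j) :: nat)"
  define R where "R = (\<Sum>i\<in>{1..<m}. E i) + (\<Sum>j\<in>{1..m}. K j)"
  have single_sum: "(\<Sum>i\<in>A. single u (f i)) = single u (\<Sum>i\<in>A. f i)" for f :: "nat \<Rightarrow> nat" and A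
    by (induction A rule: infinite_finite_induct) (auto simp: single_add)
  have qR: "yields G D' (single u q + R)"
  proof -
    have "yields G D' ((\<Sum>i\<in>{1..<m}. single u (q0 i) + E i) + (\<Sum>j\<in>{1..m}. single u (D (s j) div 2) + K j))"
      unfolding D' K_def using F(1) s
      by (intro yields_add yields_sum yields_spoke_extract) (auto simp: E_def)
    also have "(\<Sum>i\<in>{1..<m}. single u (q0 i) + E i) + (\<Sum>j\<in>{1..m}. single u (D (s j) div 2) + K j) = single u q + R"
      unfolding sum.distrib single_sum q_def R_def single_add by (simp add: ac_simps)
    finally show ?thesis .
  qed
  have lE: "yields G (E i) (single (s i) 1)" if "l i" for i using that by (simp add: l_def)
  have rE: "yields G (E i) (single (s (Suc i)) 1)" if "r i" for i using that by (simp add: r_def)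
  have PK: "yields G (K j) (single (s j) 1)" if "P j" for j using that by (simp add: K_def P_def yields_refl)
  \<comment> \<open>A load of Z - 1 is free; one usable end allows g more by \<open>B\<close>, and
    two usable ends allow Z more by \<open>C\<close>.\<close>
  have bound: "(\<Sum>x\<in>I i. F i x) \<le> (Z - 1) + Z * of_bool (l i \<and> r i) + g * of_bool (l i \<noteq> r i)" if i: "i \<in> {1..<m}" for i
  proof -
    have lr: "l i \<longleftrightarrow> yields G (restr (I i) (F i)) (single (s i) 1)"
      "r i \<longleftrightarrow> yields G (restr (I i) (F i)) (single (s (Suc i)) 1)"
      using i by (auto simp: l_def r_def E_def)
    have "\<not> Z \<le> (\<Sum>x\<in>I i. F i x)" if "\<not> l i" "\<not> r i" using A[of "F i" i] lr that by blast
    moreover have "\<not> Z + g \<le> (\<Sum>x\<in>I i. F i x)" if "\<not> (l i \<and> r i)" using B[of "F i" i] lr that F(2)[of i] by blast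
    moreover have "\<not> 2 * Z \<le> (\<Sum>x\<in>I i. F i x)" using C[of "F i" i] F(2)[of i] by blast
    ultimately show ?thesis using Z by (cases "l i"; cases "r i") auto
  qed
  have count: "(\<Sum>i\<in>{1..<m}. \<Sum>x\<in>I i. D x) + (\<Sum>j\<in>{1..m}. D (s j)) \<le> q * (2 * Z) + (m - 1) * (Z - 1) + Z * b + g * c"
  proof -
    have "(\<Sum>i\<in>{1..<m}. \<Sum>x\<in>I i. D x)
      \<le> (\<Sum>i\<in>{1..<m}. q0 i * (2 * Z) + ((Z - 1) + Z * of_bool (l i \<and> r i) + g * of_bool (l i \<noteq> r i)))"
      by (intro sum_mono order_trans[OF F(3)] add_mono bound) auto
    also have "\<dots> = (\<Sum>i\<in>{1..<m}. q0 i) * (2 * Z) + (m - 1) * (Z - 1) + Z * b + g * (\<Sum>i\<in>{1..<m}. of_bool (l i \<noteq> r i))"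
      unfolding sum.distrib sum_distrib_left[symmetric] sum_distrib_right[symmetric] b_def by simp
    finally have 1: "(\<Sum>i\<in>{1..<m}. \<Sum>x\<in>I i. D x) \<le> \<dots>" .
    have "D (s j) \<le> (D (s j) div 2) * (2 * Z) + g * of_bool (P j)" for j
    proof -
      have "D (s j) mod 2 = of_bool (P j)" unfolding P_def by (auto simp: of_bool_def)
      then have "D (s j) = D (s j) div 2 * 2 + of_bool (P j)" by (metis div_mult_mod_eq)
      also have "\<dots> \<le> D (s j) div 2 * (2 * Z) + g * of_bool (P j)"
        using Z g by (intro add_mono mult_le_mono) auto
      finally show ?thesis .
    qed
    then have "(\<Sum>j\<in>{1..m}. D (s j)) \<le> (\<Sum>j\<in>{1..m}. (D (s j) div 2) * (2 * Z) + g * of_bool (P j))"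
      by (intro sum_mono)
    also have "\<dots> = (\<Sum>j\<in>{1..m}. D (s j) div 2) * (2 * Z) + g * (\<Sum>j\<in>{1..m}. of_bool (P j))"
      unfolding sum.distrib sum_distrib_left[symmetric] sum_distrib_right[symmetric] by simp
    finally show ?thesis using 1 unfolding q_def c_def by (simp add: algebra_simps)
  qed
  let ?d = "\<lambda>j. (of_bool (r (j - 1)) + of_bool (P j) + of_bool (l j) :: nat)"
  \<comment> \<open>A piece with two usable ends is counted at both. The pieces 0 and m are empty by
    the definition of \<open>E\<close>, so nothing arrives from segment 0.\<close>
  have users: "(\<Sum>j\<in>{0<..m}. ?d j) = 2 * b + c"
  proof -
    have "(\<Sum>j\<in>{0<..m}. of_bool (r (j - 1)) :: nat) = (\<Sum>i\<in>{0..<m}. of_bool (r i))"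
      by (intro sum.reindex_bij_witness[of _ Suc "\<lambda>j. j - 1"]) auto
    also have "\<dots> = (\<Sum>i\<in>{1..<m}. of_bool (r i))"
      by (rule sum.mono_neutral_right) (auto simp: r_def)
    finally have 1: "(\<Sum>j\<in>{0<..m}. of_bool (r (j - 1)) :: nat) = \<dots>" .
    have 2: "(\<Sum>j\<in>{0<..m}. of_bool (l j) :: nat) = (\<Sum>i\<in>{1..<m}. of_bool (l i))"
      by (rule sum.mono_neutral_right) (auto simp: l_def)
    have 3: "{0<..m} = {1..m}" by auto
    have "(\<Sum>i\<in>{1..<m}. of_bool (r i) + of_bool (l i)) = (\<Sum>i\<in>{1..<m}. 2 * of_bool (l i \<and> r i) + of_bool (l i \<noteq> r i) :: nat)"
      by (intro sum.cong) auto
    then show ?thesis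
      using 1 2 unfolding b_def c_def sum.distrib sum_distrib_left 3 by simp
  qed
  have shrink: "yields G D' (single u (q + X))" if "yields G R (single u Y)" "X \<le> Y" for X Y
  proof -
    have "yields G (single u q + R) (single u q + single u Y)"
      by (intro yields_add yields_refl that)
    from yields_trans[OF qR this] show ?thesis
      by (rule yields_mono) (use that(2) in \<open>auto simp: pointwise\<close>)
  qed
  note match = spoke_matching[of G s u l E r P K, OF s lE rE PK]
  show thesis
  proof (rule that[OF count])
    fix X assume X: "2 * X \<le> 2 * b + c + 1 - m"
    obtain Y where Y: "yields G ((\<Sum>i\<in>{0..0 + m}. E i) + (\<Sum>j\<in>{0<..0 + m}. K j)) (single u Y)"
      "(\<Sum>j\<in>{0<..0 + m}. ?d j) \<le> 2 * Y + m"
      using match[of 0 m] by blast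
    have "(\<Sum>i\<in>{0..m}. E i) = (\<Sum>i\<in>{1..<m}. E i)"
      by (rule sum.mono_neutral_right) (auto simp: E_def)
    moreover have "{0<..m} = {1..m}" by auto
    ultimately have "yields G R (single u Y)" using Y(1) by (simp add: R_def)
    \<comment> \<open>The matching gives 2Y \<ge> 2b + c - m; by integrality the additional 1 in the
      bound for 2X is harmless.\<close>
    moreover have "X \<le> Y" using X Y(2) users by simp
    ultimately show "yields G D' (single u (q + X))" by (rule shrink)
  next
    have qs: "yields G D' (single u q + single v 1)" if "yields G R (single v 1)" for v
      using yields_trans[OF qR yields_add[OF yields_refl that]] .
    have ER: "E i \<le> R" if "i \<in> {1..<m}" for i
      using member_le_sum[of i "{1..<m}" "\<lambda>i. E i x" for x] that
      by (auto simp: le_fun_def R_def plus_fun_apply sum_fun_apply intro!: trans_le_add1)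
    have KR: "K j \<le> R" if "j \<in> {1..m}" for j
      using member_le_sum[of j "{1..m}" "\<lambda>j. K j x" for x] that
      by (auto simp: le_fun_def R_def plus_fun_apply sum_fun_apply intro!: trans_le_add2)
    \<comment> \<open>In the last case the spokes 1 and m have no users at all. All users then sit
      at the other m - 2 spokes, two fewer that can waste one, and this is worth one more hub
      pebble.\<close>
    consider "l 1 \<or> P 1" | "r (m - 1) \<or> P m" | "\<not> l 1" "\<not> P 1" "\<not> r (m - 1)" "\<not> P m" by blast
    then show "yields G D' (single u q + single (s 1) 1) \<or> yields G D' (single u q + single (s m) 1)
      \<or> (\<forall>X. 2 * X \<le> 2 * b + c + 3 - m \<longrightarrow> yields G D' (single u (q + X)))"
    proof cases
      case 1
      then have "yields G R (single (s 1) 1)"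
        using yields_mono[OF lE[of 1] ER] yields_mono[OF PK[of 1] KR] m by auto
      then show ?thesis using qs by blast
    next
      case 2
      then have "yields G R (single (s m) 1)"
        using yields_mono[OF rE[of "m - 1"] ER] yields_mono[OF PK[of m] KR] m by auto
      then show ?thesis using qs by blast
    next
      case 3
      have m1: "1 + (m - 2) = m - 1" using m by simp
      obtain Y where Y: "yields G ((\<Sum>i\<in>{1..m - 1}. E i) + (\<Sum>j\<in>{1<..m - 1}. K j)) (single u Y)"
        "(\<Sum>j\<in>{1<..m - 1}. ?d j) \<le> 2 * Y + (m - 2)"
        using match[of 1 "m - 2"] unfolding m1 by blast
      have "{1..m - 1} = {1..<m}" using m by auto
      moreover have "(\<Sum>j\<in>{1<..m - 1}. K j) \<le> (\<Sum>j\<in>{1..m}. K j)"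
        by (auto simp: le_fun_def sum_fun_apply intro!: sum_mono2)
      ultimately have "yields G R (single u Y)"
        using Y(1) by (elim yields_mono) (auto simp: R_def le_fun_def plus_fun_apply)
      moreover have "(\<Sum>j\<in>{0<..m}. ?d j) = (\<Sum>j\<in>{1<..m - 1}. ?d j)"
      proof (rule sum.mono_neutral_right)
        show "\<forall>j\<in>{0<..m} - {1<..m - 1}. ?d j = 0"
        proof
          fix j assume "j \<in> {0<..m} - {1<..m - 1}"
          then have "j = 1 \<or> j = m" by auto
          then show "?d j = 0" using 3 by (auto simp: r_def l_def)
        qed
      qed auto
      ultimately show ?thesis using users Y(2) m by (auto intro: shrink)
    qed
  qed
qed

lemma walk_snoc:
  assumes "walk G y L" "edge G (y L) u" "edge G u (y L)"
  shows "walk G (\<lambda>j. if j \<le> L then y j else u) (Suc L)"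
  using assms unfolding walk_def by (auto simp: less_Suc_eq le_less)

lemma yields_walk_start:
  assumes "walk G y L" "2 ^ L \<le> a" shows "yields G (single (y L) a) (single (y 0) 1)"
proof -
  let ?p = "\<lambda>j. if j = L then a else 0"
  have "yields G (\<Sum>j\<le>L. single (y j) (?p j)) (single (y 0) 1)"
    using assms by (intro yields_path) (auto simp: walk_def)
  moreover have "(\<Sum>j\<le>L. single (y j) (?p j)) = (\<Sum>j\<le>L. if j = L then single (y L) a else 0)"
    by (intro sum.cong) auto
  ultimately show ?thesis by simp
qed

lemma restr_sum:
  assumes "finite S" shows "restr S D = (\<Sum>x\<in>S. single x (D x))"
  using assms by (auto simp: fun_eq_iff restr_def sum_fun_apply single_apply)

text \<open>Here \<open>T\<close> is the claimed pebbling number, \<open>Q\<close> the number of pebbles collected on the hub, \<open>e + 1\<close> the number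
  still missing, and \<open>s\<close> the number of pebbles left in segment 0.\<close>

lemma user_count:
  fixes Z g h p m T Q e s j b c :: int
  assumes m: "m = 2 * h + p" "p = 0 \<or> p = 1" and Z: "0 \<le> Z" "1 \<le> g" "2 * g \<le> Z" and c: "0 \<le> c"
    and T: "T + 4 * Z = 4 * Z * Z + 2 + h * (3 * Z - 2) + p * (Z + g - 1)"
    and le: "T \<le> Q * (2 * Z) + s + (m - 1) * (Z - 1) + Z * b + g * c"
    and Q: "Q + e + 1 = 2 * Z" and s: "s \<le> j * Z"
  shows "m + 4 * e \<le> 2 * b + c + 1 + 2 * j"
proof (rule ccontr)
  assume "\<not> ?thesis"
  then have less: "2 * b + c \<le> m + 4 * e - 2 * j - 2" by simp
  have Q': "Q = 2 * Z - 1 - e" using Q by simp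
  from m(2) show False
  proof
    assume p: "p = 0"
    \<comment> \<open>A user costs at most Z/2: a piece with two usable ends costs Z and counts
      twice, one with a single usable end costs g.\<close>
    have "2 * (g * c) \<le> Z * c" using mult_right_mono[OF Z(3) c] by simp
    moreover have "Z * (2 * b + c) \<le> Z * (2 * h + 4 * e - 2 * j - 2)"
      using less m(1) p Z(1) by (intro mult_left_mono) auto
    ultimately show False
      using T le s unfolding Q' m(1) p by (simp add: algebra_simps)
  next
    assume p: "p = 1"
    \<comment> \<open>For odd m the bound on 2b + c is odd. Once b is fixed, c is at most d pairs,
      costing Z each at most, and one single user for g; this one is the reason for the summand Z +
      g - 1 in \<open>T\<close>.\<close>
    define d where "d = h - 1 + 2 * e - j - b"
    have cd: "c \<le> 2 * d + 1" using less m(1) p by (simp add: d_def)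
    then have d: "0 \<le> d" using c by linarith
    have "g * c \<le> g * (2 * d + 1)" using cd Z(2) by (intro mult_left_mono) auto
    also have "\<dots> = (2 * g) * d + g" by (simp add: algebra_simps)
    also have "\<dots> \<le> Z * d + g" using mult_right_mono[OF Z(3) d] by simp
    finally show False
      using T le s unfolding Q' m(1) p d_def by (simp add: algebra_simps)
  qed
qed

text \<open>These are the two facts needed about the surcharge g = f(C_(n+1)) - Z: it is positive
  and at most Z/2.\<close>

lemma half_gain:
  assumes "1 \<le> k"
  shows "2 ^ k + 1 \<le> fC (2 * k + 1)" "2 * fC (2 * k + 1) \<le> 3 * 2 ^ k"
proof -
  define Z F :: nat where "Z = 2 ^ k" and "F = 2 * Z div 3"
  have f: "fC (2 * k + 1) = 2 * F + 1" by (simp add: fC_def F_def Z_def)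
  have "3 * F \<le> 2 * Z" "2 * Z \<le> 3 * F + 2" unfolding F_def by auto
  \<comment> \<open>The estimate 8Z/3 + 2 \<le> 3Z holds only from Z = 6 on, so the two smaller
    powers are computed.\<close>
  moreover have "Z = 2 \<or> Z = 4 \<or> 8 \<le> Z"
  proof -
    have "k = 1 \<or> k = 2 \<or> 3 \<le> k" using assms by auto
    then show ?thesis using power_increasing[of 3 k "2::nat"] by (auto simp: Z_def)
  qed
  ultimately have "Z + 1 \<le> 2 * F + 1" "2 * (2 * F + 1) \<le> 3 * Z"
    by (auto simp: F_def)
  then show "2 ^ k + 1 \<le> fC (2 * k + 1)" "2 * fC (2 * k + 1) \<le> 3 * 2 ^ k"
    unfolding f by (simp_all add: Z_def)
qed

section \<open>The upper bound\<close>

locale jahangir_graph =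
  fixes k m :: nat
  assumes k: "1 \<le> k" and m: "3 \<le> m"
begin

abbreviation G where "G \<equiv> jahangir (2 * k) m"
abbreviation hub where "hub \<equiv> 2 * k * m"

text \<open>Indices are relative to segment \<open>r\<close>, so that the root may be assumed to lie in segment 0; \<open>seg r i\<close>
  consists of the inner vertices between the spokes \<open>i\<close> and \<open>i + 1\<close>.\<close>

definition v :: "nat \<Rightarrow> nat \<Rightarrow> nat" where "v r t = (2 * k * r + t) mod (2 * k * m)"
definition spoke :: "nat \<Rightarrow> nat \<Rightarrow> nat" where "spoke r j = v r (2 * k * j)"
definition seg :: "nat \<Rightarrow> nat \<Rightarrow> nat set" where "seg r i = (\<lambda>j. v r (2 * k * i + j)) ` {1..<2 * k}"

lemma km: "3 \<le> k * m" "0 < k * m"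
proof -
  have "1 * 3 \<le> k * m" using k m by (intro mult_le_mono) auto
  then show "3 \<le> k * m" "0 < k * m" using k m by auto
qed

lemma verts_G: "verts G = {0..hub}"
  by (simp add: verts_def jahangir_def)

lemma edge_G: "edge G a b \<longleftrightarrow>
    (a < hub \<and> b < hub \<and> a \<noteq> b \<and> (b = (a + 1) mod hub \<or> a = (b + 1) mod hub))
    \<or> (a = hub \<and> (\<exists>i<m. b = 2 * k * i)) \<or> (b = hub \<and> (\<exists>i<m. a = 2 * k * i))"
  unfolding edge_def verts_G by (auto simp: adj_def jahangir_def)

lemma v_less: "v r t < hub"
  using km by (simp add: v_def)

lemma v_Suc_edge: "edge G (v r t) (v r (Suc t))" "edge G (v r (Suc t)) (v r t)"
proof -
  define x where "x = v r t"
  have "x < hub" unfolding x_def by (rule v_less)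
  moreover have "v r (Suc t) = Suc x mod hub" by (simp add: x_def v_def mod_Suc_eq)
  moreover have "2 < hub" using km by simp
  ultimately show "edge G (v r t) (v r (Suc t))" "edge G (v r (Suc t)) (v r t)"
    unfolding x_def[symmetric] edge_G by (cases "Suc x = hub"; auto)+
qed

lemma spoke_eq: "spoke r j = 2 * k * ((r + j) mod m)"
  unfolding spoke_def v_def by (simp add: mod_mult_mult1 flip: distrib_left)

lemma spoke_edge: "edge G (spoke r j) hub" "edge G hub (spoke r j)"
proof -
  have "\<exists>i<m. spoke r j = 2 * k * i"
    using m unfolding spoke_eq by (intro exI[of _ "(r + j) mod m"]) auto
  then show "edge G (spoke r j) hub" "edge G hub (spoke r j)"
    unfolding edge_G by blast+
qed

lemma walk_v: "walk G (\<lambda>j. v r (a + j)) L"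
  unfolding walk_def using v_Suc_edge by simp

lemma v_inj: "inj_on (v r) {0..<hub}"
  unfolding v_def by (rule inj_on_mod_add)

lemma v_image: "v r ` {0..<hub} = {0..<hub}"
proof (rule card_subset_eq)
  show "v r ` {0..<hub} \<subseteq> {0..<hub}" using v_less by auto
  show "card (v r ` {0..<hub}) = card {0..<hub}" by (rule card_image[OF v_inj])
qed simp

lemma seg_inj:
  assumes "i < m" shows "inj_on (\<lambda>j. v r (2 * k * i + j)) {0..<2 * k}"
proof (rule inj_onI)
  fix a b assume ab: "a \<in> {0..<2 * k}" "b \<in> {0..<2 * k}" "v r (2 * k * i + a) = v r (2 * k * i + b)"
  have "2 * k * (i + 1) \<le> 2 * k * m" using assms by (intro mult_le_mono) auto
  then have "2 * k * i + a < hub" "2 * k * i + b < hub" using ab by auto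
  with inj_onD[OF v_inj ab(3)] show "a = b" by auto
qed

lemma seg_inj_wrap: "inj_on (\<lambda>j. v r (2 * k * i + j)) {1..<2 * k}"
proof -
  have "v r (2 * k * i + j) = v (r + i) j" for j by (simp add: v_def algebra_simps)
  then have "inj_on (\<lambda>j. v r (2 * k * i + j)) {0..<2 * k}"
    using seg_inj[of 0 "r + i"] m by simp
  then show ?thesis by (rule inj_on_subset) auto
qed

text \<open>Spoke 0 is listed as spoke m, so that the two spokes next to segment 0 become the first
  and the last one.\<close>

lemma sum_verts:
  fixes f :: "nat \<Rightarrow> 'z::comm_monoid_add"
  shows "(\<Sum>x\<in>verts G. f x) = f hub + (\<Sum>x\<in>seg r 0. f x)
    + ((\<Sum>i\<in>{1..<m}. \<Sum>x\<in>seg r i. f x) + (\<Sum>j\<in>{1..m}. f (spoke r j)))"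
proof -
  have "verts G = insert hub (v r ` {0..<hub})" unfolding v_image verts_G by auto
  moreover have "hub \<notin> v r ` {0..<hub}" unfolding v_image by simp
  ultimately have "(\<Sum>x\<in>verts G. f x) = f hub + (\<Sum>t\<in>{0..<hub}. f (v r t))"
    using v_inj by (simp add: sum.reindex)
  also have "(\<Sum>t\<in>{0..<hub}. f (v r t)) = (\<Sum>i<m. \<Sum>t\<in>{i * (2 * k)..<i * (2 * k) + 2 * k}. f (v r t))"
    by (simp add: sum.nat_group atLeast0LessThan mult.commute)
  also have "\<dots> = (\<Sum>i<m. f (spoke r i) + (\<Sum>x\<in>seg r i. f x))"
  proof (rule sum.cong[OF refl])
    fix i
    have "(\<Sum>t\<in>{i * (2 * k)..<i * (2 * k) + 2 * k}. f (v r t)) = (\<Sum>j\<in>{0..<2 * k}. f (v r (2 * k * i + j)))"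
      using sum.shift_bounds_nat_ivl[of "\<lambda>t. f (v r t)" 0 "i * (2 * k)" "2 * k"] by (simp add: ac_simps)
    also have "\<dots> = f (v r (2 * k * i)) + (\<Sum>j\<in>{1..<2 * k}. f (v r (2 * k * i + j)))"
      using k by (simp add: sum.atLeast_Suc_lessThan)
    also have "(\<Sum>j\<in>{1..<2 * k}. f (v r (2 * k * i + j))) = (\<Sum>x\<in>seg r i. f x)"
      unfolding seg_def by (subst sum.reindex[OF seg_inj_wrap]) simp
    finally show "(\<Sum>t\<in>{i * (2 * k)..<i * (2 * k) + 2 * k}. f (v r t)) = f (spoke r i) + (\<Sum>x\<in>seg r i. f x)"
      by (simp add: spoke_def)
  qed
  also have "\<dots> = (\<Sum>i<m. f (spoke r i)) + (\<Sum>i<m. \<Sum>x\<in>seg r i. f x)"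
    by (rule sum.distrib)
  also have "(\<Sum>i<m. \<Sum>x\<in>seg r i. f x) = (\<Sum>x\<in>seg r 0. f x) + (\<Sum>i\<in>{1..<m}. \<Sum>x\<in>seg r i. f x)"
    using m unfolding lessThan_atLeast0 by (simp add: sum.atLeast_Suc_lessThan)
  also have "(\<Sum>i<m. f (spoke r i)) = (\<Sum>j\<in>{1..m}. f (spoke r j))"
  proof -
    have "(\<Sum>i<m. f (spoke r i)) = f (spoke r 0) + (\<Sum>i\<in>{1..<m}. f (spoke r i))"
      using m unfolding lessThan_atLeast0 by (simp add: sum.atLeast_Suc_lessThan)
    moreover have "spoke r 0 = spoke r m" by (simp add: spoke_eq)
    moreover have "{1..m} = insert m {1..<m}" using m by auto
    ultimately show ?thesis by simp
  qed
  finally show ?thesis by (simp add: ac_simps)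
qed

lemma finite_seg [simp]: "finite (seg r i)"
  by (simp add: seg_def)

lemma seg_yields:
  shows "2 ^ k \<le> (\<Sum>x\<in>seg r i. E x) \<Longrightarrow>
      yields G (restr (seg r i) E) (single (spoke r i) 1) \<or> yields G (restr (seg r i) E) (single (spoke r (Suc i)) 1)"
    and "fC (2 * k + 1) \<le> (\<Sum>x\<in>seg r i. E x) \<Longrightarrow>
      (yields G (restr (seg r i) E) (single (spoke r i) 1) \<and> yields G (restr (seg r i) E) (single (spoke r (Suc i)) 1))
       \<or> yields G (restr (seg r i) E) (single hub 1)"
    and "2 * 2 ^ k \<le> (\<Sum>x\<in>seg r i. E x) \<Longrightarrow> yields G (restr (seg r i) E) (single hub 1)"
proof -
  let ?y = "\<lambda>j. v r (2 * k * i + j)"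
  have y: "?y 0 = spoke r i" "?y (2 * k) = spoke r (Suc i)" by (simp_all add: spoke_def add.commute)
  note w = walk_v[of r "2 * k * i" "2 * k"]
  have e: "edge G (?y (2 * k)) hub" "edge G hub (?y (2 * k))" "edge G (?y 0) hub" "edge G hub (?y 0)"
    unfolding y by (rule spoke_edge)+
  have L: "2 \<le> 2 * k" "1 \<le> 2 * k" using k by auto
  show "yields G (restr (seg r i) E) (single (spoke r i) 1) \<or> yields G (restr (seg r i) E) (single (spoke r (Suc i)) 1)"
    if "2 ^ k \<le> (\<Sum>x\<in>seg r i. E x)"
    using yields_closed_walk[OF w L(1) seg_inj_wrap, of E] that unfolding y seg_def by (simp add: fC_def)
  show "(yields G (restr (seg r i) E) (single (spoke r i) 1) \<and> yields G (restr (seg r i) E) (single (spoke r (Suc i)) 1))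
       \<or> yields G (restr (seg r i) E) (single hub 1)"
    if "fC (2 * k + 1) \<le> (\<Sum>x\<in>seg r i. E x)"
    using hub_segment_right[OF w e(1,2) L(2) seg_inj_wrap, of E] hub_segment_left[OF w e(3,4) L(2) seg_inj_wrap, of E] that
    unfolding y seg_def by auto
  show "yields G (restr (seg r i) E) (single hub 1)" if "2 * 2 ^ k \<le> (\<Sum>x\<in>seg r i. E x)"
    using hub_segment_both[OF w e L(2) seg_inj_wrap, of E] that unfolding seg_def by (simp add: fC_def)
qed


section \<open>The claimed value and the pebbles it forces onto the hub\<close>

text \<open>The right-hand side of the theorem after inserting (2Z - 1) 2Z for the t-fold number of
  C_(n+2) and 3Z - 2 for f(C_n) + f(C_(n+2)) - 2; \<open>m mod 2\<close> merges the two cases of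
  \<alpha>.\<close>

definition threshold :: nat where
  "threshold = 4 * 2 ^ k * 2 ^ k + 2 + (m div 2) * (3 * 2 ^ k - 2) + (m mod 2) * (fC (2 * k + 1) - 1) - 4 * 2 ^ k"

lemma threshold_int: "int threshold + 4 * 2 ^ k = 4 * 2 ^ k * 2 ^ k + 2 + int (m div 2) * (3 * 2 ^ k - 2) + int (m mod 2) * (int (fC (2 * k + 1)) - 1)"
proof -
  have "(4::nat) * 2 ^ k \<le> 4 * 2 ^ k * 2 ^ k" by simp
  then have T: "threshold + 4 * 2 ^ k = 4 * 2 ^ k * 2 ^ k + 2 + (m div 2) * (3 * 2 ^ k - 2) + (m mod 2) * (fC (2 * k + 1) - 1)"
    unfolding threshold_def by (intro le_add_diff_inverse2) linarith
  have "(2::nat) \<le> 3 * 2 ^ k" "1 \<le> fC (2 * k + 1)"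
    using half_gain(1)[OF k] one_le_power[of "2::nat" k] by linarith+
  then have "int (3 * 2 ^ k - 2) = 3 * 2 ^ k - 2" "int (fC (2 * k + 1) - 1) = int (fC (2 * k + 1)) - 1"
    by (simp_all only: of_nat_diff) simp_all
  moreover have "int (threshold + 4 * 2 ^ k) = int (4 * 2 ^ k * 2 ^ k + 2 + (m div 2) * (3 * 2 ^ k - 2) + (m mod 2) * (fC (2 * k + 1) - 1))"
    unfolding T ..
  ultimately show ?thesis by (simp only: of_nat_add of_nat_mult) simp
qed

text \<open>Each missing hub pebble forces four more users, while each Z pebbles held back in
  segment 0 cost two.\<close>

lemma users:
  assumes "threshold \<le> Q * (2 * 2 ^ k) + s + (m - 1) * (2 ^ k - 1) + 2 ^ k * b + (fC (2 * k + 1) - 2 ^ k) * c"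
    and "Q + e + 1 = 2 * 2 ^ k" and "s \<le> j * 2 ^ k"
  shows "m + 4 * e \<le> 2 * b + c + 1 + 2 * j"
proof -
  have g: "int (fC (2 * k + 1) - 2 ^ k) = int (fC (2 * k + 1)) - 2 ^ k"
    using half_gain(1)[OF k] by (simp add: of_nat_diff)
  have "int m + 4 * int e \<le> 2 * int b + int c + 1 + 2 * int j"
  proof (rule user_count)
    show "int m = 2 * int (m div 2) + int (m mod 2)" by presburger
    show "int (m mod 2) = 0 \<or> int (m mod 2) = 1" by auto
    show "(1::int) \<le> int (fC (2 * k + 1)) - 2 ^ k" "2 * (int (fC (2 * k + 1)) - 2 ^ k) \<le> 2 ^ k"
      using half_gain[OF k] by (simp_all flip: of_nat_le_iff[where 'a = int])
    show "int threshold + 4 * 2 ^ k = 4 * 2 ^ k * 2 ^ k + 2 + int (m div 2) * (3 * 2 ^ k - 2)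
        + int (m mod 2) * (2 ^ k + (int (fC (2 * k + 1)) - 2 ^ k) - 1)"
      using threshold_int by simp
    have "int threshold \<le> int (Q * (2 * 2 ^ k) + s + (m - 1) * (2 ^ k - 1) + 2 ^ k * b + (fC (2 * k + 1) - 2 ^ k) * c)"
      using assms(1) by (simp only: of_nat_le_iff)
    also have "\<dots> = int Q * (2 * 2 ^ k) + int s + (int m - 1) * (2 ^ k - 1) + 2 ^ k * int b + (int (fC (2 * k + 1)) - 2 ^ k) * int c"
      unfolding of_nat_add of_nat_mult g using m by (simp add: of_nat_diff)
    finally show "int threshold \<le> \<dots>" .
    show "int Q + int e + 1 = 2 * 2 ^ k" using assms(2) by (simp flip: of_nat_eq_iff[where 'a = int])
    show "int s \<le> int j * 2 ^ k" using assms(3) by (simp flip: of_nat_le_iff[where 'a = int])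
  qed auto
  then show ?thesis by simp
qed

definition outer :: "nat \<Rightarrow> (nat \<Rightarrow> nat) \<Rightarrow> nat \<Rightarrow> nat" where
  "outer r D = (\<Sum>i\<in>{1..<m}. restr (seg r i) D) + (\<Sum>j\<in>{1..m}. single (spoke r j) (D (spoke r j)))"

lemma parts_le: "single hub (D hub) + restr (seg r 0) D + outer r D \<le> D"
proof -
  have "single hub (D hub) + restr (seg r 0) D + outer r D = (\<Sum>x\<in>verts G. single x (D x))"
    unfolding sum_verts[of _ r] outer_def restr_sum[OF finite_seg] by simp
  also have "\<dots> = restr (verts G) D"
    by (rule restr_sum[symmetric]) (simp add: verts_G)
  also have "\<dots> \<le> D" by (simp add: restr_def le_fun_def)
  finally show ?thesis .
qed

lemma outer_extraction:
  assumes "distribution G D threshold"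
  shows "\<exists>q b c.
    threshold \<le> (D hub + q) * (2 * 2 ^ k) + (\<Sum>x\<in>seg r 0. D x) + (m - 1) * (2 ^ k - 1) + 2 ^ k * b + (fC (2 * k + 1) - 2 ^ k) * c \<and>
    (\<forall>X. 2 * X \<le> 2 * b + c + 1 - m \<longrightarrow> yields G (outer r D) (single hub (q + X))) \<and>
    (yields G (outer r D) (single hub q + single (spoke r 1) 1) \<or> yields G (outer r D) (single hub q + single (spoke r m) 1)
      \<or> (\<forall>X. 2 * X \<le> 2 * b + c + 3 - m \<longrightarrow> yields G (outer r D) (single hub (q + X))))"
proof -
  have g: "2 ^ k + (fC (2 * k + 1) - 2 ^ k) = fC (2 * k + 1)" "1 \<le> fC (2 * k + 1) - 2 ^ k"
    using half_gain(1)[OF k] by auto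
  obtain q b c where
    1: "(\<Sum>i\<in>{1..<m}. \<Sum>x\<in>seg r i. D x) + (\<Sum>j\<in>{1..m}. D (spoke r j))
      \<le> q * (2 * 2 ^ k) + (m - 1) * (2 ^ k - 1) + 2 ^ k * b + (fC (2 * k + 1) - 2 ^ k) * c"
    and 2: "\<And>X. 2 * X \<le> 2 * b + c + 1 - m \<Longrightarrow> yields G (outer r D) (single hub (q + X))"
    and 3: "yields G (outer r D) (single hub q + single (spoke r 1) 1) \<or> yields G (outer r D) (single hub q + single (spoke r m) 1)
      \<or> (\<forall>X. 2 * X \<le> 2 * b + c + 3 - m \<longrightarrow> yields G (outer r D) (single hub (q + X)))"
  proof (rule extraction[of m "2 ^ k" "fC (2 * k + 1) - 2 ^ k" "seg r" G "spoke r" hub "outer r D" D])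
    show "2 \<le> m" using m by simp
    show "2 ^ k + (fC (2 * k + 1) - 2 ^ k) \<le> sum E (seg r i) \<Longrightarrow>
      (yields G (restr (seg r i) E) (single (spoke r i) 1) \<and> yields G (restr (seg r i) E) (single (spoke r (Suc i)) 1))
       \<or> yields G (restr (seg r i) E) (single hub 1)" for i E
      unfolding g(1) by (rule seg_yields(2))
  qed (use g(2) seg_yields(1,3) spoke_edge in \<open>auto simp: outer_def\<close>)
  have "threshold = D hub + (\<Sum>x\<in>seg r 0. D x)
    + ((\<Sum>i\<in>{1..<m}. \<Sum>x\<in>seg r i. D x) + (\<Sum>j\<in>{1..m}. D (spoke r j)))"
    using assms unfolding distribution_def sum_verts[of D r] by simp
  moreover have "D hub \<le> D hub * (2 * 2 ^ k)" by simp
  ultimately have "threshold \<le> (D hub + q) * (2 * 2 ^ k) + (\<Sum>x\<in>seg r 0. D x) + (m - 1) * (2 ^ k - 1) + 2 ^ k * b + (fC (2 * k + 1) - 2 ^ k) * c"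
    using 1 unfolding add_mult_distrib by linarith
  with 2 3 show ?thesis by blast
qed

text \<open>Half of the 2Z hub pebbles are enough here, and every missing one is compensated twice,
  so segment 0 may be treated like the others and its remainder ignored.\<close>

lemma near_root:
  assumes D: "distribution G D threshold" and w: "walk G y d" "y d = hub" "d \<le> k"
  shows "yields G D (single (y 0) 1)"
proof -
  obtain q b c where
    1: "threshold \<le> (D hub + q) * (2 * 2 ^ k) + (\<Sum>x\<in>seg 0 0. D x) + (m - 1) * (2 ^ k - 1) + 2 ^ k * b + (fC (2 * k + 1) - 2 ^ k) * c"
    and 2: "\<And>X. 2 * X \<le> 2 * b + c + 1 - m \<Longrightarrow> yields G (outer 0 D) (single hub (q + X))"
    using outer_extraction[OF D, of 0] by blast
  obtain p E where p: "yields G (restr (seg 0 0) D) (single hub p + restr (seg 0 0) E)"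
      "\<not> yields G (restr (seg 0 0) E) (single hub 1)" "(\<Sum>x\<in>seg 0 0. D x) \<le> p * (2 * 2 ^ k) + (\<Sum>x\<in>seg 0 0. E x)"
    by (rule yields_extract[OF finite_seg seg_yields(3)])
  define Q where "Q = D hub + p + q"
  have s: "(\<Sum>x\<in>seg 0 0. E x) \<le> 2 * 2 ^ k"
    using seg_yields(3)[of E 0 0] p(2) by linarith
  have all: "yields G D (single hub (D hub + p + (q + X)))" if "2 * X \<le> 2 * b + c + 1 - m" for X
  proof (rule yields_mono[OF _ parts_le[of D 0]])
    show "yields G (single hub (D hub) + restr (seg 0 0) D + outer 0 D)
      (single hub (D hub) + (single hub p + restr (seg 0 0) E) + single hub (q + X))"
      by (intro yields_add yields_refl p 2 that)
  qed (auto simp: pointwise)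
  have "\<exists>X. 2 * X \<le> 2 * b + c + 1 - m \<and> 2 ^ k \<le> Q + X"
  proof (cases "2 ^ k \<le> Q")
    case True
    then show ?thesis by (intro exI[of _ 0]) auto
  next
    case False
    define e where "e = 2 * 2 ^ k - 1 - Q"
    have e: "Q + e + 1 = 2 * 2 ^ k" "2 ^ k \<le> e" using False by (simp_all add: e_def)
    have "threshold \<le> Q * (2 * 2 ^ k) + (\<Sum>x\<in>seg 0 0. E x) + (m - 1) * (2 ^ k - 1) + 2 ^ k * b + (fC (2 * k + 1) - 2 ^ k) * c"
      using 1 p(3) unfolding Q_def add_mult_distrib by linarith
    from users[OF this e(1) s] have "m + 4 * e \<le> 2 * b + c + 5" by simp
    moreover have "(2::nat) \<le> 2 ^ k" using k power_increasing[of 1 k "2::nat"] by simp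
    \<comment> \<open>The users pay for 2e - 2 meetings, which raises the 2Z - 1 - e pebbles at hand
      to 2Z - 3 + e; this suffices because e \<ge> Z \<ge> 2.\<close>
    ultimately show ?thesis
      using e by (intro exI[of _ "2 * e - 2"]) linarith
  qed
  then obtain X where X: "2 * X \<le> 2 * b + c + 1 - m" "2 ^ k \<le> Q + X" by blast
  have "(2::nat) ^ d \<le> 2 ^ k" using w(3) by (intro power_increasing) auto
  then have "2 ^ d \<le> D hub + p + (q + X)" using X(2) unfolding Q_def by linarith
  from yields_walk_start[OF w(1) this] show ?thesis
    using yields_trans[OF all[OF X(1)]] unfolding w(2) by blast
qed


text \<open>The path leads from the root through half of segment 0 and over a spoke to the hub. Its
  pebbles count like those on the hub towards 2^(k+1), so a pebble in segment 0 replaces one on the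
  hub.\<close>

lemma half_segment:
  assumes w: "walk G y (Suc k)" "y (Suc k) = hub"
    and inj: "inj_on y {1..<k}" "y ` {1..<k} \<subseteq> seg r 0"
  shows "2 ^ (k - 1) \<le> (\<Sum>j\<in>{1..<k}. D (y j)) \<Longrightarrow> yields G (restr (seg r 0) D) (single (y 0) 1)"
    and "2 * 2 ^ k \<le> a + (\<Sum>j\<in>{1..<k}. D (y j)) \<Longrightarrow> yields G (single hub a + restr (seg r 0) D) (single (y 0) 1)"
proof -
  have le: "(\<Sum>j\<in>{1..<k}. single (y j) (D (y j))) \<le> restr (seg r 0) D"
    unfolding restr_walk[OF inj(1), symmetric] using inj(2) by (auto simp: restr_def le_fun_def)
  have e: "edge G (y (Suc j)) (y j)" if "j < Suc k" for j using w(1) that by (simp add: walk_def)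
  show "yields G (restr (seg r 0) D) (single (y 0) 1)" if x: "2 ^ (k - 1) \<le> (\<Sum>j\<in>{1..<k}. D (y j))"
  proof -
    define p where "p j = (if j = 0 then 0 else D (y j))" for j
    have S: "(\<Sum>j\<le>k - 1. f (y j) (p j)) = (\<Sum>j\<in>{1..<k}. f (y j) (D (y j)))"
      if "\<And>v. f v 0 = 0" for f :: "nat \<Rightarrow> nat \<Rightarrow> 'z::comm_monoid_add"
      by (rule sum.mono_neutral_cong_right) (use k that in \<open>auto simp: p_def\<close>)
    have "yields G (\<Sum>j\<le>k - 1. single (y j) (p j)) (single (y 0) 1)"
      using x S[of "\<lambda>v a. a"] k by (intro yields_path e) auto
    then show ?thesis unfolding S[of single, OF single_0] using le by (rule yields_mono) simp
  qed
  show "yields G (single hub a + restr (seg r 0) D) (single (y 0) 1)" if x: "2 * 2 ^ k \<le> a + (\<Sum>j\<in>{1..<k}. D (y j))"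
  proof -
    define p where "p j = (if j = Suc k then a else if j = 0 \<or> j = k then 0 else D (y j))" for j
    have S: "(\<Sum>j\<le>Suc k. f (y j) (p j)) = (\<Sum>j\<in>{1..<k}. f (y j) (D (y j))) + f (y (Suc k)) a"
      if "\<And>v. f v 0 = 0" for f :: "nat \<Rightarrow> nat \<Rightarrow> 'z::comm_monoid_add"
    proof -
      have "(\<Sum>j\<le>k. f (y j) (p j)) = (\<Sum>j\<in>{1..<k}. f (y j) (D (y j)))"
        by (rule sum.mono_neutral_cong_right) (use that in \<open>auto simp: p_def\<close>)
      then show ?thesis by (simp add: p_def)
    qed
    have "yields G (\<Sum>j\<le>Suc k. single (y j) (p j)) (single (y 0) 1)"
      using x S[of "\<lambda>v a. a"] by (intro yields_path e) auto
    then have "yields G ((\<Sum>j\<in>{1..<k}. single (y j) (D (y j))) + single hub a) (single (y 0) 1)"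
      unfolding S[of single, OF single_0] w(2) .
    then show ?thesis
      by (rule yields_mono) (use le in \<open>auto simp: pointwise add.commute add_mono\<close>)
  qed
qed

lemma midpoint_root:
  assumes D: "distribution G D threshold" shows "yields G D (single (v r k) 1)"
proof -
  let ?w = "v r k"
  obtain q b c where
    1: "threshold \<le> (D hub + q) * (2 * 2 ^ k) + (\<Sum>x\<in>seg r 0. D x) + (m - 1) * (2 ^ k - 1) + 2 ^ k * b + (fC (2 * k + 1) - 2 ^ k) * c"
    and 2: "\<And>X. 2 * X \<le> 2 * b + c + 1 - m \<Longrightarrow> yields G (outer r D) (single hub (q + X))"
    and 3: "yields G (outer r D) (single hub q + single (spoke r 1) 1) \<or> yields G (outer r D) (single hub q + single (spoke r m) 1)
      \<or> (\<forall>X. 2 * X \<le> 2 * b + c + 3 - m \<longrightarrow> yields G (outer r D) (single hub (q + X)))"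
    using outer_extraction[OF D, of r] by blast
  define yl where "yl j = (if j \<le> k then v r (k - j) else hub)" for j
  define yr where "yr j = (if j \<le> k then v r (k + j) else hub)" for j
  have sp: "v r 0 = spoke r m" "v r (k + k) = spoke r 1"
    unfolding spoke_eq[of r m] by (simp_all add: spoke_def v_def mult_2 mod_mult_mult1)
  have walks: "walk G (\<lambda>j. v r (k - j)) k" "walk G (\<lambda>j. v r (k + j)) k"
    using walk_rev[OF walk_v[of r 0 k]] walk_v[of r k k] by simp_all
  have yl: "walk G yl (Suc k)" "yl (Suc k) = hub" "yl 0 = ?w"
    using walk_snoc[OF walks(1), of hub] sp spoke_edge unfolding yl_def by (simp_all add: fun_eq_iff)
  have yr: "walk G yr (Suc k)" "yr (Suc k) = hub" "yr 0 = ?w"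
    using walk_snoc[OF walks(2), of hub] sp spoke_edge unfolding yr_def by (simp_all add: fun_eq_iff)
  have inj0: "inj_on (v r) {0..<2 * k}" using seg_inj[of 0 r] m by simp
  have inj: "inj_on yl {1..<k}" "inj_on yr {1..<k}"
  proof -
    show "inj_on yl {1..<k}"
    proof (rule inj_onI)
      fix a b assume ab: "a \<in> {1..<k}" "b \<in> {1..<k}" "yl a = yl b"
      then have "k - a = k - b" using inj_onD[OF inj0, of "k - a" "k - b"] by (auto simp: yl_def)
      then show "a = b" using ab by auto
    qed
    show "inj_on yr {1..<k}"
    proof (rule inj_onI)
      fix a b assume ab: "a \<in> {1..<k}" "b \<in> {1..<k}" "yr a = yr b"
      then show "a = b" using inj_onD[OF inj0, of "k + a" "k + b"] by (auto simp: yr_def)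
    qed
  qed
  have sub: "yl ` {1..<k} \<subseteq> seg r 0" "yr ` {1..<k} \<subseteq> seg r 0"
    by (auto simp: yl_def yr_def seg_def intro!: imageI)
  let ?xl = "\<Sum>j\<in>{1..<k}. D (yl j)" and ?xr = "\<Sum>j\<in>{1..<k}. D (yr j)"
  have p0: "(\<Sum>x\<in>seg r 0. D x) = ?xl + D ?w + ?xr"
  proof -
    have "(\<Sum>x\<in>seg r 0. D x) = (\<Sum>j\<in>{1..<2 * k}. D (v r j))"
      unfolding seg_def using inj_on_subset[OF inj0, of "{1..<2 * k}"] by (simp add: sum.reindex)
    also have "{1..<2 * k} = {1..<k} \<union> ({k} \<union> {Suc k..<2 * k})" using k by auto
    also have "(\<Sum>j\<in>\<dots>. D (v r j)) = (\<Sum>j\<in>{1..<k}. D (v r j)) + (D (v r k) + (\<Sum>j\<in>{Suc k..<2 * k}. D (v r j)))"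
      by (simp add: sum.union_disjoint)
    also have "(\<Sum>j\<in>{1..<k}. D (v r j)) = ?xl"
      by (rule sum.reindex_bij_witness[of _ "\<lambda>j. k - j" "\<lambda>j. k - j"]) (auto simp: yl_def)
    also have "(\<Sum>j\<in>{Suc k..<2 * k}. D (v r j)) = ?xr"
      by (rule sum.reindex_bij_witness[of _ "\<lambda>j. k + j" "\<lambda>j. j - k"]) (auto simp: yr_def)
    finally show ?thesis by simp
  qed
  obtain y where y: "walk G y (Suc k)" "y (Suc k) = hub" "y 0 = ?w" "inj_on y {1..<k}" "y ` {1..<k} \<subseteq> seg r 0"
    "?xl + ?xr \<le> 2 * (\<Sum>j\<in>{1..<k}. D (y j))"
  proof (cases "?xl \<le> ?xr")
    case True
    then show ?thesis using that[of yr] yr inj sub by simp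
  next
    case False
    then show ?thesis using that[of yl] yl inj sub by simp
  qed
  define x where "x = (\<Sum>j\<in>{1..<k}. D (y j))"
  note half = half_segment[OF y(1,2,4,5), where D = D, folded x_def, unfolded y(3)]
  have kk: "(2::nat) ^ k = 2 * 2 ^ (k - 1)" using k by (cases k) auto
  have seg_le: "restr (seg r 0) D \<le> D" by (simp add: restr_def le_fun_def)
  show ?thesis
  proof (cases "1 \<le> D ?w \<or> 2 ^ (k - 1) \<le> x")
    case True
    then show ?thesis
    proof
      assume "1 \<le> D ?w"
      then show ?thesis by (intro yields_le) (auto simp: pointwise)
    next
      assume "2 ^ (k - 1) \<le> x"
      from yields_mono[OF half(1)[OF this] seg_le] show ?thesis by simp
    qed
  next
    case False
    define s where "s = (\<Sum>x\<in>seg r 0. D x)"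
    have s: "s \<le> 2 * x" "s \<le> 2 ^ k" using False p0 y(6) unfolding s_def x_def[symmetric] kk by simp_all
    define Q where "Q = D hub + q"
    have fin: "yields G D (single ?w 1)" if "yields G (outer r D) (single hub (q + X))" "2 * 2 ^ k \<le> Q + X + x" for X
    proof (rule yields_mono[OF _ parts_le[of D r]])
      have a: "yields G (single hub (D hub) + restr (seg r 0) D + outer r D)
        (single hub (D hub) + restr (seg r 0) D + single hub (q + X))"
        by (intro yields_add yields_refl that(1))
      have b: "single hub (D hub) + restr (seg r 0) D + single hub (q + X) = single hub (Q + X) + restr (seg r 0) D"
        unfolding Q_def single_add by (simp add: ac_simps)
      show "yields G (single hub (D hub) + restr (seg r 0) D + outer r D) (single ?w 1)"
        by (rule yields_trans[OF a]) (unfold b, rule half(2)[OF that(2)])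
    qed simp
    show ?thesis
    proof (cases "2 * 2 ^ k \<le> Q + x")
      case True
      then show ?thesis using fin[OF 2[of 0]] by simp
    next
      case lt: False
      define e where "e = 2 * 2 ^ k - 1 - Q"
      have e: "Q + e + 1 = 2 * 2 ^ k" using lt by (simp add: e_def)
      note users = users[OF 1[folded Q_def s_def] e]
      show ?thesis
      proof (cases "s = 0")
        case False
        then have "1 \<le> x" using s by simp
        moreover have "m + 4 * e \<le> 2 * b + c + 3" using users[of 1] s by simp
        \<comment> \<open>By \<open>lt\<close>, x \<le> e; hence 2e - 1 meetings lead to 2Z - 2 + e
          + x \<ge> 2Z.\<close>
        ultimately show ?thesis
          using e lt by (intro fin[OF 2[of "2 * e - 1"]]) linarith+
      next
        case True
        then have u: "m + 4 * e \<le> 2 * b + c + 1" using users[of 0] by simp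
        show ?thesis
        proof (cases "e = 0")
          case False
          then show ?thesis using e u by (intro fin[OF 2[of "2 * e"]]) linarith+
        next
          case True
          with e have Q: "Q = 2 * 2 ^ k - 1" by simp
          \<comment> \<open>The hub sends \<open>2 ^ k - 1\<close> pebbles to a spoke next to the root that already has one.\<close>
          have via: "yields G D (single ?w 1)" if sp: "yields G (outer r D) (single hub q + single t 1)"
            "edge G hub t" "walk G z k" "z 0 = ?w" "z k = t" for t z
          proof (rule yields_mono[OF _ parts_le[of D r]])
            have A: "yields G (single hub (D hub) + restr (seg r 0) D + outer r D)
              (single hub (D hub) + (single hub q + single t 1))"
              using yields_add[OF yields_le[of "single hub (D hub)" "single hub (D hub) + restr (seg r 0) D"] sp(1)]
              by (simp add: pointwise)
            have B: "yields G (single hub (D hub) + (single hub q + single t 1)) (single t (2 ^ k))"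
            proof -
              have "(1::nat) \<le> 2 ^ k" by simp
              with Q have "Q = 2 * (2 ^ k - 1) + 1" by linarith
              then have "Q div 2 = 2 ^ k - 1" by simp
              then have "yields G (single hub Q + single t 1) (single t (2 ^ k - 1) + single t 1)"
                using yields_edge_div[OF sp(2), of Q] by (intro yields_add yields_refl) simp
              then show ?thesis
                unfolding Q_def by (simp add: single_add[symmetric] add.assoc[symmetric])
            qed
            have C: "yields G (single t (2 ^ k)) (single ?w 1)"
              using yields_walk_start[OF sp(3), of "2 ^ k"] sp(4,5) by simp
            show "yields G (single hub (D hub) + restr (seg r 0) D + outer r D) (single ?w 1)"
              by (rule yields_trans[OF yields_trans[OF A B] C])
          qed simp
          from 3 show ?thesis
          proof (elim disjE)
            assume "yields G (outer r D) (single hub q + single (spoke r 1) 1)"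
            then show ?thesis using via[OF _ spoke_edge(2) walks(2)] sp by simp
          next
            assume "yields G (outer r D) (single hub q + single (spoke r m) 1)"
            then show ?thesis using via[OF _ spoke_edge(2) walks(1)] sp by simp
          next
            assume a: "\<forall>X. 2 * X \<le> 2 * b + c + 3 - m \<longrightarrow> yields G (outer r D) (single hub (q + X))"
            have "yields G (outer r D) (single hub (q + 1))" using a[rule_format, of 1] u True by simp
            then show ?thesis by (rule fin) (use Q in simp)
          qed
        qed
      qed
    qed
  qed
qed

theorem upper_bound:
  assumes D: "distribution G D threshold" and w: "w \<in> verts G"
  shows "yields G D (single w 1)"
proof (cases "w = hub")
  case True
  then show ?thesis using near_root[OF D, of "\<lambda>j. hub" 0] by (simp add: walk_def)
next
  case False
  define r where "r = w div (2 * k)"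
  define j where "j = w mod (2 * k)"
  have w2: "w < hub" using w False by (simp add: verts_G)
  have wr: "w = v r j" using w2 by (simp add: v_def r_def j_def)
  have j: "j < 2 * k" using k by (simp add: j_def)
  consider "j < k" | "j = k" | "k < j" by linarith
  then show ?thesis
  proof cases
    case 1
    have "walk G (\<lambda>i. v r (j - i)) j" using walk_rev[OF walk_v[of r 0 j]] by simp
    moreover have "v r (j - j) = spoke r 0" by (simp add: spoke_def)
    ultimately have "walk G (\<lambda>i. if i \<le> j then v r (j - i) else hub) (Suc j)"
      using spoke_edge[of r 0] by (intro walk_snoc) auto
    from near_root[OF D this] show ?thesis using 1 wr by simp
  next
    case 2
    then show ?thesis using midpoint_root[OF D, of r] wr by simp
  next
    case 3
    have "v r (j + (2 * k - j)) = spoke r 1" using j by (simp add: spoke_def)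
    then have "walk G (\<lambda>i. if i \<le> 2 * k - j then v r (j + i) else hub) (Suc (2 * k - j))"
      using spoke_edge[of r 1] by (intro walk_snoc walk_v) auto
    from near_root[OF D this] show ?thesis using 3 j wr by simp
  qed
qed

end

section \<open>The lower bound\<close>

text \<open>Integral changes pass through the rounding unharmed; for this reason the effect of a
  reverse move is always recorded by integers.\<close>

lemma floor_le_floor_add:
  fixes s t :: real
  assumes "s \<le> t + of_int d" shows "\<lfloor>s\<rfloor> \<le> \<lfloor>t\<rfloor> + d"
proof -
  have "of_int (\<lfloor>s\<rfloor> - d) \<le> t" using assms of_int_floor_le[of s] unfolding of_int_diff by linarith
  then show ?thesis unfolding le_floor_iff[symmetric] by linarith
qed

lemma half_step: "(X + (of_bool P - 2 * of_bool Q)) div 2 \<le> X div 2 + (of_bool P - of_bool Q)" for X :: int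
  unfolding of_bool_def by (cases P; cases Q; simp only: if_True if_False not_True_eq_False; presburger)

text \<open>\<open>al c x\<close> is the number of pebbles on \<open>x\<close> in role \<open>c\<close>. The roles are: 0 and 1, moving to the spoke below and
  above; 2 and 3, travelling along the cycle to the root \<open>k\<close> through the spokes 0 and \<open>2 * k\<close>.
  A reverse move takes \<open>a\<close> pebbles of role \<open>c\<close> from \<open>y\<close> and puts \<open>b\<close> of role \<open>c'\<close> on \<open>x\<close>.\<close>

definition shift :: "(nat \<Rightarrow> nat \<Rightarrow> nat) \<Rightarrow> nat \<Rightarrow> nat \<Rightarrow> nat \<Rightarrow> nat \<Rightarrow> nat \<Rightarrow> nat \<Rightarrow> nat \<Rightarrow> nat \<Rightarrow> nat" where
  "shift al a c y b c' x = (\<lambda>d z. al d z - a * of_bool (d = c \<and> z = y) + b * of_bool (d = c' \<and> z = x))"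

context jahangir_graph
begin

section \<open>Weights of the four roles\<close>

text \<open>The unit is a pebble on spoke 0, resp. on spoke \<open>2 * k\<close> for
  \<open>w1\<close>: weights double towards the root and halve away from it. Both are 2^k at the
  root \<open>k\<close>, which permits a change of direction there.\<close>

definition w0 :: "nat \<Rightarrow> real" where
  "w0 x = (if x \<le> k then 2 ^ x else (1 / 2) ^ (hub - x))"

definition w1 :: "nat \<Rightarrow> real" where
  "w1 x = (if x < k then 0 else 2 ^ k * (1 / 2) ^ (x - k))"

definition wl :: "nat \<Rightarrow> nat \<Rightarrow> real" where
  "wl j x = (if 2 * k * j \<le> x \<and> x < 2 * k * j + 2 * k then (1 / 2) ^ (x - 2 * k * j) else 0)"

text \<open>Unlike \<open>wl j\<close>, this vanishes on spoke j itself, so that a pebble on a spoke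
  is credited to that spoke by role 0 only.\<close>

definition wr :: "nat \<Rightarrow> nat \<Rightarrow> real" where
  "wr j x = (if 2 * k * j < x + 2 * k \<and> x < 2 * k * j then (1 / 2) ^ (2 * k * j - x) else 0)"

definition wsum :: "(nat \<Rightarrow> nat) \<Rightarrow> (nat \<Rightarrow> real) \<Rightarrow> real" where
  "wsum f w = (\<Sum>x<hub. real (f x) * w x)"

text \<open>The unit is one pebble on the hub. A pebble on a spoke next to the root costs two of them, while at any
  other spoke two pebbles yield one.\<close>

definition worth :: "(nat \<Rightarrow> nat \<Rightarrow> nat) \<Rightarrow> int \<Rightarrow> int" where
  "worth al h = h + 2 * \<lfloor>wsum (al 2) w0\<rfloor> + 2 * \<lfloor>wsum (al 3) w1\<rfloor>
     + (\<Sum>j\<in>{2..<m}. (\<lfloor>wsum (al 0) (wl j)\<rfloor> + \<lfloor>wsum (al 1) (wr j)\<rfloor>) div 2)"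

definition allocation :: "(nat \<Rightarrow> nat) \<Rightarrow> (nat \<Rightarrow> nat \<Rightarrow> nat) \<Rightarrow> bool" where
  "allocation D al \<longleftrightarrow> (\<forall>x<hub. al 0 x + al 1 x + al 2 x + al 3 x \<le> D x)"

definition bounded_worth :: "(nat \<Rightarrow> nat) \<Rightarrow> bool" where
  "bounded_worth D \<longleftrightarrow> (\<forall>al. allocation D al \<longrightarrow> worth al (int (D hub)) < 2 * 2 ^ k)"

text \<open>\<open>p\<close> is a spoke that may lose one pebble and \<open>q\<close> one that gains two, which costs, respectively pays, at most
  one hub pebble.\<close>

lemma worth_le:
  assumes "wsum (al 2) w0 \<le> wsum (al' 2) w0 + of_int ea"
    and "wsum (al 3) w1 \<le> wsum (al' 3) w1 + of_int eb"
    and "\<And>j. j \<in> {2..<m} \<Longrightarrow> wsum (al 0) (wl j) \<le> wsum (al' 0) (wl j) + of_int (el j)"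
    and "\<And>j. j \<in> {2..<m} \<Longrightarrow> wsum (al 1) (wr j) \<le> wsum (al' 1) (wr j) + of_int (er j)"
    and "\<And>j. j \<in> {2..<m} \<Longrightarrow> el j + er j \<le> of_bool (j = p) - 2 * of_bool (j = q)"
    and "h + 2 * ea + 2 * eb + of_bool (p \<in> {2..<m}) - of_bool (q \<in> {2..<m}) \<le> h'"
  shows "worth al h \<le> worth al' h'"
proof -
  let ?b = "\<lambda>al j. \<lfloor>wsum (al 0) (wl j)\<rfloor> + \<lfloor>wsum (al 1) (wr j)\<rfloor>"
  have "?b al j div 2 \<le> ?b al' j div 2 + (of_bool (j = p) - of_bool (j = q))" if j: "j \<in> {2..<m}" for j
  proof -
    have "?b al j \<le> ?b al' j + (of_bool (j = p) - 2 * of_bool (j = q))"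
      using floor_le_floor_add[OF assms(3)[OF j]] floor_le_floor_add[OF assms(4)[OF j]] assms(5)[OF j] by linarith
    then have "?b al j div 2 \<le> (?b al' j + (of_bool (j = p) - 2 * of_bool (j = q))) div 2"
      by (rule zdiv_mono1) simp
    also have "\<dots> \<le> ?b al' j div 2 + (of_bool (j = p) - of_bool (j = q))"
      by (rule half_step)
    finally show ?thesis .
  qed
  then have "(\<Sum>j\<in>{2..<m}. ?b al j div 2) \<le> (\<Sum>j\<in>{2..<m}. ?b al' j div 2 + (of_bool (j = p) - of_bool (j = q)))"
    by (rule sum_mono)
  also have "\<dots> = (\<Sum>j\<in>{2..<m}. ?b al' j div 2) + (of_bool (p \<in> {2..<m}) - of_bool (q \<in> {2..<m}))"
    by (simp add: sum.distrib sum_subtractf of_bool_def)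
  finally show ?thesis
    using floor_le_floor_add[OF assms(1)] floor_le_floor_add[OF assms(2)] assms(6)
    unfolding worth_def by linarith
qed

lemma wsum_shift:
  assumes "a \<le> al c y" "x < hub" "y < hub"
  shows "wsum (shift al a c y b c' x d) w
    = wsum (al d) w - real a * of_bool (d = c) * w y + real b * of_bool (d = c') * w x"
proof -
  have "wsum (shift al a c y b c' x d) w = (\<Sum>z<hub. real (al d z) * w z
      + ((if z = y then - (real a * of_bool (d = c) * w y) else 0) + (if z = x then real b * of_bool (d = c') * w x else 0)))"
    unfolding wsum_def shift_def
    by (intro sum.cong) (use assms(1) in \<open>auto simp: of_nat_diff algebra_simps\<close>)
  also have "\<dots> = wsum (al d) w + (- (real a * of_bool (d = c) * w y) + real b * of_bool (d = c') * w x)"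
    unfolding sum.distrib wsum_def using assms(2,3) by simp
  finally show ?thesis by simp
qed

text \<open>\<open>ea\<close>, \<open>eb\<close>, \<open>el\<close> and \<open>er\<close> bound what
  the four weighted sums lose by the shift; negative values are guaranteed gains.\<close>

lemma worth_shift:
  assumes "a \<le> al c y" "x < hub" "y < hub"
    and "real a * of_bool (2 = c) * w0 y \<le> real b * of_bool (2 = c') * w0 x + of_int ea"
    and "real a * of_bool (3 = c) * w1 y \<le> real b * of_bool (3 = c') * w1 x + of_int eb"
    and "\<And>j. j \<in> {2..<m} \<Longrightarrow> real a * of_bool (0 = c) * wl j y \<le> real b * of_bool (0 = c') * wl j x + of_int (el j)"
    and "\<And>j. j \<in> {2..<m} \<Longrightarrow> real a * of_bool (1 = c) * wr j y \<le> real b * of_bool (1 = c') * wr j x + of_int (er j)"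
    and "\<And>j. j \<in> {2..<m} \<Longrightarrow> el j + er j \<le> of_bool (j = p) - 2 * of_bool (j = q)"
    and "h + 2 * ea + 2 * eb + of_bool (p \<in> {2..<m}) - of_bool (q \<in> {2..<m}) \<le> h'"
  shows "worth al h \<le> worth (shift al a c y b c' x) h'"
proof (rule worth_le[where el = el and er = er])
  note [simp] = wsum_shift[of a al c y x, OF assms(1-3)]
  show "wsum (al 2) w0 \<le> wsum (shift al a c y b c' x 2) w0 + of_int ea" using assms(4) by simp
  show "wsum (al 3) w1 \<le> wsum (shift al a c y b c' x 3) w1 + of_int eb" using assms(5) by simp
  show "wsum (al 0) (wl j) \<le> wsum (shift al a c y b c' x 0) (wl j) + of_int (el j)" if "j \<in> {2..<m}" for j
    using assms(6)[OF that] by simp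
  show "wsum (al 1) (wr j) \<le> wsum (shift al a c y b c' x 1) (wr j) + of_int (er j)" if "j \<in> {2..<m}" for j
    using assms(7)[OF that] by simp
qed (use assms(8,9) in auto)


section \<open>Reversing a single move\<close>

lemma edge_cases [consumes 1, case_names to_hub from_hub up down]:
  assumes "edge G x y"
  obtains j where "j < m" "x = 2 * k * j" "y = hub"
    | j where "j < m" "x = hub" "y = 2 * k * j"
    | "x < hub" "y < hub" "y = Suc x \<or> x = hub - 1 \<and> y = 0"
    | "x < hub" "y < hub" "x = Suc y \<or> y = hub - 1 \<and> x = 0"
proof -
  from assms consider "x < hub" "y < hub" "y = (x + 1) mod hub" | "x < hub" "y < hub" "x = (y + 1) mod hub"
    | "x = hub" "\<exists>i<m. y = 2 * k * i" | "y = hub" "\<exists>i<m. x = 2 * k * i"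
    unfolding edge_G by blast
  then show thesis
  proof cases
    case 1
    then have "y = Suc x \<or> x = hub - 1 \<and> y = 0" by (cases "Suc x = hub") auto
    with 1 that(3) show thesis by blast
  next
    case 2
    then have "x = Suc y \<or> y = hub - 1 \<and> x = 0" by (cases "Suc y = hub") auto
    with 2 that(4) show thesis by blast
  next
    case 3
    then show thesis using that(2) by blast
  next
    case 4
    then show thesis using that(1) by blast
  qed
qed

lemma weights_nonneg: "0 \<le> w0 x" "0 \<le> w1 x" "0 \<le> wl j x" "0 \<le> wr j x"
  by (simp_all add: w0_def w1_def wl_def wr_def)

lemma weights_le_1: "wl j x \<le> 1" "wr j x \<le> 1"
  by (simp_all add: wl_def wr_def power_le_one)

lemma half_power_mult:
  assumes "a \<le> b" shows "(2::real) ^ a * (1 / 2) ^ b = (1 / 2) ^ (b - a)"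
proof -
  have "(1 / 2 :: real) ^ b = (1 / 2) ^ a * (1 / 2) ^ (b - a)"
    using assms by (simp flip: power_add)
  then show ?thesis by (simp add: power_one_over)
qed

lemma w1_le_1: "2 * k \<le> x \<Longrightarrow> w1 x \<le> 1"
  by (simp add: w1_def half_power_mult power_le_one)

lemma w0_le_1: "x = 0 \<or> k < x \<Longrightarrow> w0 x \<le> 1"
  by (auto simp: w0_def power_le_one)

lemma segments_separated: "i = j \<or> 2 * k * i + 2 * k \<le> 2 * k * j \<or> 2 * k * j + 2 * k \<le> 2 * k * i"
proof (cases i j rule: linorder_cases)
  case less
  then have "2 * k * (i + 1) \<le> 2 * k * j" by (intro mult_le_mono) auto
  then show ?thesis by (simp add: algebra_simps)
next
  case greater
  then have "2 * k * (j + 1) \<le> 2 * k * i" by (intro mult_le_mono) auto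
  then show ?thesis by (simp add: algebra_simps)
qed simp

lemma wl_at: "t < 2 * k \<Longrightarrow> wl i (2 * k * j + t) = (if i = j then (1 / 2) ^ t else 0)"
  using segments_separated[of i j] by (auto simp: wl_def)

lemma wr_at:
  assumes t: "t < 2 * k"
  shows "wr i (2 * k * j + t) = (if i = Suc j \<and> 0 < t then (1 / 2) ^ (2 * k - t) else 0)"
proof (cases "i = Suc j")
  case True
  have "2 * k * Suc j = 2 * k * j + 2 * k" by simp
  then show ?thesis using t unfolding wr_def True by simp
next
  case False
  then have "2 * k * i + 2 * k \<le> 2 * k * j + 2 * k \<or> 2 * k * j + 2 * k + 2 * k \<le> 2 * k * i"
    using segments_separated[of i "Suc j"] by simp
  then have "\<not> (2 * k * i < 2 * k * j + t + 2 * k \<and> 2 * k * j + t < 2 * k * i)"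
    using t by linarith
  then have "wr i (2 * k * j + t) = 0" by (simp only: wr_def if_False)
  then show ?thesis using False by simp
qed

lemma hub_ge: "6 * k \<le> hub"
proof -
  have "2 * k * 3 \<le> 2 * k * m" using m by (intro mult_le_mono) auto
  then show ?thesis by simp
qed

lemma spoke_weights:
  shows "w0 (2 * k * j) \<le> 1" "w1 (2 * k * j) \<le> 1" "wr i (2 * k * j) = 0"
    "wl i (2 * k * j) = of_bool (i = j)" "w0 0 = 1" "w1 (2 * k) = 1"
proof -
  have jk: "2 * k \<le> 2 * k * j" if "j \<noteq> 0" using that by (cases j) auto
  show "w0 (2 * k * j) \<le> 1" using jk k by (intro w0_le_1) (cases "j = 0"; auto)
  show "w1 (2 * k * j) \<le> 1" using jk w1_le_1[of "2 * k * j"] k by (cases "j = 0") (auto simp: w1_def)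
  show "wr i (2 * k * j) = 0" using wr_at[of 0 i j] k by simp
  show "wl i (2 * k * j) = of_bool (i = j)" using wl_at[of 0 i j] k by simp
  show "w0 0 = 1" "w1 (2 * k) = 1" using half_power_mult[of k k] by (auto simp: w0_def w1_def)
qed

lemma allocation_class:
  assumes al: "allocation D' al" and y: "y < hub" "D' y = Suc (D y)" and other: "\<And>z. z < hub \<Longrightarrow> z \<noteq> y \<Longrightarrow> D' z \<le> D z"
    and not: "\<not> allocation D al"
  obtains c where "c \<in> {0, 1, 2, 3}" "1 \<le> al c y"
proof (rule ccontr)
  assume "\<not> thesis"
  then have "al c y = 0" if "c \<in> {0, 1, 2, 3}" for c
    using that \<open>\<And>c. c \<in> {0, 1, 2, 3} \<Longrightarrow> 1 \<le> al c y \<Longrightarrow> thesis\<close> by (metis One_nat_def Suc_leI neq0_conv)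
  then have "allocation D al"
    using al other unfolding allocation_def by (metis add_is_0 insertCI le_trans zero_le)
  then show False using not by simp
qed


definition consecutive :: "nat \<Rightarrow> nat \<Rightarrow> bool" where
  "consecutive x y \<longleftrightarrow> y = Suc x \<or> x = hub - 1 \<and> y = 0"

text \<open>Undoing a move puts two pebbles on \<open>x\<close> for one on \<open>y\<close>, and
  neighbouring weights differ by a factor of at most 2. The exception is a step onto the root from
  its far side, where the pebbles take the other direction instead.\<close>

lemma worth_step_w0:
  assumes xy: "x < hub" "y < hub" "consecutive x y \<or> consecutive y x" and al: "1 \<le> al 2 y"
  shows "\<exists>c'\<in>{0, 1, 2, 3}. worth al h \<le> worth (shift al 1 2 y 2 c' x) h"
proof (cases "y = k \<and> x = Suc k")
  case True
  show ?thesis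
  proof (rule bexI[of _ 3], rule worth_shift[where el = "\<lambda>_. 0" and er = "\<lambda>_. 0" and ea = "2 ^ k" and eb = "- (2 ^ k)" and p = 0 and q = 0])
  qed (use xy al True in \<open>auto simp: w0_def w1_def\<close>)
next
  case False
  have hk: "k < hub - 1" "hub - (hub - Suc 0) = Suc 0"
    using hub_ge k by linarith+
  have "w0 y \<le> 2 * w0 x"
  proof -
    consider "y = Suc x" "y \<le> k" | "y = Suc x" "x = k" | "y = Suc x" "k < x" | "x = hub - 1" "y = 0"
      | "x = Suc y" "x \<le> k" | "x = Suc y" "k < y" | "y = hub - 1" "x = 0"
    proof -
      have "y = Suc x \<Longrightarrow> y \<le> k \<or> x = k \<or> k < x" "x = Suc y \<Longrightarrow> x \<le> k \<or> k < y"
        using False by auto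
      then show ?thesis using that xy(3) unfolding consecutive_def by blast
    qed
    then show ?thesis
    proof cases
      case 2
      have "w0 y \<le> 1" using 2 by (intro w0_le_1) auto
      moreover have "1 \<le> w0 x" using 2 by (simp add: w0_def)
      ultimately show ?thesis by linarith
    next
      case 3
      then have "hub - x = Suc (hub - y)" using xy by auto
      then show ?thesis using 3 by (simp add: w0_def)
    next
      case 6
      then have "hub - y = Suc (hub - x)" using xy by auto
      then show ?thesis using 6 by (simp add: w0_def)
    qed (use hk in \<open>auto simp: w0_def\<close>)
  qed
  show ?thesis
  proof (rule bexI[of _ 2], rule worth_shift[where el = "\<lambda>_. 0" and er = "\<lambda>_. 0" and ea = 0 and eb = 0 and p = 0 and q = 0])
  qed (use xy al \<open>w0 y \<le> 2 * w0 x\<close> in auto)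
qed

text \<open>\<open>w1\<close> vanishes below the root, so the role changes at both ends of that
  stretch: next to the root, where two pebbles of role 2 weigh exactly as much, and at spoke 0,
  where they gain 2 for a loss of at most 1.\<close>

lemma worth_step_w1:
  assumes xy: "x < hub" "y < hub" "consecutive x y \<or> consecutive y x" and al: "1 \<le> al 3 y"
  shows "\<exists>c'\<in>{0, 1, 2, 3}. worth al h \<le> worth (shift al 1 3 y 2 c' x) h"
proof -
  have hk: "2 * k \<le> hub - 1"
  using hub_ge k by linarith
  consider (meet) "y = k" "Suc x = k" | (wrap) "y = hub - 1" "x = 0" | (near) "w1 y \<le> 2 * w1 x"
  proof -
    consider "y = Suc x" "x < k" "y < k" | "y = Suc x" "y = k" | "y = Suc x" "k \<le> x" | "x = hub - 1" "y = 0"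
      | "x = Suc y" "y < k" | "x = Suc y" "k \<le> y" | "y = hub - 1" "x = 0"
    proof -
      have "y = Suc x \<Longrightarrow> x < k \<and> y < k \<or> y = k \<or> k \<le> x" "x = Suc y \<Longrightarrow> y < k \<or> k \<le> y"
        by auto
      then show ?thesis using that xy(3) unfolding consecutive_def by blast
    qed
    then show thesis
    proof cases
      case 3
      then have "w1 y \<le> 2 * w1 x" by (simp add: w1_def Suc_diff_le)
      then show thesis by (rule near)
    next
      case 6
      then have "w1 y \<le> 2 * w1 x" by (simp add: w1_def Suc_diff_le)
      then show thesis by (rule near)
    next
      case 1
      then show thesis by (intro near) (simp add: w1_def)
    next
      case 4
      then show thesis using k weights_nonneg(2)[of x] by (intro near) (simp add: w1_def)
    next
      case 5
      then show thesis using weights_nonneg(2)[of x] by (intro near) (simp add: w1_def)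
    next
      case 2
      then show thesis by (intro meet) simp_all
    next
      case 7
      then show thesis by (intro wrap)
    qed
  qed
  then show ?thesis
  proof cases
    case meet
    have w: "w1 y = 2 ^ k" "2 * w0 x = 2 ^ k" using meet by (auto simp: w0_def w1_def power_Suc[symmetric])
    show ?thesis
    proof (rule bexI[of _ 2], rule worth_shift[where el = "\<lambda>_. 0" and er = "\<lambda>_. 0" and ea = "- (2 ^ k)" and eb = "2 ^ k" and p = 0 and q = 0])
    qed (use xy al w in auto)
  next
    case wrap
    have w: "w1 y \<le> 1" "w0 x = 1" using wrap hk by (auto simp: w1_le_1 w0_def)
    show ?thesis
    proof (rule bexI[of _ 2], rule worth_shift[where el = "\<lambda>_. 0" and er = "\<lambda>_. 0" and ea = "- 2" and eb = "1" and p = 0 and q = 0])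
    qed (use xy al w in auto)
  next
    case near
    show ?thesis
    proof (rule bexI[of _ 3], rule worth_shift[where el = "\<lambda>_. 0" and er = "\<lambda>_. 0" and ea = 0 and eb = 0 and p = 0 and q = 0])
    qed (use xy al near in auto)
  qed
qed

lemma coordinates:
  assumes "y < hub"
  obtains j t where "y = 2 * k * j + t" "t < 2 * k" "j < m"
proof
  show "y = 2 * k * (y div (2 * k)) + y mod (2 * k)" by simp
  show "y mod (2 * k) < 2 * k" using k by simp
  show "y div (2 * k) < m" using assms by (simp add: less_mult_imp_div_less mult.commute)
qed


text \<open>A pebble on its own spoke that came from the segment below is pulled back into role 1.
  If it came from the spoke above, the two pebbles there form a meeting of their own, which pays for
  the one unit lost at the old spoke; at spoke 0 role 2 pays.\<close>

lemma worth_step_wl: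
  assumes xy: "x < hub" "y < hub" "consecutive x y \<or> consecutive y x" and al: "1 \<le> al 0 y"
  shows "\<exists>c'\<in>{0, 1, 2, 3}. worth al h \<le> worth (shift al 1 0 y 2 c' x) h"
proof -
  obtain j t where y: "y = 2 * k * j + t" and t: "t < 2 * k" and j: "j < m"
    by (rule coordinates[OF xy(2)])
  note wy = wl_at[OF t, of _ j, folded y]
  consider (near) "\<And>i. i \<in> {2..<m} \<Longrightarrow> wl i y \<le> 2 * wl i x"
    | (lower) "2 \<le> j" "t = 0" "Suc x = y" | (upper) "Suc j < m" "2 \<le> j" "x = 2 * k * Suc j"
    | (wrap) "2 \<le> j" "x = 0"
  proof (cases "2 \<le> j")
    case False
    then have "wl i y \<le> 2 * wl i x" if "i \<in> {2..<m}" for i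
      using that weights_nonneg(3)[of i x] by (auto simp: wy)
    then show thesis by (rule near)
  next
    case True
    then have y0: "0 < y" using y k by (cases j) auto
    consider "y = Suc x" "t = 0" | s where "y = Suc x" "t = Suc s" | "x = Suc y" "Suc t < 2 * k" | "x = Suc y" "Suc t = 2 * k" | "x = 0"
    proof -
      have "Suc t < 2 * k \<or> Suc t = 2 * k" "t = 0 \<or> (\<exists>s. t = Suc s)" "y \<noteq> 0"
        using t y0 by (linarith, cases t, auto)
      then show ?thesis using that xy(3) unfolding consecutive_def by blast
    qed
    then show thesis
    proof cases
      case 1
      then show thesis using lower True by simp
    next
      case (2 s)
      then have "x = 2 * k * j + s" "s < 2 * k" using y t by auto
      then have wx: "wl i x = (if i = j then (1 / 2) ^ s else 0)" for i using wl_at[of s i j] by simp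
      have "wl i y \<le> 2 * wl i x" for i unfolding wy wx using 2(2) by simp
      then show thesis by (rule near)
    next
      case 3
      then have "x = 2 * k * j + Suc t" using y by auto
      then have wx: "wl i x = (if i = j then (1 / 2) ^ Suc t else 0)" for i using wl_at[of "Suc t" i j] 3 by simp
      have "wl i y \<le> 2 * wl i x" for i unfolding wy wx by simp
      then show thesis by (rule near)
    next
      case 4
      then have x: "x = 2 * k * Suc j" using y by simp
      have "2 * k * Suc j < 2 * k * m" using xy(1) unfolding x .
      then have "Suc j < m" by (simp only: mult_less_cancel1)
      then show thesis using upper True x by simp
    next
      case 5
      then show thesis using wrap True by simp
    qed
  qed
  then show ?thesis
  proof cases
    case near
    show ?thesis
    proof (rule bexI[of _ 0], rule worth_shift[where el = "\<lambda>_. 0" and er = "\<lambda>_. 0" and ea = 0 and eb = 0 and p = 0 and q = 0])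
    qed (use xy al near in auto)
  next
    case lower
    obtain j' where j': "j = Suc j'" using lower by (cases j) auto
    have "x = 2 * k * j' + (2 * k - 1)" using lower y j' k by simp
    then have wx: "wr i x = (if i = j then 1 / 2 else 0)" for i
      using wr_at[of "2 * k - 1" i j'] k j' by simp
    show ?thesis
    proof (rule bexI[of _ 1], rule worth_shift[where el = "\<lambda>i. of_bool (i = j)" and er = "\<lambda>i. - of_bool (i = j)" and ea = 0 and eb = 0 and p = 0 and q = 0])
    qed (use xy al wx wy lower in auto)
  next
    case upper
    note wx = spoke_weights(4)[of _ "Suc j", folded upper(3)]
    show ?thesis
    proof (rule bexI[of _ 0], rule worth_shift[where el = "\<lambda>i. of_bool (i = j) - 2 * of_bool (i = Suc j)" and er = "\<lambda>i. 0" and ea = 0 and eb = 0 and p = j and q = "Suc j"])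
    qed (use xy al wx wy upper weights_le_1(1)[of j y] in auto)
  next
    case wrap
    show ?thesis
    proof (rule bexI[of _ 2], rule worth_shift[where el = "\<lambda>i. of_bool (i = j)" and er = "\<lambda>i. 0" and ea = "- 2" and eb = 0 and p = j and q = m])
    qed (use xy al wrap spoke_weights(5) wy weights_le_1(1)[of j y] in auto)
  qed
qed

text \<open>Pebbles pulled back onto a spoke must leave role 1, which has no weight there: they form
  a meeting in role 0, or on spoke 1 travel on to the root in role 3.\<close>

lemma worth_step_wr:
  assumes xy: "x < hub" "y < hub" "consecutive x y \<or> consecutive y x" and al: "1 \<le> al 1 y"
  shows "\<exists>c'\<in>{0, 1, 2, 3}. worth al h \<le> worth (shift al 1 1 y 2 c' x) h"
proof -
  obtain j t where y: "y = 2 * k * j + t" and t: "t < 2 * k" and j: "j < m"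
    by (rule coordinates[OF xy(2)])
  note wy = wr_at[OF t, of _ j, folded y]
  consider (near) "\<And>i. i \<in> {2..<m} \<Longrightarrow> wr i y \<le> 2 * wr i x"
    | (lower) "2 \<le> j" "Suc j < m" "x = 2 * k * j" | (first) "j = 1" "x = 2 * k" | (upper) "Suc j < m" "1 \<le> j" "x = 2 * k * Suc j"
  proof (cases "1 \<le> j \<and> Suc j < m \<and> 0 < t")
    case False
    then have "wr i y \<le> 2 * wr i x" if "i \<in> {2..<m}" for i
      using that weights_nonneg(4)[of i x] by (auto simp: wy)
    then show thesis by (rule near)
  next
    case True
    have "2 * k * Suc j < 2 * k * m" using True k by (simp only: mult_less_cancel1) simp
    then have "y < hub - 1" using y t by simp
    then consider "y = Suc x" "t = 1" | s where "y = Suc x" "t = Suc s" "0 < s" | "x = Suc y" "Suc t < 2 * k" | "x = Suc y" "Suc t = 2 * k"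
    proof -
      have "Suc t < 2 * k \<or> Suc t = 2 * k" "t = 1 \<or> (\<exists>s. t = Suc s \<and> 0 < s)" "y \<noteq> 0" "y \<noteq> hub - 1"
        using t True y \<open>y < hub - 1\<close> by (linarith, cases t, auto)
      then show ?thesis using that xy(3) unfolding consecutive_def by blast
    qed
    then show thesis
    proof cases
      case 1
      then have "x = 2 * k * j" using y by simp
      then show thesis using lower first True by (cases "j = 1") auto
    next
      case (2 s)
      then have "x = 2 * k * j + s" "s < 2 * k" using y t by auto
      then have wx: "wr i x = (if i = Suc j then (1 / 2) ^ (2 * k - s) else 0)" for i using wr_at[of s i j] 2 by simp
      have eq: "2 * k - s = Suc (2 * k - t)" using 2 t by simp
      have "wr i y \<le> 2 * wr i x" for i unfolding wy wx eq using True by simp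
      then show thesis by (rule near)
    next
      case 3
      then have "x = 2 * k * j + Suc t" using y by auto
      then have wx: "wr i x = (if i = Suc j then (1 / 2) ^ (2 * k - Suc t) else 0)" for i using wr_at[of "Suc t" i j] 3 by simp
      have eq: "2 * k - t = Suc (2 * k - Suc t)" using 3 by simp
      have "wr i y \<le> 2 * wr i x" for i unfolding wy wx eq using True by simp
      then show thesis by (rule near)
    next
      case 4
      then have "x = 2 * k * Suc j" using y by simp
      then show thesis using upper True by simp
    qed
  qed
  then show ?thesis
  proof cases
    case near
    show ?thesis
    proof (rule bexI[of _ 1], rule worth_shift[where el = "\<lambda>_. 0" and er = "\<lambda>_. 0" and ea = 0 and eb = 0 and p = 0 and q = 0])
    qed (use xy al near in auto)
  next
    case lower
    note wx = spoke_weights(4)[of _ "j", folded lower(3)]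
    show ?thesis
    proof (rule bexI[of _ 0], rule worth_shift[where el = "\<lambda>i. - 2 * of_bool (i = j)" and er = "\<lambda>i. of_bool (i = Suc j)" and ea = 0 and eb = 0 and p = "Suc j" and q = j])
    qed (use xy al wx wy lower weights_le_1(2)[of "Suc j" y] in auto)
  next
    case first
    show ?thesis
    proof (rule bexI[of _ 3], rule worth_shift[where el = "\<lambda>i. 0" and er = "\<lambda>i. of_bool (i = Suc j)" and ea = 0 and eb = "- 2" and p = "Suc j" and q = m])
    qed (use xy al first spoke_weights(6) wy weights_le_1(2)[of "Suc j" y] in auto)
  next
    case upper
    note wx = spoke_weights(4)[of _ "Suc j", folded upper(3)]
    show ?thesis
    proof (rule bexI[of _ 0], rule worth_shift[where el = "\<lambda>i. - 2 * of_bool (i = Suc j)" and er = "\<lambda>i. of_bool (i = Suc j)" and ea = 0 and eb = 0 and p = "Suc j" and q = "Suc j"])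
    qed (use xy al wx wy upper weights_le_1(2)[of "Suc j" y] in auto)
  qed
qed

lemma allocation_shift:
  assumes al: "allocation D' al" and c: "c \<in> {0, 1, 2, 3}" "c' \<in> {0, 1, 2, 3}" "a \<le> al c y"
    and le: "\<And>z. z < hub \<Longrightarrow> D' z + b * of_bool (z = x) \<le> D z + a * of_bool (z = y)"
  shows "allocation D (shift al a c y b c' x)"
  unfolding allocation_def
proof (intro allI impI)
  fix z assume z: "z < hub"
  let ?s = "shift al a c y b c' x"
  have "?s 0 z + ?s 1 z + ?s 2 z + ?s 3 z + a * of_bool (z = y) = al 0 z + al 1 z + al 2 z + al 3 z + b * of_bool (z = x)"
  proof -
    have A: "(al 0 z - a * of_bool (0 = c \<and> z = y)) + (al 1 z - a * of_bool (1 = c \<and> z = y))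
      + (al 2 z - a * of_bool (2 = c \<and> z = y)) + (al 3 z - a * of_bool (3 = c \<and> z = y)) + a * of_bool (z = y)
      = al 0 z + al 1 z + al 2 z + al 3 z"
      using c(1,3) by (cases "z = y") (elim insertE emptyE; simp)+
    have B: "b * of_bool (0 = c' \<and> z = x) + b * of_bool (1 = c' \<and> z = x) + b * of_bool (2 = c' \<and> z = x)
      + b * of_bool (3 = c' \<and> z = x) = b * of_bool (z = x)"
      using c(2) by (cases "z = x") (elim insertE emptyE; simp)+
    show ?thesis using A B unfolding shift_def by linarith
  qed
  also have "\<dots> \<le> D' z + b * of_bool (z = x)"
    using al z by (simp add: allocation_def)
  finally show "?s 0 z + ?s 1 z + ?s 2 z + ?s 3 z \<le> D z"
    using le[OF z] by linarith
qed

end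

section \<open>Numerical estimates for the extremal configuration\<close>

text \<open>With F = floor(2Z/3), strictness in 3F < 2Z prevents the two piles in segment 6 from
  sending two pebbles to spoke 6, and in 3F/2 < Z even one to spoke 7.\<close>

lemma three_not_dvd_power2: "3 * (2 * 2 ^ k div 3) < (2 * 2 ^ k :: nat)"
proof -
  have "2 ^ n mod 3 \<noteq> (0::nat)" for n
  proof (induction n)
    case (Suc n)
    then show ?case by (simp add: mod_mult_right_eq) presburger
  qed simp
  from this[of "Suc k"] have "0 < 2 * 2 ^ k mod (3::nat)" by simp
  then show ?thesis
    using div_mult_mod_eq[of "2 * 2 ^ k" "3::nat"] by linarith
qed

text \<open>The next lemmas bound the total weight of a chain of segments, where \<open>z = 1 / Z\<close> and \<open>q i\<close> pebbles sit at the
  midpoint of the \<open>i\<close>-th segment counted from the root, at weight \<open>z ^ (2 * i - 1)\<close>; the large pile is the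
  fourth one or further away. This is where \<open>m \<ge> 8\<close> matters, most tightly for \<open>k = 1\<close>.\<close>

lemma geometric_tail:
  fixes z :: real
  assumes z: "0 < z" "z \<le> 1 / 2" and M: "4 \<le> M"
  shows "(\<Sum>i\<in>{5..M}. 2 * z ^ (2 * i - 2)) \<le> 8 / 3 * (z ^ 8 - z ^ (2 * M))"
  using M
proof (induction M rule: dec_induct)
  case (step M)
  have "z * z \<le> 1 / 2 * (1 / 2)" using z by (intro mult_mono) auto
  \<comment> \<open>8/3 is 2 / (1 - 1/4), the sum of a geometric series with first term 2 and ratio
    1/4.\<close>
  then have "2 \<le> 8 / 3 * (1 - z * z)" by simp
  then have "2 * z ^ (2 * M) \<le> 8 / 3 * (1 - z * z) * z ^ (2 * M)"
    using z by (intro mult_right_mono) auto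
  moreover have "{5..Suc M} = insert (Suc M) {5..M}" using step(1) by auto
  ultimately show ?case using step(3) by (simp add: algebra_simps power_add)
qed simp

lemma chain_tail:
  fixes z Z :: real and q :: "nat \<Rightarrow> real"
  assumes z: "0 < z" "z \<le> 1 / 2" "Z * z = 1" and M: "4 \<le> M" and q: "\<And>i. 5 \<le> i \<Longrightarrow> i \<le> M \<Longrightarrow> q i \<le> 2 * Z"
  shows "(\<Sum>i\<in>{5..M}. q i * z ^ (2 * i - 1)) \<le> 8 / 3 * z ^ 8"
proof -
  have "(\<Sum>i\<in>{5..M}. q i * z ^ (2 * i - 1)) \<le> (\<Sum>i\<in>{5..M}. 2 * z ^ (2 * i - 2))"
  proof (rule sum_mono)
    fix i assume i: "i \<in> {5..M}"
    then have e: "2 * i - 1 = Suc (2 * i - 2)" by auto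
    have "q i * z ^ (2 * i - 1) \<le> 2 * Z * z ^ (2 * i - 1)" using q[of i] i z by (intro mult_right_mono) auto
    also have "\<dots> = 2 * (Z * z) * z ^ (2 * i - 2)" unfolding e by simp
    finally show "q i * z ^ (2 * i - 1) \<le> 2 * z ^ (2 * i - 2)" using z(3) by simp
  qed
  also have "\<dots> \<le> 8 / 3 * (z ^ 8 - z ^ (2 * M))" by (rule geometric_tail[OF z(1,2) M])
  also have "\<dots> \<le> 8 / 3 * z ^ 8" using z by simp
  finally show ?thesis .
qed

lemma chain_head:
  fixes z :: real
  assumes M: "4 \<le> M"
  shows "(\<Sum>i\<in>{1..M}. q i * z ^ (2 * i - 1)) = q 1 * z + q 2 * z ^ 3 + q 3 * z ^ 5 + q 4 * z ^ 7 + (\<Sum>i\<in>{5..M}. q i * z ^ (2 * i - 1))"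
proof -
  have "{1..M} = {1, 2, 3, 4} \<union> {5..M}" using M by auto
  then show ?thesis by (simp add: sum.union_disjoint add.assoc)
qed

text \<open>These remain of the two chain estimates after cancelling Z against z. At z = 1/2 the
  second has a slack of about 0.005, so the factor 1 - 2z is split off before anything is
  estimated.\<close>

lemma chain_polynomials:
  fixes z :: real
  assumes z: "0 < z" "z \<le> 1 / 2"
  shows "2 * z\<^sup>2 - z ^ 3 + z ^ 4 - z ^ 5 + 4 * z ^ 6 + 8 / 3 * z ^ 8 \<le> z"
    and "2 * z\<^sup>2 - z ^ 3 + z ^ 4 + 2 * z ^ 6 + 8 / 3 * z ^ 8 + 4 * z ^ 8 \<le> z"
proof -
  have p2: "z\<^sup>2 \<le> (1 / 2)\<^sup>2" and p5: "z ^ 5 \<le> (1 / 2) ^ 5" and p3: "z ^ 3 \<le> (1 / 2) ^ 3"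
    using z by (intro power_mono; simp)+
  have z3: "z ^ 3 \<le> z\<^sup>2 / 2" using mult_left_mono[OF z(2), of "z\<^sup>2"] by (simp add: power3_eq_cube power2_eq_square)
  have "0 \<le> z * ((1 - 2 * z) + z\<^sup>2 * (1 - z + z\<^sup>2 - 4 * z ^ 3 - 8 / 3 * z ^ 5))"
    using z p2 p5 z3 by (intro mult_nonneg_nonneg add_nonneg_nonneg) (auto simp: power2_eq_square power_divide)
  then show "2 * z\<^sup>2 - z ^ 3 + z ^ 4 - z ^ 5 + 4 * z ^ 6 + 8 / 3 * z ^ 8 \<le> z"
    by (simp add: algebra_simps eval_nat_numeral)
  have "0 \<le> z * ((1 - 2 * z) + z\<^sup>2 * (1 - z - 2 * z ^ 3 - 20 / 3 * z ^ 5))"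
    using z p5 p3 by (intro mult_nonneg_nonneg add_nonneg_nonneg) (auto simp: power_divide)
  then show "2 * z\<^sup>2 - z ^ 3 + z ^ 4 + 2 * z ^ 6 + 8 / 3 * z ^ 8 + 4 * z ^ 8 \<le> z"
    by (simp add: algebra_simps eval_nat_numeral)
qed

text \<open>The bound is shaped for rounding: as long as x < 4Z the last term does not make up for 4
  z^6, and the chain delivers nothing.\<close>

lemma chain_near:
  fixes z Z x :: real and q :: "nat \<Rightarrow> real"
  assumes z: "0 < z" "z \<le> 1 / 2" "Z * z = 1" and M: "4 \<le> M"
    and q: "q 1 \<le> Z - 1" "q 2 \<le> 2 * Z - 1" "q 3 \<le> Z - 1" "q 4 \<le> x" "\<And>i. 5 \<le> i \<Longrightarrow> i \<le> M \<Longrightarrow> q i \<le> 2 * Z"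
  shows "(\<Sum>i\<in>{1..M}. q i * z ^ (2 * i - 1)) \<le> 1 - 4 * z ^ 6 + x * z ^ 7"
proof -
  have Zz: "Z * z ^ Suc i = z ^ i" for i using z(3) by (simp flip: mult.assoc)
  have "q 1 * z \<le> (Z - 1) * z" "q 2 * z ^ 3 \<le> (2 * Z - 1) * z ^ 3" "q 3 * z ^ 5 \<le> (Z - 1) * z ^ 5" "q 4 * z ^ 7 \<le> x * z ^ 7"
    using q z by (intro mult_right_mono; simp)+
  moreover have "(Z - 1) * z = 1 - z" "(2 * Z - 1) * z ^ 3 = 2 * z\<^sup>2 - z ^ 3" "(Z - 1) * z ^ 5 = z ^ 4 - z ^ 5"
    using Zz[of 0] Zz[of 2] Zz[of 4] by (simp_all add: algebra_simps eval_nat_numeral)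
  ultimately show ?thesis
    unfolding chain_head[OF M] using chain_tail[OF z(1,2,3) M, of q, OF q(5)] chain_polynomials(1)[OF z(1,2)] by linarith
qed

text \<open>The large pile is rated as if it were in the fifth segment, the nearest one allowed.
  Position 3 may hold Z, because for m = 9 it is segment 6 with both of its piles.\<close>

lemma chain_far:
  fixes z Z x :: real and q :: "nat \<Rightarrow> real"
  assumes z: "0 < z" "z \<le> 1 / 2" "Z * z = 1" and M: "4 \<le> M" and x: "0 \<le> x" and p: "5 \<le> p"
    and q: "q 1 \<le> Z - 1" "q 2 \<le> 2 * Z - 1" "q 3 \<le> Z"
      "\<And>i. 4 \<le> i \<Longrightarrow> i \<le> M \<Longrightarrow> q i \<le> (if i = p then x else 2 * Z)"
  shows "(\<Sum>i\<in>{1..M}. q i * z ^ (2 * i - 1)) \<le> 1 - 4 * z ^ 8 + x * z ^ 9"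
proof -
  have Zz: "Z * z ^ Suc i = z ^ i" for i using z(3) by (simp flip: mult.assoc)
  define r where "r i = (if i = p then 0 else q i)" for i
  have Z: "0 \<le> Z" using z zero_le_mult_iff[of Z z] by auto
  have "(\<Sum>i\<in>{5..M}. q i * z ^ (2 * i - 1)) \<le> (\<Sum>i\<in>{5..M}. r i * z ^ (2 * i - 1) + (if i = p then x * z ^ (2 * i - 1) else 0))"
  proof (rule sum_mono)
    fix i assume i: "i \<in> {5..M}"
    have "q i * z ^ (2 * i - 1) \<le> x * z ^ (2 * i - 1)" if "i = p"
      using q(4)[of i] i that z by (intro mult_right_mono) auto
    then show "q i * z ^ (2 * i - 1) \<le> r i * z ^ (2 * i - 1) + (if i = p then x * z ^ (2 * i - 1) else 0)"
      by (simp add: r_def)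
  qed
  also have "\<dots> = (\<Sum>i\<in>{5..M}. r i * z ^ (2 * i - 1)) + (if p \<in> {5..M} then x * z ^ (2 * p - 1) else 0)"
    by (simp add: sum.distrib)
  also have "\<dots> \<le> 8 / 3 * z ^ 8 + x * z ^ 9"
  proof (rule add_mono)
    show "(\<Sum>i\<in>{5..M}. r i * z ^ (2 * i - 1)) \<le> 8 / 3 * z ^ 8"
    proof (rule chain_tail[OF z M])
      fix i assume "5 \<le> i" "i \<le> M"
      then show "r i \<le> 2 * Z" using q(4)[of i] Z by (auto simp: r_def split: if_splits)
    qed
    have "z ^ (2 * p - 1) \<le> z ^ 9" using z p by (intro power_decreasing) auto
    then show "(if p \<in> {5..M} then x * z ^ (2 * p - 1) else 0) \<le> x * z ^ 9"
      using x z by (auto intro: mult_left_mono)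
  qed
  finally have tail: "(\<Sum>i\<in>{5..M}. q i * z ^ (2 * i - 1)) \<le> 8 / 3 * z ^ 8 + x * z ^ 9" .
  have q4: "q 4 \<le> 2 * Z" using q(4)[of 4] M p by simp
  have "q 1 * z \<le> (Z - 1) * z" "q 2 * z ^ 3 \<le> (2 * Z - 1) * z ^ 3" "q 3 * z ^ 5 \<le> Z * z ^ 5" "q 4 * z ^ 7 \<le> 2 * Z * z ^ 7"
    using q q4 z by (intro mult_right_mono; simp)+
  moreover have "(Z - 1) * z = 1 - z" "(2 * Z - 1) * z ^ 3 = 2 * z\<^sup>2 - z ^ 3" "Z * z ^ 5 = z ^ 4" "2 * Z * z ^ 7 = 2 * z ^ 6"
    using Zz[of 0] Zz[of 2] Zz[of 4] Zz[of 6] by (simp_all add: algebra_simps eval_nat_numeral)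
  ultimately show ?thesis
    unfolding chain_head[OF M] using tail chain_polynomials(2)[OF z(1,2)] by linarith
qed

text \<open>A pebble brought along the cycle replaces two on the hub, but it takes 4Z pebbles of the
  large pile, which would be worth two hub pebbles anyway.\<close>

lemma floor_chain:
  fixes s :: real
  assumes Z: "0 < Z" and "s < 2" "X < 4 * Z \<Longrightarrow> s < 1"
  shows "2 * \<lfloor>s\<rfloor> \<le> int (X div (2 * Z))"
proof (cases "X < 4 * Z")
  case True
  then have "\<lfloor>s\<rfloor> \<le> 0" using assms(3) by (simp add: floor_le_iff)
  then show ?thesis by linarith
next
  case False
  then have "2 \<le> X div (2 * Z)" using Z by (simp add: less_eq_div_iff_mult_less_eq)
  moreover have "\<lfloor>s\<rfloor> \<le> 1" using assms(2) by (simp add: floor_le_iff)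
  ultimately show ?thesis by linarith
qed

context jahangir_graph
begin

section \<open>The potential never increases\<close>

lemma hub_minus: "hub - Suc 0 \<noteq> 0"
  using km(1) by linarith

lemma bounded_worth_move:
  assumes D: "bounded_worth D" and mv: "pebbling_move G D D'"
  shows "bounded_worth D'"
proof -
  obtain x y where e: "edge G x y" and Dx: "2 \<le> D x" and D': "D' = (D(x := D x - 2))(y := D y + 1)"
    using mv unfolding pebbling_move_def edge_def by blast
  have dec: "\<exists>al'. allocation D al' \<and> worth al (int (D' hub)) \<le> worth al' (int (D hub))" if al: "allocation D' al" for al
  proof -
    have step: "\<exists>al'. allocation D al' \<and> worth al (int (D' hub)) \<le> worth al' (int (D hub))" if xy: "x < hub" "y < hub" "consecutive x y \<or> consecutive y x" "x \<noteq> y"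
    proof -
      have h: "D' hub = D hub" using xy D' by simp
      show ?thesis
      proof (cases "allocation D al")
        case True
        then show ?thesis using h by auto
      next
        case False
        obtain c where c: "c \<in> {0, 1, 2, 3}" "1 \<le> al c y"
          by (rule allocation_class[OF al xy(2) _ _ False]) (use D' xy in auto)
        then obtain c' where c': "c' \<in> {0, 1, 2, 3}" "worth al (int (D hub)) \<le> worth (shift al 1 c y 2 c' x) (int (D hub))"
          using worth_step_wl[OF xy(1-3), of al "int (D hub)"] worth_step_wr[OF xy(1-3), of al "int (D hub)"]
            worth_step_w0[OF xy(1-3), of al "int (D hub)"] worth_step_w1[OF xy(1-3), of al "int (D hub)"] by blast
        have "allocation D (shift al 1 c y 2 c' x)"
          by (rule allocation_shift[OF al c(1) c'(1) c(2)]) (use D' Dx xy in auto)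
        then show ?thesis using c'(2) h by auto
      qed
    qed
    show ?thesis
      using e
    proof (cases rule: edge_cases)
      case (to_hub j)
      have x: "x < hub" using to_hub k by simp
      have h: "int (D' hub) = int (D hub) + 1" "D' x + 2 = D x" using to_hub x D' Dx by auto
      have alloc: "allocation D (shift al 0 0 x 2 c' x)" if "c' \<in> {0, 1, 2, 3}" for c'
        by (rule allocation_shift[OF al]) (use that h D' to_hub in auto)
      consider "2 \<le> j" | "j = 1" | "j = 0" by linarith
      then show ?thesis
      proof cases
        case 1
        have "worth al (int (D' hub)) \<le> worth (shift al 0 0 x 2 0 x) (int (D hub))"
          by (rule worth_shift[where el = "\<lambda>i. - 2 * of_bool (i = j)" and er = "\<lambda>_. 0" and ea = 0 and eb = 0 and p = m and q = j])
            (use x h(1) 1 to_hub(1) spoke_weights(4)[of _ j, folded to_hub(2)] in auto)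
        then show ?thesis using alloc[of 0] by auto
      next
        case 2
        then have x2: "x = 2 * k" using to_hub by simp
        have "worth al (int (D' hub)) \<le> worth (shift al 0 0 x 2 3 x) (int (D hub))"
          by (rule worth_shift[where el = "\<lambda>_. 0" and er = "\<lambda>_. 0" and ea = 0 and eb = "- 2" and p = 0 and q = 0])
            (use x h(1) x2 spoke_weights(6) in auto)
        then show ?thesis using alloc[of 3] by auto
      next
        case 3
        then have x2: "x = 0" using to_hub by simp
        have "worth al (int (D' hub)) \<le> worth (shift al 0 0 x 2 2 x) (int (D hub))"
          by (rule worth_shift[where el = "\<lambda>_. 0" and er = "\<lambda>_. 0" and ea = "- 2" and eb = 0 and p = 0 and q = 0])
            (use x h(1) x2 spoke_weights(5) in auto)
        then show ?thesis using alloc[of 2] by auto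
      qed
    next
      case (from_hub j)
      have y: "y < hub" using from_hub k by simp
      have h: "int (D' hub) = int (D hub) - 2" using from_hub y D' Dx by auto
      show ?thesis
      proof (cases "allocation D al")
        case True
        moreover have "worth al (int (D' hub)) \<le> worth al (int (D hub))" by (simp add: worth_def h)
        ultimately show ?thesis by blast
      next
        case False
        obtain c where c: "c \<in> {0, 1, 2, 3}" "1 \<le> al c y"
          by (rule allocation_class[OF al y _ _ False]) (use D' from_hub y in auto)
        \<comment> \<open>The reverse move deletes the pebble on the spoke and returns two to the
          hub. The pebble was worth at most two, for the roles 2 and 3, and at most one
          otherwise.\<close>
        have alloc: "allocation D (shift al 1 c y 0 0 y)"
          by (rule allocation_shift[OF al]) (use c D' from_hub in auto)
        have "worth al (int (D' hub)) \<le> worth (shift al 1 c y 0 0 y) (int (D hub))"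
        proof (rule worth_shift[where el = "\<lambda>i. of_bool (c = 0 \<and> i = j)" and er = "\<lambda>_. 0" and ea = "of_bool (c = 2)"
              and eb = "of_bool (c = 3)" and p = "if c = 0 then j else m" and q = m])
        qed (use y h c spoke_weights(1,2)[of j, folded from_hub(3)]
              spoke_weights(3,4)[of _ j, folded from_hub(3)] in auto)
        then show ?thesis using alloc by blast
      qed
    next
      case up
      then show ?thesis using hub_minus by (intro step) (auto simp: consecutive_def)
    next
      case down
      then show ?thesis using hub_minus by (intro step) (auto simp: consecutive_def)
    qed
  qed
  show ?thesis
    using D dec unfolding bounded_worth_def by (meson le_less_trans)
qed

lemma bounded_worth_unsolvable:
  assumes "bounded_worth D" shows "\<not> yields G D (single k 1)"
proof
  assume "yields G D (single k 1)"
  then obtain D' where D': "(pebbling_move G)\<^sup>*\<^sup>* D D'" "1 \<le> D' k"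
    by (auto simp: yields_single_iff[symmetric])
  from D'(1) assms have b: "bounded_worth D'"
    by induction (use bounded_worth_move in blast)+
  define al :: "nat \<Rightarrow> nat \<Rightarrow> nat" where "al c z = of_bool (c = 3 \<and> z = k)" for c z
  have "allocation D' al" using D'(2) by (auto simp: allocation_def al_def)
  moreover have "2 * 2 ^ k \<le> worth al (int (D' hub))"
  proof -
    have zero: "wsum (al c) w = 0" if "c \<noteq> 3" for c w using that by (simp add: wsum_def al_def)
    have kh: "k < hub" using hub_ge k by simp
    have "wsum (al 3) w1 = (\<Sum>x<hub. if x = k then w1 k else 0)"
      unfolding wsum_def by (intro sum.cong) (auto simp: al_def)
    also have "\<dots> = of_int (2 ^ k)" using kh by (simp add: w1_def)
    finally have "wsum (al 3) w1 = of_int (2 ^ k)" .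
    then have "\<lfloor>wsum (al 3) w1\<rfloor> = 2 ^ k" by (simp only: floor_of_int)
    then show ?thesis unfolding worth_def by (simp add: zero)
  qed
  ultimately show False using b unfolding bounded_worth_def by (meson not_le)
qed

section \<open>The extremal configuration\<close>

text \<open>The extra pile for odd \<open>m\<close> sits next to the midpoint of segment 6, on the side of spoke 6; for
  \<open>k = 1\<close> it lies on that spoke.\<close>

definition pile :: "nat \<Rightarrow> nat" where
  "pile i = (if i = 0 then 0 else if i = 4 then 4 * 2 ^ k * 2 ^ k - 1
     else if odd m \<and> i = 6 then 2 * 2 ^ k div 3
     else if odd i \<longleftrightarrow> even m \<or> i < 6 then 2 ^ k - 1 else 2 * 2 ^ k - 1)"

definition config :: "nat \<Rightarrow> nat" where
  "config x = (if x < hub \<and> x mod (2 * k) = k then pile (x div (2 * k))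
     else if odd m \<and> x = 13 * k - 1 then 2 * 2 ^ k div 3 else 0)"

abbreviation center :: "nat \<Rightarrow> nat" where "center i \<equiv> 2 * k * i + k"

lemma center_div_mod: "center i div (2 * k) = i" "center i mod (2 * k) = k"
  using k by auto

lemma center_less: "i < m \<Longrightarrow> center i < hub"
proof -
  assume "i < m"
  then have "2 * k * (i + 1) \<le> 2 * k * m" by (intro mult_le_mono) auto
  then show ?thesis using k by simp
qed

lemma config_center: "i < m \<Longrightarrow> config (center i) = pile i"
  using center_less center_div_mod by (simp add: config_def)

lemma extra_eq: "13 * k - 1 = 2 * k * 6 + (k - 1)"
  using k by simp

lemma extra_mod: "(13 * k - 1) mod (2 * k) = k - 1"
  unfolding extra_eq mod_mult_self4 using k by simp

lemma config_extra: "odd m \<Longrightarrow> config (13 * k - 1) = 2 * 2 ^ k div 3"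
proof -
  have "k - 1 \<noteq> k" using k by linarith
  then show "odd m \<Longrightarrow> config (13 * k - 1) = 2 * 2 ^ k div 3"
    unfolding config_def extra_mod by simp
qed

lemma sum_config:
  fixes g :: "nat \<Rightarrow> 'z::comm_monoid_add"
  assumes m8: "8 \<le> m" and g: "\<And>x. x < hub \<Longrightarrow> config x = 0 \<Longrightarrow> g x = 0"
  shows "(\<Sum>x<hub. g x) = (\<Sum>i<m. g (center i)) + (if odd m then g (13 * k - 1) else 0)"
proof -
  define X where "X = (if odd m then {13 * k - 1} else {})"
  have Xh: "13 * k - 1 < hub"
  proof -
    have "2 * k * 8 \<le> 2 * k * m" using m8 by (intro mult_le_mono) auto
    then show ?thesis using k by linarith
  qed
  have "(\<Sum>x<hub. g x) = (\<Sum>x\<in>center ` {..<m} \<union> X. g x)"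
  proof (rule sum.mono_neutral_right)
    show "center ` {..<m} \<union> X \<subseteq> {..<hub}" using center_less Xh by (auto simp: X_def)
    show "\<forall>x\<in>{..<hub} - (center ` {..<m} \<union> X). g x = 0"
    proof
      fix x assume x: "x \<in> {..<hub} - (center ` {..<m} \<union> X)"
      have "x \<in> center ` {..<m}" if "x mod (2 * k) = k"
      proof (rule image_eqI)
        show "x = center (x div (2 * k))" using that by (metis mult_div_mod_eq)
        show "x div (2 * k) \<in> {..<m}" using x by (simp add: less_mult_imp_div_less mult.commute)
      qed
      then have "config x = 0" using x by (auto simp: config_def X_def)
      then show "g x = 0" using g x by simp
    qed
  qed simp
  also have "\<dots> = (\<Sum>x\<in>center ` {..<m}. g x) + (\<Sum>x\<in>X. g x)"
  proof (rule sum.union_disjoint)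
    have "13 * k - 1 \<noteq> center i" for i
      using extra_mod center_div_mod(2)[of i] k by (metis diff_less less_irrefl zero_less_one less_le_trans)
    then show "center ` {..<m} \<inter> X = {}" by (auto simp: X_def)
  qed (auto simp: X_def)
  also have "(\<Sum>x\<in>center ` {..<m}. g x) = (\<Sum>i<m. g (center i))"
    using k by (simp add: sum.reindex inj_on_def)
  finally show ?thesis by (simp add: X_def)
qed

text \<open>The extra pile could fall on the hub only for k = 1 and m = 6, but it is present for odd
  m only.\<close>

lemma config_hub: "config hub = 0"
proof -
  have "hub \<noteq> 13 * k - 1" if "odd m"
  proof
    assume "hub = 13 * k - 1"
    then have "(13 * k - 1) mod (2 * k) = 0" by (metis mod_mult_self1_is_0)
    then have "k = 1" using k unfolding extra_mod by simp
    then have "2 * m = 12" using \<open>hub = 13 * k - 1\<close> by simp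
    then show False using that by presburger
  qed
  then show ?thesis by (auto simp: config_def)
qed

lemma alternating_sum: "(\<Sum>i<2 * h. if odd i then a else b) = h * (a + b)" for a b h :: nat
  by (induction h) (auto simp: algebra_simps)

text \<open>Beyond the first six segments every two consecutive ones hold 3Z - 2 pebbles; for odd m
  the segment 6 in between holds 2F = f(C_(n+1)) - 1 in its two piles.\<close>

lemma pile_sum:
  assumes m8: "8 \<le> m"
  shows "Suc ((\<Sum>i<m. pile i) + (if odd m then 2 * 2 ^ k div 3 else 0)) = threshold"
proof -
  let ?Z = "2 ^ k :: nat" and ?F = "2 * 2 ^ k div 3 :: nat"
  define h where "h = m div 2 - 3"
  have h: "m div 2 = h + 3" using m8 by (simp add: h_def)
  have six: "(\<Sum>i<6. pile i) = 3 * (?Z - 1) + (2 * ?Z - 1) + (4 * ?Z * ?Z - 1)"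
  proof -
    have "{..<6::nat} = {0, 1, 2, 3, 4, 5}" by auto
    then have "(\<Sum>i<6. pile i) = pile 0 + pile 1 + pile 2 + pile 3 + pile 4 + pile 5" by simp
    moreover have "pile 0 = 0" "pile 1 = ?Z - 1" "pile 2 = 2 * ?Z - 1" "pile 3 = ?Z - 1"
      "pile 4 = 4 * ?Z * ?Z - 1" "pile 5 = ?Z - 1" by (simp_all add: pile_def)
    ultimately show ?thesis by linarith
  qed
  have F: "fC (2 * k + 1) = 2 * ?F + 1" by (simp add: fC_def)
  have "(\<Sum>i<m. pile i) + (if odd m then ?F else 0)
     = (\<Sum>i<6. pile i) + h * ((?Z - 1) + (2 * ?Z - 1)) + (m mod 2) * (2 * ?F)"
  proof (cases "even m")
    case True
    then have "m = 2 * h + 6" using h by presburger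
    then have m_eq: "{..<m} = {0..<2 * h + 6}" by auto
    have "(\<Sum>i<m. pile i) = (\<Sum>i<6. pile i) + (\<Sum>i<2 * h. pile (i + 6))"
      unfolding m_eq unfolding lessThan_atLeast0
      using sum.atLeastLessThan_concat[of 0 6 "2 * h + 6" pile] sum.shift_bounds_nat_ivl[of pile 0 6 "2 * h"] by simp
    also have "(\<Sum>i<2 * h. pile (i + 6)) = (\<Sum>i<2 * h. if odd i then ?Z - 1 else 2 * ?Z - 1)"
      using True by (intro sum.cong) (auto simp: pile_def)
    finally show ?thesis using True by (simp add: alternating_sum)
  next
    case False
    then have "m = 2 * h + 7" using h by presburger
    then have m_eq: "{..<m} = {0..<2 * h + 7}" by auto
    have "(\<Sum>i<m. pile i) = (\<Sum>i<6. pile i) + pile 6 + (\<Sum>i<2 * h. pile (i + 7))"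
      unfolding m_eq unfolding lessThan_atLeast0
      using sum.atLeastLessThan_concat[of 0 7 "2 * h + 7" pile] sum.shift_bounds_nat_ivl[of pile 0 7 "2 * h"]
        sum.atLeastLessThan_concat[of 0 6 7 pile] by (simp add: eval_nat_numeral)
    also have "(\<Sum>i<2 * h. pile (i + 7)) = (\<Sum>i<2 * h. if odd i then ?Z - 1 else 2 * ?Z - 1)"
      using False by (intro sum.cong) (auto simp: pile_def)
    also have "pile 6 = ?F" using False by (simp add: pile_def)
    moreover have "m mod 2 = 1" using False by presburger
    ultimately show ?thesis using False by (simp add: alternating_sum)
  qed
  then have T: "(\<Sum>i<m. pile i) + (if odd m then ?F else 0)
     = 3 * (?Z - 1) + (2 * ?Z - 1) + (4 * ?Z * ?Z - 1) + h * ((?Z - 1) + (2 * ?Z - 1)) + (m mod 2) * (2 * ?F)"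
    unfolding six .
  have "int (?Z - 1) = 2 ^ k - 1" "int (2 * ?Z - 1) = 2 * 2 ^ k - 1" "int (4 * ?Z * ?Z - 1) = 4 * 2 ^ k * 2 ^ k - 1"
    by (simp_all add: of_nat_diff)
  then have "int ((\<Sum>i<m. pile i) + (if odd m then ?F else 0))
     = 3 * (2 ^ k - 1) + (2 * 2 ^ k - 1) + (4 * 2 ^ k * 2 ^ k - 1) + int h * ((2 ^ k - 1) + (2 * 2 ^ k - 1)) + int (m mod 2) * (2 * int ?F)"
    unfolding T of_nat_add of_nat_mult by simp
  moreover have "int threshold + 4 * 2 ^ k = 4 * 2 ^ k * 2 ^ k + 2 + (int h + 3) * (3 * 2 ^ k - 2) + int (m mod 2) * (2 * int ?F)"
    using threshold_int unfolding h F by simp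
  ultimately have "int ((\<Sum>i<m. pile i) + (if odd m then ?F else 0)) + 1 = int threshold"
    by (simp add: algebra_simps)
  then show ?thesis by linarith
qed

lemma config_distribution:
  assumes "8 \<le> m" shows "distribution G config (threshold - 1)"
  unfolding distribution_def
proof
  show "\<forall>x. x \<notin> verts G \<longrightarrow> config x = 0"
  proof (intro allI impI)
    fix x assume "x \<notin> verts G"
    then have "hub < x" by (simp add: verts_G)
    moreover have "2 * k * 8 \<le> 2 * k * m" using assms by (intro mult_le_mono) auto
    ultimately have "\<not> x < hub" "x \<noteq> 13 * k - 1" using k by linarith+
    then show "config x = 0" by (simp add: config_def)
  qed
  have "verts G = insert hub {..<hub}" by (auto simp: verts_G)
  then have "(\<Sum>x\<in>verts G. config x) = (\<Sum>x<hub. config x)" by (simp add: config_hub)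
  also have "\<dots> = (\<Sum>i<m. config (center i)) + (if odd m then config (13 * k - 1) else 0)"
    by (rule sum_config[OF assms]) simp
  also have "\<dots> = (\<Sum>i<m. pile i) + (if odd m then 2 * 2 ^ k div 3 else 0)"
    using config_extra by (auto simp: config_center)
  finally show "(\<Sum>x\<in>verts G. config x) = threshold - 1" using pile_sum[OF assms] by linarith
qed

lemma wsum_config:
  assumes "8 \<le> m" "\<And>x. x < hub \<Longrightarrow> f x \<le> config x"
  shows "wsum f w = (\<Sum>i\<in>{1..m - 1}. real (f (center i)) * w (center i))
    + (if odd m then real (f (13 * k - 1)) * w (13 * k - 1) else 0)"
proof -
  have "wsum f w = (\<Sum>i<m. real (f (center i)) * w (center i)) + (if odd m then real (f (13 * k - 1)) * w (13 * k - 1) else 0)"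
    unfolding wsum_def using assms by (intro sum_config) force+
  also have "(\<Sum>i<m. real (f (center i)) * w (center i)) = (\<Sum>i\<in>{1..m - 1}. real (f (center i)) * w (center i))"
  proof (rule sum.mono_neutral_right)
    have "f (center 0) = 0" using assms(2)[of "center 0"] config_center[of 0] center_less[of 0] m by (simp add: pile_def)
    moreover have "{..<m} - {1..m - 1} \<subseteq> {0}" by auto
    ultimately show "\<forall>i\<in>{..<m} - {1..m - 1}. real (f (center i)) * w (center i) = 0" by fastforce
  qed (use m in auto)
  finally show ?thesis .
qed

abbreviation z :: real where "z \<equiv> (1 / 2) ^ k"

lemma z_power: "z ^ i = (1 / 2) ^ (k * i)"
  by (simp add: power_mult)

lemma z_bounds: "0 < z" "z \<le> 1 / 2" "2 ^ k * z = 1"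
proof -
  show "z \<le> 1 / 2" using power_decreasing[of 1 k "1 / 2 :: real"] k by simp
  show "2 ^ k * z = 1" using half_power_mult[of k k] by simp
qed simp

lemma w1_center: "1 \<le> i \<Longrightarrow> w1 (center i) = z ^ (2 * i - 1)"
proof -
  assume "1 \<le> i"
  then obtain j where i: "i = Suc j" by (cases i) auto
  have "k \<le> 2 * k * i" using i by simp
  then have "w1 (center i) = (1 / 2) ^ (2 * k * i - k)" by (simp add: w1_def half_power_mult)
  also have "2 * k * i - k = k * (2 * i - 1)" by (simp add: diff_mult_distrib2)
  finally show ?thesis by (simp only: z_power)
qed

lemma w0_center: "1 \<le> i \<Longrightarrow> i \<le> m - 1 \<Longrightarrow> w0 (center (m - i)) = z ^ (2 * i - 1)"
proof -
  assume i: "1 \<le> i" "i \<le> m - 1"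
  define j where "j = m - i"
  then have j: "m = j + i" "1 \<le> j" using i m by auto
  have "k < center j" using j k by (cases j) auto
  then have "w0 (center j) = (1 / 2) ^ (hub - center j)" by (simp add: w0_def)
  also have "hub - center j = k * (2 * i - 1)" unfolding j(1) by (simp add: algebra_simps diff_mult_distrib2)
  finally show ?thesis using j by (simp add: z_power)
qed

text \<open>The extra pile is one step nearer on this side than the midpoint of segment 6, whose
  weight is z^11; in the other direction it is one step farther.\<close>

lemma w1_extra: "w1 (13 * k - 1) = 2 * z ^ 11"
proof -
  have "w1 (13 * k - 1) = (1 / 2) ^ (13 * k - 1 - k - k)" using k by (simp add: w1_def half_power_mult)
  also have "13 * k - 1 - k - k = k * 11 - 1" using k by simp
  also have "(1 / 2 :: real) ^ (k * 11 - 1) = 2 * (1 / 2) ^ (k * 11)"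
    using k by (cases "k * 11") auto
  finally show ?thesis by (simp only: z_power)
qed

lemma w0_extra: "8 \<le> m \<Longrightarrow> w0 (13 * k - 1) = z ^ (2 * (m - 6) - 1) / 2"
proof -
  assume m8: "8 \<le> m"
  obtain j where j: "m = j + 8" using m8 by (metis add.commute le_Suc_ex)
  have "w0 (13 * k - 1) = (1 / 2) ^ (hub - (13 * k - 1))" using k by (simp add: w0_def)
  also have "hub - (13 * k - 1) = Suc (k * (2 * (m - 6) - 1))" using k unfolding j by (simp add: algebra_simps)
  finally show ?thesis by (simp add: z_power)
qed

end

text \<open>Absorbs the extra pile into the load of its segment, so that the chain estimates see one
  load per segment.\<close>

lemma extra_summand:
  fixes w :: "nat \<Rightarrow> real"
  assumes "finite S" "p \<in> S"
  shows "(\<Sum>i\<in>S. g i * w i) + (if b then y * w p else 0) = (\<Sum>i\<in>S. (g i + (if b \<and> i = p then y else 0)) * w i)"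
proof -
  have "(\<Sum>i\<in>S. (g i + (if b \<and> i = p then y else 0)) * w i) = (\<Sum>i\<in>S. g i * w i + (if i = p then (if b then y * w p else 0) else 0))"
    by (intro sum.cong) (auto simp: distrib_right)
  then show ?thesis using assms by (simp add: sum.distrib)
qed

context jahangir_graph
begin

section \<open>The worth of the extremal configuration\<close>

lemma third_bound: "3 * real (2 * 2 ^ k div 3) < 2 * 2 ^ k"
proof -
  have "real (3 * (2 * 2 ^ k div 3)) < real (2 * 2 ^ k)"
    using three_not_dvd_power2[of k] by (simp only: of_nat_less_iff)
  then show ?thesis by simp
qed

lemma pile_le: "i \<noteq> 4 \<Longrightarrow> real (pile i) \<le> 2 * 2 ^ k"
  using third_bound by (auto simp: pile_def of_nat_diff)

lemma pile_small:
  assumes "odd i \<longleftrightarrow> even m \<or> i < 6" "i \<noteq> 4" "odd m \<Longrightarrow> i \<noteq> 6" shows "real (pile i) \<le> 2 ^ k - 1"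
  using assms by (auto simp: pile_def of_nat_diff)

lemma pile_large:
  assumes "\<not> (odd i \<longleftrightarrow> even m \<or> i < 6)" "i \<noteq> 4" "odd m \<Longrightarrow> i \<noteq> 6" "i \<noteq> 0" shows "real (pile i) \<le> 2 * 2 ^ k - 1"
  using assms by (auto simp: pile_def of_nat_diff)

lemma pile_four: "real (pile 4) = 4 * 2 ^ k * 2 ^ k - 1"
  by (simp add: pile_def of_nat_diff)

lemma chain_floor:
  assumes s: "s \<le> 1 - 4 * z ^ Suc d + real X * z ^ Suc (Suc d)" and X: "X \<le> pile 4" and d: "4 \<le> d"
  shows "2 * \<lfloor>s\<rfloor> \<le> int (X div (2 * 2 ^ k))"
proof (rule floor_chain)
  have "z ^ d \<le> z ^ 4" using z_bounds d by (intro power_decreasing) auto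
  also have "z ^ 4 \<le> (1 / 2) ^ 4" using z_bounds by (intro power_mono) auto
  finally have zd: "z ^ d \<le> 1 / 16" by (simp add: power_divide)
  have "real X \<le> 4 * 2 ^ k * 2 ^ k" using X pile_four by simp
  then have "real X * z ^ Suc (Suc d) \<le> (4 * 2 ^ k * 2 ^ k) * z ^ Suc (Suc d)" using z_bounds by (intro mult_right_mono) auto
  also have "\<dots> = 4 * (2 ^ k * z) * (2 ^ k * z) * z ^ d" by (simp only: power_Suc ac_simps)
  finally have "real X * z ^ Suc (Suc d) \<le> 4 * z ^ d" unfolding z_bounds(3) by simp
  moreover have "0 \<le> z ^ Suc d" using z_bounds by (intro zero_le_power) auto
  ultimately show "s < 2" using s zd by linarith
  assume "X < 4 * 2 ^ k"
  then have "real X < real (4 * 2 ^ k)" by (simp only: of_nat_less_iff)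
  then have "real X * z ^ Suc (Suc d) < (4 * 2 ^ k) * z ^ Suc (Suc d)"
    using z_bounds(1) by (intro mult_strict_right_mono zero_less_power) auto
  also have "\<dots> = 4 * (2 ^ k * z) * z ^ Suc d" by (simp only: power_Suc ac_simps)
  finally have "real X * z ^ Suc (Suc d) < 4 * z ^ Suc d" unfolding z_bounds(3) by simp
  then show "s < 1" using s by linarith
qed simp

lemma allocation_le:
  assumes "allocation config al" "c \<in> {0, 1, 2, 3}" "x < hub" shows "al c x \<le> config x"
proof -
  have "al 0 x + al 1 x + al 2 x + al 3 x \<le> config x" using assms by (simp add: allocation_def)
  then show ?thesis using assms(2) by auto
qed

lemma allocation_center:
  assumes "allocation config al" "c \<in> {0, 1, 2, 3}" "i < m" shows "al c (center i) \<le> pile i"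
  using allocation_le[OF assms(1,2) center_less[OF assms(3)]] config_center[OF assms(3)] by simp

lemma extra_less: "8 \<le> m \<Longrightarrow> 13 * k - 1 < hub"
proof -
  assume "8 \<le> m"
  then have "2 * k * 8 \<le> 2 * k * m" by (intro mult_le_mono) auto
  then show ?thesis using k by linarith
qed

lemma allocation_extra:
  assumes "allocation config al" "c \<in> {0, 1, 2, 3}" "8 \<le> m" "odd m" shows "al c (13 * k - 1) \<le> 2 * 2 ^ k div 3"
  using allocation_le[OF assms(1,2) extra_less[OF assms(3)]] unfolding config_extra[OF assms(4)] .

lemma worth_chain1:
  assumes m8: "8 \<le> m" and al: "allocation config al"
  shows "2 * \<lfloor>wsum (al 3) w1\<rfloor> \<le> int (al 3 (center 4) div (2 * 2 ^ k))"
proof -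
  let ?f = "al 3"
  have f: "?f x \<le> config x" if "x < hub" for x using allocation_le[OF al _ that] by simp
  have c: "real (?f (center i)) \<le> real (pile i)" if "i < m" for i using allocation_center[OF al _ that, of 3] by simp
  have e: "odd m \<Longrightarrow> real (?f (13 * k - 1)) \<le> real (2 * 2 ^ k div 3)"
    using allocation_extra[OF al _ m8, of 3] by (simp only: of_nat_le_iff) simp
  define q where "q i = real (?f (center i)) + (if odd m \<and> i = 6 then 2 * real (?f (13 * k - 1)) else 0)" for i
  have "wsum ?f w1 = (\<Sum>i\<in>{1..m - 1}. real (?f (center i)) * z ^ (2 * i - 1))
      + (if odd m then 2 * real (?f (13 * k - 1)) * z ^ (2 * 6 - 1) else 0)"
    using wsum_config[OF m8, of ?f w1, OF f] w1_extra by (simp add: w1_center)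
  also have "\<dots> = (\<Sum>i\<in>{1..m - 1}. q i * z ^ (2 * i - 1))"
    unfolding q_def by (rule extra_summand[where w = "\<lambda>i. z ^ (2 * i - 1)"]) (use m8 in auto)
  also have "\<dots> \<le> 1 - 4 * z ^ 6 + real (?f (center 4)) * z ^ 7"
  proof (rule chain_near)
    show "q 1 \<le> 2 ^ k - 1" using c[of 1] pile_small[of 1] m8 by (simp add: q_def)
    show "q 2 \<le> 2 * 2 ^ k - 1" using c[of 2] pile_large[of 2] m8 by (simp add: q_def)
    show "q 3 \<le> 2 ^ k - 1" using c[of 3] pile_small[of 3] m8 by (simp add: q_def)
    show "q 4 \<le> real (?f (center 4))" by (simp add: q_def)
    show "4 \<le> m - 1" using m8 by simp
    fix i assume i: "5 \<le> i" "i \<le> m - 1"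
    show "q i \<le> 2 * 2 ^ k"
    proof (cases "odd m \<and> i = 6")
      case True
      then have "real (pile i) = real (2 * 2 ^ k div 3)" by (simp add: pile_def)
      then show ?thesis using c[of i] e third_bound True i m8 by (simp add: q_def)
    next
      case False
      then have "q i = real (?f (center i))" by (auto simp: q_def)
      then show ?thesis using c[of i] pile_le[of i] i m8 by linarith
    qed
  qed (use z_bounds in auto)
  finally show ?thesis
    using chain_floor[of _ 5] allocation_center[OF al, of 3 4] m8 by simp
qed

lemma worth_chain0:
  assumes m8: "8 \<le> m" and al: "allocation config al"
  shows "2 * \<lfloor>wsum (al 2) w0\<rfloor> \<le> int (al 2 (center 4) div (2 * 2 ^ k))"
proof -
  let ?f = "al 2"
  have f: "?f x \<le> config x" if "x < hub" for x using allocation_le[OF al _ that] by simp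
  have c: "real (?f (center (m - i))) \<le> real (pile (m - i))" if "1 \<le> i" for i
    using allocation_center[OF al _, of 2 "m - i"] that m by simp
  have e: "odd m \<Longrightarrow> real (?f (13 * k - 1)) \<le> real (2 * 2 ^ k div 3)"
    using allocation_extra[OF al _ m8, of 2] by (simp only: of_nat_le_iff) simp
  define q where "q i = real (?f (center (m - i))) + (if odd m \<and> i = m - 6 then real (?f (13 * k - 1)) / 2 else 0)" for i
  have "(\<Sum>i\<in>{1..m - 1}. real (?f (center i)) * w0 (center i)) = (\<Sum>i\<in>{1..m - 1}. real (?f (center (m - i))) * w0 (center (m - i)))"
    by (rule sum.reindex_bij_witness[of _ "\<lambda>i. m - i" "\<lambda>i. m - i"]) auto
  also have "\<dots> = (\<Sum>i\<in>{1..m - 1}. real (?f (center (m - i))) * z ^ (2 * i - 1))"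
    using w0_center by (intro sum.cong) auto
  finally have "wsum ?f w0 = (\<Sum>i\<in>{1..m - 1}. real (?f (center (m - i))) * z ^ (2 * i - 1))
      + (if odd m then real (?f (13 * k - 1)) / 2 * z ^ (2 * (m - 6) - 1) else 0)"
    using wsum_config[OF m8, of ?f w0, OF f] w0_extra[OF m8] by simp
  also have "\<dots> = (\<Sum>i\<in>{1..m - 1}. q i * z ^ (2 * i - 1))"
    unfolding q_def by (rule extra_summand[where w = "\<lambda>i. z ^ (2 * i - 1)"]) (use m8 in auto)
  finally have S: "wsum ?f w0 = (\<Sum>i\<in>{1..m - 1}. q i * z ^ (2 * i - 1))" .
  have M: "4 \<le> m - 1" using m8 by simp
  have plain: "q i \<le> real (pile (m - i))" if "1 \<le> i" "\<not> (odd m \<and> i = m - 6)" for i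
  proof -
    have "q i = real (?f (center (m - i)))" using that(2) by (auto simp: q_def)
    then show ?thesis using c[OF that(1)] by linarith
  qed
  \<comment> \<open>Travelling in this direction the extra pile counts half, and F + F/2 <
    Z.\<close>
  have extra: "q i \<le> 2 ^ k" if "odd m" "i = m - 6" for i
  proof -
    have "m - i = 6" using that m8 by simp
    have "1 \<le> i" using that m8 by simp
    from c[OF this] have "real (?f (center (m - i))) \<le> real (2 * 2 ^ k div 3)"
      unfolding \<open>m - i = 6\<close> using that(1) by (simp add: pile_def)
    moreover have "q i = real (?f (center (m - i))) + real (?f (13 * k - 1)) / 2" using that by (simp add: q_def)
    ultimately show ?thesis using e[OF that(1)] third_bound by linarith
  qed
  have q1: "q 1 \<le> 2 ^ k - 1"
  proof -
    have "real (pile (m - 1)) \<le> 2 ^ k - 1"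
    proof (rule pile_small)
      show "odd (m - 1) \<longleftrightarrow> even m \<or> m - 1 < 6" using m8 by presburger
    qed (use m8 in auto)
    moreover have "\<not> (odd m \<and> 1 = m - 6)" using m8 by presburger
    ultimately show ?thesis using plain[of 1] by linarith
  qed
  have q2: "q 2 \<le> 2 * 2 ^ k - 1"
  proof -
    have "real (pile (m - 2)) \<le> 2 * 2 ^ k - 1"
    proof (rule pile_large)
      show "\<not> (odd (m - 2) \<longleftrightarrow> even m \<or> m - 2 < 6)" using m8 by presburger
      show "m - 2 \<noteq> 6" if "odd m" using that m8 by presburger
    qed (use m8 in auto)
    moreover have "\<not> (odd m \<and> 2 = m - 6)" using m8 by presburger
    ultimately show ?thesis using plain[of 2] by linarith
  qed
  have q_gen: "q i \<le> 2 * 2 ^ k" if "1 \<le> i" "i \<noteq> m - 4" "i \<le> m - 1" for i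
  proof (cases "odd m \<and> i = m - 6")
    case True
    then show ?thesis using extra[of i] by (auto intro: order_trans)
  next
    case False
    have "m - i \<noteq> 4" using that m8 by auto
    then show ?thesis using plain[OF that(1) False] pile_le[of "m - i"] by linarith
  qed
  have q4: "q (m - 4) \<le> real (?f (center 4))" using m8 by (auto simp: q_def)
  have X: "?f (center 4) \<le> pile 4" using allocation_center[OF al, of 2 4] m8 by simp
  show ?thesis
  \<comment> \<open>From this side the large pile lies in segment number m - 4, which is the fourth
    for m = 8 and farther away otherwise.\<close>
  proof (cases "m = 8")
    case True
    have "wsum ?f w0 \<le> 1 - 4 * z ^ 6 + real (?f (center 4)) * z ^ 7"
      unfolding S
    proof (rule chain_near[OF _ _ _ M q1 q2])
      show "q 3 \<le> 2 ^ k - 1" using plain[of 3] pile_small[of 5] True by simp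
      show "q 4 \<le> real (?f (center 4))" using q4 True by simp
      show "q i \<le> 2 * 2 ^ k" if "5 \<le> i" "i \<le> m - 1" for i using q_gen[of i] that True by simp
    qed (use z_bounds in auto)
    then show ?thesis using chain_floor[of _ 5] X by simp
  next
    case False
    have "wsum ?f w0 \<le> 1 - 4 * z ^ 8 + real (?f (center 4)) * z ^ 9"
      unfolding S
    proof (rule chain_far[OF _ _ _ M _ _ q1 q2])
      show "5 \<le> m - 4" using m8 False by simp
      show "q 3 \<le> 2 ^ k"
      proof (cases "m = 9")
        case True
        then show ?thesis using extra[of 3] by simp
      next
        case m9: False
        have "real (pile (m - 3)) \<le> 2 ^ k - 1"
          using m8 False m9 by (intro pile_small) auto
        moreover have "\<not> (odd m \<and> 3 = m - 6)" using m8 False m9 by presburger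
        ultimately show ?thesis using plain[of 3] by linarith
      qed
      show "q i \<le> (if i = m - 4 then real (?f (center 4)) else 2 * 2 ^ k)" if "4 \<le> i" "i \<le> m - 1" for i
        using q_gen[of i] q4 that by auto
    qed (use z_bounds in auto)
    then show ?thesis using chain_floor[of _ 7] X by simp
  qed
qed

lemma wsum_wl:
  assumes m8: "8 \<le> m" and f: "\<And>x. x < hub \<Longrightarrow> f x \<le> config x" and j: "j \<in> {2..<m}"
  shows "wsum f (wl j) = real (f (center j)) * z + (if odd m \<and> j = 6 then real (f (13 * k - 1)) * (1 / 2) ^ (k - 1) else 0)"
proof -
  have "k - 1 < 2 * k" using k by linarith
  note e = wl_at[OF this, of j 6, folded extra_eq]
  have "wl j (center i) = (if i = j then z else 0)" for i using wl_at[of k j i] k by simp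
  then have "(\<Sum>i\<in>{1..m - 1}. real (f (center i)) * wl j (center i)) = (\<Sum>i\<in>{1..m - 1}. if i = j then real (f (center j)) * z else 0)"
    by (intro sum.cong) auto
  also have "\<dots> = real (f (center j)) * z"
  proof -
    have "j \<in> {1..m - 1}" using j by auto
    then show ?thesis by simp
  qed
  finally show ?thesis
    using wsum_config[OF m8, of f "wl j", OF f] unfolding e by auto
qed

lemma wsum_wr:
  assumes m8: "8 \<le> m" and f: "\<And>x. x < hub \<Longrightarrow> f x \<le> config x" and j: "j \<in> {2..<m}"
  shows "wsum f (wr j) \<le> real (f (center (j - 1))) * z + (if odd m \<and> j = 7 then real (f (13 * k - 1)) * (z / 2) else 0)"
proof -
  have "wr j (center i) = (if i = j - 1 then z else 0)" for i using wr_at[of k j i] k j by auto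
  then have "(\<Sum>i\<in>{1..m - 1}. real (f (center i)) * wr j (center i)) = (\<Sum>i\<in>{1..m - 1}. if i = j - 1 then real (f (center (j - 1))) * z else 0)"
    by (intro sum.cong) auto
  also have "\<dots> = real (f (center (j - 1))) * z"
  proof -
    have "j - 1 \<in> {1..m - 1}" using j by auto
    then show ?thesis by simp
  qed
  finally have S: "(\<Sum>i\<in>{1..m - 1}. real (f (center i)) * wr j (center i)) = \<dots>" .
  have "wr j (13 * k - 1) \<le> (if j = 7 then z / 2 else 0)"
  proof -
    have "2 * k - (k - 1) = Suc k" using k by simp
    then show ?thesis using wr_at[of "k - 1" j 6, folded extra_eq] k by simp
  qed
  then have "real (f (13 * k - 1)) * wr j (13 * k - 1) \<le> real (f (13 * k - 1)) * (if j = 7 then z / 2 else 0)"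
    by (rule mult_left_mono) simp
  then show ?thesis
    using wsum_config[OF m8, of f "wr j", OF f] S by (auto split: if_splits)
qed

lemma pile_floor:
  assumes "real a \<le> 2 ^ k - 1" shows "real a * z < 1"
proof -
  have "real a * z \<le> (2 ^ k - 1) * z" using assms z_bounds by (intro mult_right_mono) auto
  also have "\<dots> = 2 ^ k * z - z" by (simp only: left_diff_distrib mult_1)
  finally show ?thesis unfolding z_bounds(3) using z_bounds(1) by linarith
qed

lemma pile_floor2:
  assumes "real a \<le> 2 * 2 ^ k - 1" shows "real a * z < 2"
proof -
  have "real a * z \<le> (2 * 2 ^ k - 1) * z" using assms z_bounds by (intro mult_right_mono) auto
  also have "\<dots> = 2 * (2 ^ k * z) - z" by (simp only: left_diff_distrib mult.assoc mult_1)
  finally show ?thesis unfolding z_bounds(3) using z_bounds(1) by linarith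
qed

lemma floor_center: "\<lfloor>real a * z\<rfloor> = int (a div 2 ^ k)"
proof -
  have "real a * z = real a / real (2 ^ k)" by (simp add: power_divide)
  then show ?thesis by (simp only: floor_divide_of_nat_eq)
qed

lemma center_div2: "int (a div 2 ^ k) div 2 = int (a div (2 * 2 ^ k))"
proof -
  have "a div (2 * 2 ^ k) = a div 2 ^ k div 2" by (metis div_mult2_eq mult.commute)
  then show ?thesis by (simp add: zdiv_int)
qed

text \<open>Without the large pile each of the two segments at a spoke sends at most one pebble
  there, and by the alternation of loads one of them sends none, so no two pebbles meet. The large
  pile alone can pair its own pebbles.\<close>

lemma worth_local:
  assumes m8: "8 \<le> m" and al: "allocation config al" and j: "j \<in> {2..<m}"
  shows "(\<lfloor>wsum (al 0) (wl j)\<rfloor> + \<lfloor>wsum (al 1) (wr j)\<rfloor>) div 2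
    \<le> (if j = 4 then int (al 0 (center 4) div (2 * 2 ^ k)) else 0) + (if j = 5 then int (al 1 (center 4) div (2 * 2 ^ k)) else 0)"
proof -
  define A where "A = \<lfloor>wsum (al 0) (wl j)\<rfloor>"
  define B where "B = \<lfloor>wsum (al 1) (wr j)\<rfloor>"
  define small :: "nat \<Rightarrow> bool" where "small i \<longleftrightarrow> (odd i \<longleftrightarrow> even m \<or> i < 6)" for i
  have f0: "al 0 x \<le> config x" if "x < hub" for x using allocation_le[OF al _ that] by simp
  have f1: "al 1 x \<le> config x" if "x < hub" for x using allocation_le[OF al _ that] by simp
  have c0: "real (al 0 (center i)) \<le> real (pile i)" if "i < m" for i using allocation_center[OF al _ that, of 0] by simp
  have c1: "real (al 1 (center i)) \<le> real (pile i)" if "i < m" for i using allocation_center[OF al _ that, of 1] by simp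
  have e0: "odd m \<Longrightarrow> real (al 0 (13 * k - 1)) \<le> real (2 * 2 ^ k div 3)"
    using allocation_extra[OF al _ m8, of 0] by (simp only: of_nat_le_iff) simp
  have e1: "odd m \<Longrightarrow> real (al 1 (13 * k - 1)) \<le> real (2 * 2 ^ k div 3)"
    using allocation_extra[OF al _ m8, of 1] by (simp only: of_nat_le_iff) simp
  have p6: "odd m \<Longrightarrow> pile 6 = 2 * 2 ^ k div 3" by (simp add: pile_def)
  note S0 = wsum_wl[OF m8, of "al 0", OF f0 j]
  note S1 = wsum_wr[OF m8, of "al 1", OF f1 j]
  have third_z: "3 * (real (2 * 2 ^ k div 3) * z) < 2"
  proof -
    have "3 * real (2 * 2 ^ k div 3) * z < 2 * 2 ^ k * z" by (rule mult_strict_right_mono[OF third_bound z_bounds(1)])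
    then show ?thesis using z_bounds(3) by (simp add: mult.assoc)
  qed
  have A0: "A \<le> 0" if "small j" "\<not> (odd m \<and> j = 6)" "j \<noteq> 4"
  proof -
    have "real (al 0 (center j)) \<le> 2 ^ k - 1" using c0[of j] pile_small[of j] that j unfolding small_def by fastforce
    from pile_floor[OF this] show ?thesis using S0 that by (auto simp: A_def floor_le_iff)
  qed
  have A1: "A \<le> 1" if "j \<noteq> 4"
  proof -
    consider "small j" "\<not> (odd m \<and> j = 6)" | "odd m" "j = 6" | "\<not> small j" "\<not> (odd m \<and> j = 6)" by blast
    then show ?thesis
    proof cases
      case 1
      then show ?thesis using A0 that by simp
    next
      case 2
      \<comment> \<open>For spoke 6 the extra pile counts double, so the load amounts to at most 3F
        < 2Z.\<close>
      have "(1 / 2 :: real) ^ (k - 1) = 2 * z" using k by (cases k) auto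
      then have "wsum (al 0) (wl j) = (real (al 0 (center 6)) + 2 * real (al 0 (13 * k - 1))) * z"
        using S0 2 by (simp add: distrib_right)
      also have "\<dots> \<le> (3 * real (2 * 2 ^ k div 3)) * z"
        using c0[of 6] e0 p6 2 m8 z_bounds by (intro mult_right_mono) auto
      also have "\<dots> < 2" using third_z by (simp add: mult.assoc)
      finally show ?thesis by (simp add: A_def floor_le_iff)
    next
      case 3
      have "real (al 0 (center j)) \<le> 2 * 2 ^ k - 1" using c0[of j] pile_large[of j] 3 that j unfolding small_def by fastforce
      from pile_floor2[OF this] show ?thesis using S0 3 by (auto simp: A_def floor_le_iff)
    qed
  qed
  have B_plain: "B \<le> \<lfloor>real (al 1 (center (j - 1))) * z\<rfloor>" if "\<not> (odd m \<and> j = 7)"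
    unfolding B_def using S1 that by (intro floor_mono) (auto split: if_splits)
  have B0: "B \<le> 0" if "small (j - 1)" "j \<noteq> 5"
  proof (cases "odd m \<and> j = 7")
    case True
    have "wsum (al 1) (wr j) \<le> (real (al 1 (center 6)) + real (al 1 (13 * k - 1)) / 2) * z"
      using S1 True by (simp add: distrib_right)
    also have "\<dots> \<le> (3 / 2 * real (2 * 2 ^ k div 3)) * z"
      using c1[of 6] e1 p6 True m8 z_bounds by (intro mult_right_mono) auto
    also have "\<dots> < 1" using third_z by (simp add: mult.assoc)
    finally show ?thesis by (simp add: B_def floor_le_iff)
  next
    case False
    have "real (al 1 (center (j - 1))) \<le> 2 ^ k - 1"
    proof -
      have "real (pile (j - 1)) \<le> 2 ^ k - 1"
        by (rule pile_small) (use that False j in \<open>auto simp: small_def\<close>)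
      moreover have "j - 1 < m" using j by auto
      ultimately show ?thesis using c1[of "j - 1"] by linarith
    qed
    from pile_floor[OF this] have "\<lfloor>real (al 1 (center (j - 1))) * z\<rfloor> \<le> 0" by (simp add: floor_le_iff)
    then show ?thesis using B_plain[OF False] by linarith
  qed
  have B1: "B \<le> 1" if "j \<noteq> 5"
  proof (cases "small (j - 1)")
    case True
    then show ?thesis using B0 that by simp
  next
    case False
    have n7: "\<not> (odd m \<and> j = 7)" using False by (auto simp: small_def)
    have "real (pile (j - 1)) \<le> 2 * 2 ^ k - 1"
      by (rule pile_large) (use that False n7 j in \<open>auto simp: small_def\<close>)
    moreover have "j - 1 < m" using j by auto
    ultimately have "real (al 1 (center (j - 1))) \<le> 2 * 2 ^ k - 1" using c1[of "j - 1"] by linarith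
    from pile_floor2[OF this] have "\<lfloor>real (al 1 (center (j - 1))) * z\<rfloor> \<le> 1" by (simp add: floor_le_iff)
    then show ?thesis using B_plain[OF n7] by linarith
  qed
  consider "j = 4" | "j = 5" | "j \<noteq> 4" "j \<noteq> 5" by blast
  then have "(A + B) div 2 \<le> (if j = 4 then int (al 0 (center 4) div (2 * 2 ^ k)) else 0) + (if j = 5 then int (al 1 (center 4) div (2 * 2 ^ k)) else 0)"
  proof cases
    case 1
    have "A = int (al 0 (center 4) div 2 ^ k)" using S0 1 floor_center by (simp add: A_def)
    moreover have "B \<le> 0" by (rule B0) (use 1 in \<open>auto simp: small_def\<close>)
    ultimately have "(A + B) div 2 \<le> int (al 0 (center 4) div 2 ^ k) div 2" by (intro zdiv_mono1) auto
    then show ?thesis unfolding center_div2 using 1 by simp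
  next
    case 2
    have "B \<le> int (al 1 (center 4) div 2 ^ k)" using B_plain floor_center[of "al 1 (center 4)"] 2 by simp
    moreover have "A \<le> 0" by (rule A0) (use 2 in \<open>auto simp: small_def\<close>)
    ultimately have "(A + B) div 2 \<le> int (al 1 (center 4) div 2 ^ k) div 2" by (intro zdiv_mono1) auto
    then show ?thesis unfolding center_div2 using 2 by simp
  next
    case 3
    have "A \<le> 0 \<or> B \<le> 0"
    proof (cases "small (j - 1)")
      case True
      then show ?thesis using B0 3 by blast
    next
      case False
      obtain i where i: "j = Suc i" using j by (cases j) auto
      have "small j" using False unfolding small_def i by auto
      moreover have "\<not> (odd m \<and> j = 6)" using False by (auto simp: small_def)
      ultimately show ?thesis using A0 3 by blast
    qed
    then have "A + B \<le> 1" using A1 B1 3 by linarith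
    then have "(A + B) div 2 \<le> 0" by linarith
    then show ?thesis using 3 by simp
  qed
  then show ?thesis by (simp only: A_def B_def)
qed

lemma config_bounded_worth:
  assumes m8: "8 \<le> m" shows "bounded_worth config"
  unfolding bounded_worth_def
proof (intro allI impI)
  fix al assume al: "allocation config al"
  let ?a = "\<lambda>c. al c (center 4)" and ?W = "2 * 2 ^ k :: nat"
  have "(\<Sum>j\<in>{2..<m}. (\<lfloor>wsum (al 0) (wl j)\<rfloor> + \<lfloor>wsum (al 1) (wr j)\<rfloor>) div 2)
    \<le> (\<Sum>j\<in>{2..<m}. (if j = 4 then int (?a 0 div ?W) else 0) + (if j = 5 then int (?a 1 div ?W) else 0))"
    by (intro sum_mono worth_local[OF m8 al])
  also have "\<dots> = int (?a 0 div ?W) + int (?a 1 div ?W)"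
    using m8 by (simp add: sum.distrib)
  finally have W: "worth al (int (config hub)) \<le> int (?a 0 div ?W + ?a 1 div ?W + ?a 2 div ?W + ?a 3 div ?W)"
    using worth_chain0[OF m8 al] worth_chain1[OF m8 al] unfolding worth_def config_hub by simp
  have "?a 0 div ?W + ?a 1 div ?W + ?a 2 div ?W + ?a 3 div ?W \<le> (?a 0 + ?a 1 + ?a 2 + ?a 3) div ?W"
  proof -
    have add: "x div ?W + y div ?W \<le> (x + y) div ?W" for x y
      unfolding div_add1_eq[of x y] by (rule le_add1)
    show ?thesis
      using add[of "?a 0" "?a 1"] add[of "?a 0 + ?a 1" "?a 2"] add[of "?a 0 + ?a 1 + ?a 2" "?a 3"] by linarith
  qed
  also have "(?a 0 + ?a 1 + ?a 2 + ?a 3) div ?W < ?W"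
  proof -
    have "?a 0 + ?a 1 + ?a 2 + ?a 3 \<le> pile 4"
    proof -
      have "4 < m" using m8 by simp
      from al center_less[OF this] have "?a 0 + ?a 1 + ?a 2 + ?a 3 \<le> config (center 4)"
        unfolding allocation_def by blast
      then show ?thesis using config_center[OF \<open>4 < m\<close>] by simp
    qed
    \<comment> \<open>This fixes the size of the large pile: with one pebble more it would be worth
      2Z hub pebbles.\<close>
    also have "pile 4 < ?W * ?W"
      by (simp add: pile_def mult.assoc)
    finally show ?thesis by (simp add: less_mult_imp_div_less)
  qed
  finally have "int (?a 0 div ?W + ?a 1 div ?W + ?a 2 div ?W + ?a 3 div ?W) < int ?W"
    by (simp only: of_nat_less_iff)
  then show "worth al (int (config hub)) < 2 * 2 ^ k" using W by simp
qed

theorem pebbling_number_threshold: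
  assumes m8: "8 \<le> m" shows "pebbling_number G = threshold"
proof -
  have pos: "threshold = Suc (threshold - 1)" using pile_sum[OF m8] by linarith
  have "t_pebbling_number 1 G = Suc (threshold - 1)"
  proof (rule t_pebbling_number_eqI)
    show "finite (verts G)" by (simp add: verts_G)
    show "yields G D (single w 1)" if "distribution G D (Suc (threshold - 1))" "w \<in> verts G" for D w
      using upper_bound[of D w] that pos by simp
    show "distribution G config (threshold - 1)" by (rule config_distribution[OF m8])
    show "k \<in> verts G" using hub_ge k by (simp add: verts_G)
    show "\<not> yields G config (single k 1)" by (rule bounded_worth_unsolvable[OF config_bounded_worth[OF m8]])
  qed
  then show ?thesis using pos by (simp add: pebbling_number_def)
qed

end

theorem theorem2p10:
  fixes n m :: nat
  assumes "even n" "n \<ge> 2" "m \<ge> 8"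
  shows "int (pebbling_number (jahangir n m)) =
           int (t_pebbling_number (2 ^ (n div 2 + 1) - 1) (cycle_graph (n + 2)))
             + jahangir_alpha n m + 1
         \<and> pebbling_number (jahangir 2 m) = 2 * m + 10"
proof
  obtain k where n: "n = 2 * k" using assms(1) by (elim evenE)
  interpret jahangir_graph k m using assms n by unfold_locales auto
  have "t_pebbling_number (2 ^ Suc k - 1) (cycle_graph (2 * Suc k)) = (2 ^ Suc k - 1) * 2 ^ Suc k"
  proof (rule t_pebbling_number_even_cycle)
    have "(1::nat) \<le> 2 ^ k" by simp
    then show "1 \<le> 2 ^ Suc k - (1::nat)" unfolding power_Suc by linarith
  qed (use k in simp)
  then have "int (t_pebbling_number (2 ^ (n div 2 + 1) - 1) (cycle_graph (n + 2))) = (2 * 2 ^ k - 1) * (2 * 2 ^ k)"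
    unfolding n by (simp add: of_nat_diff)
  moreover have "int (pebbling_number (jahangir n m)) = int threshold"
    unfolding n using pebbling_number_threshold assms by simp
  moreover have "jahangir_alpha n m = (if even m
     then int (m div 2) * (2 ^ k + 2 * 2 ^ k - 2) - 2 * 2 ^ k + 1
     else int (m div 2) * (2 ^ k + 2 * 2 ^ k - 2) + int (fC (2 * k + 1)) - 2 * 2 ^ k)"
    unfolding n jahangir_alpha_def by (auto simp: fC_def elim!: oddE)
  ultimately show "int (pebbling_number (jahangir n m)) =
           int (t_pebbling_number (2 ^ (n div 2 + 1) - 1) (cycle_graph (n + 2)))
             + jahangir_alpha n m + 1"
    using threshold_int by (auto simp: algebra_simps odd_iff_mod_2_eq_one)
next
  interpret J: jahangir_graph 1 m using assms by unfold_locales auto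
  have "int (pebbling_number (jahangir 2 m)) = 2 * int m + 10"
  proof -
    have "int m = 2 * int (m div 2) + int (m mod 2)" by presburger
    then show ?thesis
      using J.pebbling_number_threshold J.threshold_int assms by (simp add: fC_def)
  qed
  then show "pebbling_number (jahangir 2 m) = 2 * m + 10" by linarith
qed

end
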